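(* Let $\mathcal L$ be an affine subspace of $\mathbb R^n$ and let $\mathcal M$ be a submanifold of $\mathcal L$ which is nondegenerate in $\mathcal L$. Then $$\omega(\mathcal M)=\omega(\mathcal L)=\inf\{\omega(y)\mid y\in\mathcal L\}=\inf\{\omega(y)\mid y\in\mathcal M\}.$$
   Context: For a row vector $y\in\mathbb R^n$ and $q\in\mathbb Z^n$ write $yq=\sum y_iq_i$. The Diophantine exponent $\omega(y)$ is the supremum of $v>0$ such that there are infinitely many $q\in\mathbb Z^n$ with $|yq+p|<\|q\|^{-v}$ for some $p\in\mathbb Z$. For a Borel measure $\mu$ on $\mathbb R^n$, $\omega(\mu)=\sup\{v\mid \mu(\{y\mid\omega(y)>v\})>0\}$. For a smooth submanifold $\mathcal M$ (including an affine subspace), $\omega(\mathcal M)$ is $\omega$ of its Riemannian volume measure (equivalently of $f_*\lambda$ for any smooth parametrization $f$). A differentiable map $f:U\to\mathbb R^n$, $U\subset\mathbb R^d$ open, is nondegenerate in an affine subspace $\mathcal L$ at $x\in U$ if $f(U)\subset\mathcal L$ and the linear span of all partial derivatives of $f$ at $x$ up to some order equals the linear part of $\mathcal L$. A $d$-dimensional submanifold $\mathcal M\subset\mathcal L$ is nondegenerate in $\mathcal L$ at $y\in\mathcal M$ if some (equivalently any) diffeomorphism $f$ from an open subset of $\mathbb R^d$ onto a neighborhood of $y$ in $\mathcal M$ is nondegenerate in $\mathcal L$ at $f^{-1}(y)$; $\mathcal M$ is nondegenerate in $\mathcal L$ if this holds at almost every point of $\mathcal M$ (w.r.t. the smooth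 measure class). *)

theory Defs
  imports "HOL-Analysis.Analysis"
begin

definition int_vec :: "real^'n \<Rightarrow> bool" where
  "int_vec q \<longleftrightarrow> (\<forall>i. q $ i \<in> \<int>)"

definition dio_exp :: "real^'n \<Rightarrow> ereal" where
  "dio_exp y = Sup {ereal v | v. v > 0 \<and>
      infinite {q. int_vec q \<and> (\<exists>p::int. \<bar>y \<bullet> q + of_int p\<bar> < norm q powr (- v))}}"

definition pderiv1 :: "'d::finite \<Rightarrow> (real^'d \<Rightarrow> real^'n) \<Rightarrow> real^'d \<Rightarrow> real^'n" where
  "pderiv1 i g x = frechet_derivative g (at x) (axis i 1)"

fun pderivs :: "'d::finite list \<Rightarrow> (real^'d \<Rightarrow> real^'n) \<Rightarrow> real^'d \<Rightarrow> real^'n" where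
  "pderivs [] g = g"
| "pderivs (i # is) g = pderiv1 i (pderivs is g)"

definition smooth_on :: "(real^'d::finite) set \<Rightarrow> (real^'d \<Rightarrow> real^'n) \<Rightarrow> bool" where
  "smooth_on U f \<longleftrightarrow> (\<forall>is. \<forall>x\<in>U. pderivs is f differentiable (at x))"

definition is_chart :: "(real^'d::finite) set \<Rightarrow> (real^'d \<Rightarrow> real^'n) \<Rightarrow> (real^'n) set \<Rightarrow> bool" where
  "is_chart U f M \<longleftrightarrow> open U \<and> smooth_on U f \<and>
     (\<forall>x\<in>U. inj (frechet_derivative f (at x))) \<and>
     f ` U \<subseteq> M \<and> openin (top_of_set M) (f ` U) \<and>
     (\<exists>g. homeomorphism U (f ` U) f g)"

definition submanifold :: "'d::finite itself \<Rightarrow> (real^'n) set \<Rightarrow> bool" where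
  "submanifold TYPE('d) M \<longleftrightarrow>
     (\<forall>y\<in>M. \<exists>(U::(real^'d) set) f. is_chart U f M \<and> y \<in> f ` U)"

text \<open>Null sets of the smooth measure class (Riemannian volume) of a CARD('d)-dimensional
  submanifold: sets whose preimage under every chart is Lebesgue null.\<close>
definition null_in :: "'d::finite itself \<Rightarrow> (real^'n) set \<Rightarrow> (real^'n) set \<Rightarrow> bool" where
  "null_in TYPE('d) M A \<longleftrightarrow>
     (\<forall>(U::(real^'d) set) f. is_chart U f M \<longrightarrow> f -` A \<inter> U \<in> null_sets lebesgue)"

definition dio_exp_mfd :: "'d::finite itself \<Rightarrow> (real^'n) set \<Rightarrow> ereal" where
  "dio_exp_mfd TYPE('d) M =
     Sup {ereal v | v. \<not> null_in TYPE('d) M {y \<in> M. dio_exp y > ereal v}}"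

definition lin_part :: "(real^'n) set \<Rightarrow> (real^'n) set" where
  "lin_part L = {a - b | a b. a \<in> L \<and> b \<in> L}"

definition nondeg_at :: "(real^'n) set \<Rightarrow> (real^'d::finite \<Rightarrow> real^'n) \<Rightarrow> (real^'d) set \<Rightarrow> real^'d \<Rightarrow> bool" where
  "nondeg_at L f U x \<longleftrightarrow> f ` U \<subseteq> L \<and>
     (\<exists>k. span {pderivs is f x | is. 1 \<le> length is \<and> length is \<le> k} = lin_part L)"

definition mfd_nondeg_at :: "'d::finite itself \<Rightarrow> (real^'n) set \<Rightarrow> (real^'n) set \<Rightarrow> real^'n \<Rightarrow> bool" where
  "mfd_nondeg_at TYPE('d) L M y \<longleftrightarrow>
     (\<exists>(U::(real^'d) set) f x. is_chart U f M \<and> x \<in> U \<and> f x = y \<and> nondeg_at L f U x)"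

definition mfd_nondeg :: "'d::finite itself \<Rightarrow> (real^'n) set \<Rightarrow> (real^'n) set \<Rightarrow> bool" where
  "mfd_nondeg TYPE('d) L M \<longleftrightarrow>
     M \<subseteq> L \<and> null_in TYPE('d) M {y \<in> M. \<not> mfd_nondeg_at TYPE('d) L M y}"

end

theory Submission
  imports Defs "HOL-Computational_Algebra.Polynomial"
begin

text \<open>
  If some \<open>y\<^sub>0 \<in> L\<close> has exponent below \<open>v\<close>, then for every \<open>X \<ge> 1\<close> the lattice of integer
  vectors \<open>(p, q)\<close>, mapped by \<open>(p, q) \<mapsto> (X\<^sup>v (p + y\<^sub>0 q) / c, q / X)\<close>, has no vector shorter than 1,
  so by Minkowski's theorem the covolumes of all its rational sublattices are bounded below. As functions of \<open>y\<close>
  these covolumes are maxima of affine functions, so the bound passes from \<open>y\<^sub>0\<close> to the supremum over any small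
  piece of a curve whose derivatives span the direction of \<open>L\<close>. The
  Kleinbock--Margulis nondivergence argument then shows that, outside a set of measure decaying like a power of
  \<open>X\<close>, the lattices along the curve have no short vectors; Borel--Cantelli gives exponent at most \<open>v\<close>
  almost everywhere on the curve.

  Working on curves keeps this argument on the real line. A manifold that is nondegenerate in \<open>L\<close> is reached
  through translates of one polynomial curve \<open>t \<mapsto> (t\<^bsup>N\<^sub>i\<^esup>)\<^sub>i\<close>, whose exponents keep the Taylor monomials of
  the parametrization apart, and Fubini's theorem.
\<close>

section \<open>Functions with good sublevel sets on intervals\<close>

text \<open>All quantities are caught in one circle: each y in L bounds the exponent of M from
  above, the infimum over L is at most the one over M, and a chart domain of positive measure makes
  the latter a lower bound for the exponent of M. Since L is a nondegenerate submanifold of itself,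
  it enters the same circle. The obstacle is uniformity. Each scale X involves infinitely many
  rational subspaces, hence affine forms with arbitrary coefficients, while the piece of curve must
  not shrink as X grows. So the good sublevel sets of an affine form, and the comparison of its
  value at one point of L with its supremum on the curve, come with constants that do not depend on
  the coefficients; compactness of the unit sphere in the direction of L provides them. The
  nondivergence estimate trades excluded sets of measure about \<tau> against vectors of length
  about \<open>\<tau> ^ K\<close>. Taking \<open>\<tau> ^ K\<close> to be a small negative power of
  X costs that power in the approximation, and the gap between two exponents v < v' pays for
  it.\<close>

lemma spaced_points_derivative_small:
  fixes G :: "nat \<Rightarrow> real \<Rightarrow> real"
  assumes "\<And>j t. j < k \<Longrightarrow> t \<in> {a..b} \<Longrightarrow> (G j has_real_derivative G (Suc j) t) (at t)"
    and "0 < s" "0 \<le> \<epsilon>"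
    and "\<And>i. i < 2^k \<Longrightarrow> x i \<in> {a..b}"
    and "\<And>i. Suc i < 2^k \<Longrightarrow> x i + s \<le> x (Suc i)"
    and "\<And>i. i < 2^k \<Longrightarrow> \<bar>G 0 (x i)\<bar> \<le> \<epsilon>"
  shows "\<exists>\<xi>\<in>{a..b}. \<bar>G k \<xi>\<bar> \<le> \<epsilon> * (2/s)^k"
  using assms
proof (induction k arbitrary: G x \<epsilon>)
  case 0
  then show ?case by (intro bexI[of _ "x 0"]) auto
next
  case (Suc k)
  \<comment> \<open>The mean value theorem is applied to disjoint pairs of neighbours, which keeps the new points \<open>s\<close> apart.\<close>
  have "\<exists>\<xi>. i < 2^k \<longrightarrow> x (2*i) < \<xi> \<and> \<xi> < x (Suc (2*i)) \<and> \<bar>G 1 \<xi>\<bar> \<le> \<epsilon> * 2 / s" for i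
  proof (cases "i < 2^k")
    case True
    then have i: "Suc (2*i) < 2 ^ Suc k" "2*i < 2 ^ Suc k" by auto
    have gap: "x (2*i) + s \<le> x (Suc (2*i))" using Suc.prems(5)[OF i(1)] .
    have xin: "x (2*i) \<in> {a..b}" "x (Suc (2*i)) \<in> {a..b}" using Suc.prems(4) i by blast+
    have "\<exists>z. x (2*i) < z \<and> z < x (Suc (2*i)) \<and>
        G 0 (x (Suc (2*i))) - G 0 (x (2*i)) = (x (Suc (2*i)) - x (2*i)) * G (Suc 0) z"
      using gap \<open>0 < s\<close> xin by (intro MVT2 Suc.prems(1)) auto
    then obtain z where z: "x (2*i) < z" "z < x (Suc (2*i))"
      "G 0 (x (Suc (2*i))) - G 0 (x (2*i)) = (x (Suc (2*i)) - x (2*i)) * G (Suc 0) z" by blast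
    have "s * \<bar>G (Suc 0) z\<bar> \<le> (x (Suc (2*i)) - x (2*i)) * \<bar>G (Suc 0) z\<bar>"
      using gap by (intro mult_right_mono) auto
    also have "\<dots> = \<bar>G 0 (x (Suc (2*i))) - G 0 (x (2*i))\<bar>"
      using z gap \<open>0 < s\<close> by (simp add: abs_mult)
    also have "\<dots> \<le> 2 * \<epsilon>"
      using Suc.prems(6)[OF i(1)] Suc.prems(6)[OF i(2)] by linarith
    finally show ?thesis using z \<open>0 < s\<close> by (auto simp: field_simps intro!: exI[of _ z])
  qed simp
  then obtain y where y: "\<And>i. i < 2^k \<Longrightarrow> x (2*i) < y i \<and> y i < x (Suc (2*i)) \<and> \<bar>G 1 (y i)\<bar> \<le> \<epsilon> * 2 / s"
    by metis
  have "\<exists>\<xi>\<in>{a..b}. \<bar>(\<lambda>j. G (Suc j)) k \<xi>\<bar> \<le> (\<epsilon> * 2 / s) * (2/s)^k"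
  proof (rule Suc.IH[of _ _ y])
    show "y i \<in> {a..b}" if "i < 2^k" for i
    proof -
      have "x (2*i) \<in> {a..b}" "x (Suc (2*i)) \<in> {a..b}" using Suc.prems(4) that by auto
      then show ?thesis using y[OF that] by auto
    qed
    show "y i + s \<le> y (Suc i)" if "Suc i < 2^k" for i
    proof -
      have "x (Suc (2*i)) + s \<le> x (Suc (Suc (2*i)))" using that by (intro Suc.prems(5)) auto
      moreover have "y i < x (Suc (2*i))" using y[of i] that by auto
      moreover have "x (2 * Suc i) < y (Suc i)" using y that by blast
      ultimately show ?thesis by simp
    qed
  qed (use Suc.prems y in auto)
  then show ?case by (simp add: mult_ac)
qed

text \<open>Bounds travel down from the \<open>k\<close>-th derivative to the function: each lower
  derivative is small at one point of the interval, and the mean value theorem limits how far it can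
  move away from that value.\<close>

lemma derivative_chain_bound:
  fixes G :: "nat \<Rightarrow> real \<Rightarrow> real"
  assumes G: "\<And>j t. j < k \<Longrightarrow> t \<in> {a..b} \<Longrightarrow> (G j has_real_derivative G (Suc j) t) (at t)"
    and s: "0 < s" "s \<le> b - a" and "0 \<le> \<epsilon>" "1 \<le> \<Lambda>"
    and small: "\<And>j. j < k \<Longrightarrow> \<exists>\<xi>\<in>{a..b}. \<bar>G j \<xi>\<bar> \<le> \<epsilon> * (2/s)^j"
    and top: "\<And>t. t \<in> {a..b} \<Longrightarrow> \<bar>G k t\<bar> \<le> \<Lambda> * \<epsilon> * (2/s)^k"
    and t: "t \<in> {a..b}"
  shows "\<bar>G 0 t\<bar> \<le> (real k + 1) * \<Lambda> * \<epsilon> * (2 * (b - a) / s)^k"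
proof -
  let ?l = "b - a"
  have l0: "0 < ?l" using s by linarith
  have "i \<le> k \<Longrightarrow> t \<in> {a..b} \<Longrightarrow> \<bar>G (k - i) t\<bar> \<le> (real i + 1) * \<Lambda> * \<epsilon> * (2/s)^k * ?l^i" for i t
  proof (induction i arbitrary: t)
    case 0
    then show ?case using top by simp
  next
    case (Suc i)
    define j where "j = k - Suc i"
    have j: "j < k" "Suc j = k - i" "k = j + Suc i" using Suc.prems by (auto simp: j_def)
    obtain \<xi> where \<xi>: "\<xi> \<in> {a..b}" "\<bar>G j \<xi>\<bar> \<le> \<epsilon> * (2/s)^j" using small[OF j(1)] by blast
    let ?B = "(real i + 1) * \<Lambda> * \<epsilon> * (2/s)^k * ?l^i"
    have B0: "0 \<le> ?B" using assms l0 by simp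
    have "norm (G j t - G j \<xi>) \<le> ?B * norm (t - \<xi>)"
    proof (rule field_differentiable_bound[of "{a..b}" _ "G (Suc j)"])
      show "(G j has_field_derivative G (Suc j) z) (at z within {a..b})" if "z \<in> {a..b}" for z
        using G[OF j(1) that] by (rule has_field_derivative_at_within)
      show "norm (G (Suc j) z) \<le> ?B" if "z \<in> {a..b}" for z
        using Suc.IH[OF _ that] Suc.prems j(2) by simp
    qed (use \<xi> Suc.prems in auto)
    also have "\<dots> \<le> ?B * ?l"
      using \<xi>(1) Suc.prems(2) by (intro mult_left_mono B0) (auto simp: abs_le_iff)
    finally have 1: "\<bar>G j t\<bar> \<le> \<epsilon> * (2/s)^j + ?B * ?l" using \<xi>(2) by simp
    \<comment> \<open>The spacing fits into the interval, so this ratio is at least 1. Multiplying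
      the value at \<open>\<xi>\<close> by its powers gives it the same form as the variation, and
      each level adds just one unit to the constant.\<close>
    have "1 \<le> 2 * ?l / s" using s by (simp add: field_simps)
    then have "1 \<le> (2 * ?l / s) ^ Suc i" by (rule one_le_power)
    then have "\<epsilon> * (2/s)^j * 1 \<le> \<epsilon> * (2/s)^j * (2 * ?l / s) ^ Suc i"
      using assms by (intro mult_left_mono) auto
    also have "\<dots> = \<epsilon> * (2/s)^k * ?l ^ Suc i"
    proof -
      have "(2/s)^j * (2 * l / s) ^ Suc i = (2/s)^k * l ^ Suc i" for l
        unfolding j(3) by (simp add: power_add power_divide power_mult_distrib mult_ac)
      from this[of ?l] show ?thesis by (simp only: mult.assoc)
    qed
    also have "\<dots> \<le> \<Lambda> * (\<epsilon> * (2/s)^k * ?l ^ Suc i)"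
    proof -
      have "1 * (\<epsilon> * (2/s)^k * ?l ^ Suc i) \<le> \<Lambda> * (\<epsilon> * (2/s)^k * ?l ^ Suc i)"
        using assms l0 by (intro mult_right_mono) auto
      then show ?thesis by simp
    qed
    finally have "\<epsilon> * (2/s)^j \<le> \<Lambda> * \<epsilon> * (2/s)^k * ?l ^ Suc i" by (simp add: mult_ac)
    then show ?case using 1 by (simp add: j_def[symmetric] algebra_simps)
  qed
  from this[of k t] t have "\<bar>G 0 t\<bar> \<le> (real k + 1) * \<Lambda> * \<epsilon> * (2/s)^k * ?l^k" by simp
  also have "\<dots> = (real k + 1) * \<Lambda> * \<epsilon> * (2 * ?l / s)^k"
  proof -
    have "(2/s)^k * l^k = (2 * l / s)^k" for l by (simp add: power_mult_distrib power_divide)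
    from this[of ?l] show ?thesis by (simp only: mult.assoc)
  qed
  finally show ?thesis .
qed

lemma sublevel_lmeasurable:
  fixes f :: "real \<Rightarrow> real"
  assumes "continuous_on {a..b} f"
  shows "{t \<in> {a..b}. f t < e} \<in> lmeasurable"
proof -
  have "openin (top_of_set {a..b}) ({a..b} \<inter> f -` {..<e})"
    using assms by (intro continuous_openin_preimage_gen) auto
  then obtain T where "open T" and T: "{a..b} \<inter> f -` {..<e} = {a..b} \<inter> T"
    by (auto simp: openin_open)
  have "{a..b} \<inter> T \<in> lmeasurable"
    using borel_open[OF \<open>open T\<close>] by (intro fmeasurable_Int_fmeasurable) auto
  moreover have "{t \<in> {a..b}. f t < e} = {a..b} \<inter> f -` {..<e}" by auto
  ultimately show ?thesis unfolding T[symmetric] by (simp only:)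
qed

text \<open>Greedy selection: take a point almost at the infimum, discard everything up to distance
  \<open>s\<close> beyond it, and continue in what is left.\<close>

lemma spaced_points_in_large_set:
  fixes E :: "real set"
  assumes "E \<in> lmeasurable" "E \<subseteq> {a..b}" "0 < s" "real N * s < measure lebesgue E"
  shows "\<exists>x::nat \<Rightarrow> real. (\<forall>i<N. x i \<in> E) \<and> (\<forall>i. Suc i < N \<longrightarrow> x i + s \<le> x (Suc i))"
  using assms
proof (induction N arbitrary: E)
  case 0
  then show ?case by auto
next
  case (Suc N)
  \<comment> \<open>The surplus of measure. A first point within \<open>d\<close> of the infimum
    wastes less than \<open>s + d\<close>, which leaves more than \<open>N * s\<close> for the other
    points.\<close>
  define d where "d = measure lebesgue E - real (Suc N) * s"
  have d: "0 < d" using Suc.prems by (simp add: d_def)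
  have "E \<noteq> {}"
  proof
    assume "E = {}"
    with Suc.prems have "real (Suc N) * s < 0" by simp
    moreover have "real (Suc N) * s \<ge> 0" using Suc.prems by simp
    ultimately show False by linarith
  qed
  moreover have bdd: "bdd_below E" using Suc.prems(2) by (meson bdd_below_Icc bdd_below_mono)
  ultimately obtain x0 where x0: "x0 \<in> E" "x0 < Inf E + d"
    using d cInf_less_iff[of E "Inf E + d"] by auto
  have inf: "Inf E \<le> x0" using x0 bdd by (intro cInf_lower)
  let ?E = "E \<inter> {x0 + s..}"
  have mE: "?E \<in> lmeasurable"
    using Suc.prems(1) by (intro fmeasurable_Int_fmeasurable) auto
  have "measure lebesgue E \<le> measure lebesgue (?E \<union> {Inf E..x0 + s})"
    using Suc.prems(1) mE bdd by (intro measure_mono_fmeasurable) (auto intro: cInf_lower)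
  also have "\<dots> \<le> measure lebesgue ?E + measure lebesgue {Inf E..x0 + s}"
    using mE by (intro measure_Un_le) auto
  also have "\<dots> = measure lebesgue ?E + (x0 + s - Inf E)"
    using inf \<open>0 < s\<close> by simp
  finally have "real N * s < measure lebesgue ?E"
    using x0(2) by (simp add: d_def algebra_simps)
  from Suc.IH[OF mE _ \<open>0 < s\<close> this] Suc.prems(2)
  obtain x where x: "\<And>i. i < N \<Longrightarrow> x i \<in> ?E" "\<And>i. Suc i < N \<Longrightarrow> x i + s \<le> x (Suc i)"
    by blast
  show ?case
  proof (intro exI[of _ "case_nat x0 x"] conjI allI impI)
    fix i assume "i < Suc N"
    then show "case_nat x0 x i \<in> E" using x0 x(1) by (cases i) auto
  next
    fix i assume "Suc i < Suc N"
    then show "case_nat x0 x i + s \<le> case_nat x0 x (Suc i)"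
      using x(1)[of 0] x(2) by (cases i) auto
  qed
qed

text \<open>The \<open>(C, \<alpha>)\<close>-good property of Kleinbock and Margulis with \<open>\<alpha> = 1 / K\<close>, raised to the power \<open>K\<close>.\<close>

definition good_on :: "nat \<Rightarrow> real \<Rightarrow> real set \<Rightarrow> (real \<Rightarrow> real) \<Rightarrow> bool" where
  "good_on K C I \<psi> \<longleftrightarrow> continuous_on I \<psi> \<and>
    (\<forall>a b \<epsilon> t. a < b \<longrightarrow> {a..b} \<subseteq> I \<longrightarrow> 0 < \<epsilon> \<longrightarrow> t \<in> {a..b} \<longrightarrow>
      \<bar>\<psi> t\<bar> * measure lebesgue {s \<in> {a..b}. \<bar>\<psi> s\<bar> < \<epsilon>} ^ K \<le> C * \<epsilon> * (b - a) ^ K)"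

lemma measure_sublevel_le:
  fixes \<psi> :: "real \<Rightarrow> real"
  assumes "continuous_on {a..b} \<psi>" "a \<le> b"
  shows "measure lebesgue {s \<in> {a..b}. \<bar>\<psi> s\<bar> < \<epsilon>} \<le> b - a"
proof -
  have "measure lebesgue {s \<in> {a..b}. \<bar>\<psi> s\<bar> < \<epsilon>} \<le> measure lebesgue {a..b}"
    using assms by (intro measure_mono_fmeasurable fmeasurableD[OF sublevel_lmeasurable]) (auto intro!: continuous_intros)
  then show ?thesis using assms by simp
qed

lemma good_on_const:
  assumes "1 \<le> C" "1 \<le> K"
  shows "good_on K C I (\<lambda>_. c)"
  unfolding good_on_def
proof (intro conjI allI impI)
  fix a b \<epsilon> t :: real
  assume "a < b" "0 < \<epsilon>"
  show "\<bar>c\<bar> * measure lebesgue {s \<in> {a..b}. \<bar>c\<bar> < \<epsilon>} ^ K \<le> C * \<epsilon> * (b - a) ^ K"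
  proof (cases "\<bar>c\<bar> < \<epsilon>")
    case True
    moreover have "1 * \<epsilon> \<le> C * \<epsilon>" using assms \<open>0 < \<epsilon>\<close> by (intro mult_right_mono) auto
    ultimately have "\<bar>c\<bar> \<le> C * \<epsilon>" by linarith
    moreover have "{s \<in> {a..b}. \<bar>c\<bar> < \<epsilon>} = {a..b}" using True by auto
    ultimately show ?thesis using \<open>a < b\<close> by (simp only:) (simp add: mult_right_mono)
  next
    case False
    then have "{s \<in> {a..b}. \<bar>c\<bar> < \<epsilon>} = {}" by auto
    moreover have "(0::real) ^ K = 0" using assms by simp
    moreover have "0 \<le> C * \<epsilon> * (b - a) ^ K" using assms \<open>a < b\<close> \<open>0 < \<epsilon>\<close> by simp
    ultimately show ?thesis by (simp only: measure_empty mult_zero_right)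
  qed
qed simp

lemma good_on_continuous: "good_on K C I \<psi> \<Longrightarrow> continuous_on I \<psi>"
  by (simp add: good_on_def)

lemma good_onD:
  assumes "good_on K C I \<psi>" "a < b" "{a..b} \<subseteq> I" "0 < \<epsilon>" "t \<in> {a..b}"
  shows "\<bar>\<psi> t\<bar> * measure lebesgue {s \<in> {a..b}. \<bar>\<psi> s\<bar> < \<epsilon>} ^ K \<le> C * \<epsilon> * (b - a) ^ K"
  using assms unfolding good_on_def by (elim conjE allE impE) assumption+

lemma good_on_subset: "good_on K C I \<psi> \<Longrightarrow> J \<subseteq> I \<Longrightarrow> good_on K C J \<psi>"
  unfolding good_on_def by (meson continuous_on_subset order_trans)

lemma good_on_scale:
  assumes "good_on K C I \<psi>" "0 < c"
  shows "good_on K C I (\<lambda>t. c * \<psi> t)"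
  unfolding good_on_def
proof (intro conjI allI impI)
  show "continuous_on I (\<lambda>t. c * \<psi> t)" by (intro continuous_intros good_on_continuous[OF assms(1)])
  fix a b \<epsilon> t :: real
  assume *: "a < b" "{a..b} \<subseteq> I" "0 < \<epsilon>" "t \<in> {a..b}"
  have "\<bar>\<psi> t\<bar> * measure lebesgue {s \<in> {a..b}. \<bar>\<psi> s\<bar> < \<epsilon> / c} ^ K \<le> C * (\<epsilon> / c) * (b - a) ^ K"
    by (rule good_onD[OF assms(1) *(1,2) _ *(4)]) (use *(3) assms(2) in simp)
  moreover have "{s \<in> {a..b}. \<bar>\<psi> s\<bar> < \<epsilon> / c} = {s \<in> {a..b}. \<bar>c * \<psi> s\<bar> < \<epsilon>}"
    using assms(2) by (auto simp: abs_mult field_simps)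
  moreover have "\<bar>c * \<psi> t\<bar> * m \<le> C * \<epsilon> * l" if "\<bar>\<psi> t\<bar> * m \<le> C * (\<epsilon> / c) * l" for m l
  proof -
    have "c * (\<bar>\<psi> t\<bar> * m) \<le> c * (C * (\<epsilon> / c) * l)"
      using that assms(2) by (intro mult_left_mono) auto
    then show ?thesis using assms(2) by (simp add: abs_mult mult.assoc)
  qed
  ultimately show "\<bar>c * \<psi> t\<bar> * measure lebesgue {s \<in> {a..b}. \<bar>c * \<psi> s\<bar> < \<epsilon>} ^ K \<le> C * \<epsilon> * (b - a) ^ K"
    by (simp only:)
qed

lemma good_on_Max:
  fixes f :: "'a \<Rightarrow> real \<Rightarrow> real"
  assumes "finite A" "A \<noteq> {}" and good: "\<And>i. i \<in> A \<Longrightarrow> good_on K C I (f i)"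
  shows "good_on K C I (\<lambda>t. Max ((\<lambda>i. \<bar>f i t\<bar>) ` A))" (is "good_on K C I ?M")
proof -
  have cf: "continuous_on I (\<lambda>t. \<bar>f i t\<bar>)" if "i \<in> A" for i
    by (intro continuous_on_rabs good_on_continuous[OF good] that)
  have cont: "continuous_on I ?M"
  proof -
    have "continuous_on I (\<lambda>t. Max ((\<lambda>i. \<bar>f i t\<bar>) ` B))"
      if "finite B" "B \<noteq> {}" "B \<subseteq> A" for B
      using that
    proof (induction B rule: finite_ne_induct)
      case (singleton x)
      then show ?case using cf by simp
    next
      case (insert x F)
      then have "continuous_on I (\<lambda>t. max \<bar>f x t\<bar> (Max ((\<lambda>i. \<bar>f i t\<bar>) ` F)))"
        using cf by (intro continuous_on_max) simp_all
      then show ?case using insert by simp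
    qed
    then show ?thesis using assms by blast
  qed
  show ?thesis
    unfolding good_on_def
  proof (intro conjI allI impI cont)
    fix a b \<epsilon> t :: real
    assume *: "a < b" "{a..b} \<subseteq> I" "0 < \<epsilon>" "t \<in> {a..b}"
    have "?M t \<in> (\<lambda>i. \<bar>f i t\<bar>) ` A" using assms by (intro Max_in) auto
    then obtain i where i: "i \<in> A" "?M t = \<bar>f i t\<bar>" by auto
    have le: "\<bar>f i s\<bar> \<le> ?M s" for s using assms i by (intro Max_ge) auto
    have "continuous_on I (f i)" using good[OF i(1)] by (simp only: good_on_def)
    then have c1: "continuous_on {a..b} (f i)" using *(2) by (rule continuous_on_subset)
    have c2: "continuous_on {a..b} ?M" using cont *(2) by (rule continuous_on_subset)
    have "measure lebesgue {s \<in> {a..b}. \<bar>?M s\<bar> < \<epsilon>} \<le> measure lebesgue {s \<in> {a..b}. \<bar>f i s\<bar> < \<epsilon>}"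
    proof (rule measure_mono_fmeasurable)
      show "{s \<in> {a..b}. \<bar>?M s\<bar> < \<epsilon>} \<subseteq> {s \<in> {a..b}. \<bar>f i s\<bar> < \<epsilon>}"
        by (auto intro: le_less_trans[OF order_trans[OF le abs_ge_self]])
      show "{s \<in> {a..b}. \<bar>?M s\<bar> < \<epsilon>} \<in> sets lebesgue"
        by (intro fmeasurableD sublevel_lmeasurable continuous_on_rabs c2)
      show "{s \<in> {a..b}. \<bar>f i s\<bar> < \<epsilon>} \<in> lmeasurable"
        by (intro sublevel_lmeasurable continuous_on_rabs c1)
    qed
    then have "\<bar>?M t\<bar> * measure lebesgue {s \<in> {a..b}. \<bar>?M s\<bar> < \<epsilon>} ^ K
        \<le> \<bar>f i t\<bar> * measure lebesgue {s \<in> {a..b}. \<bar>f i s\<bar> < \<epsilon>} ^ K"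
      unfolding i(2) abs_idempotent by (intro mult_left_mono power_mono measure_nonneg abs_ge_zero)
    also have "\<dots> \<le> C * \<epsilon> * (b - a) ^ K"
      by (rule good_onD[OF good[OF i(1)] *])
    finally show "\<bar>?M t\<bar> * measure lebesgue {s \<in> {a..b}. \<bar>?M s\<bar> < \<epsilon>} ^ K \<le> C * \<epsilon> * (b - a) ^ K" .
  qed
qed

text \<open>The spacing \<open>m / 2 ^ Suc k\<close> of \<open>2 ^ k\<close> points is the source of
  the power of 2. Since \<open>m \<le> l\<close>, an estimate of order \<open>k\<close> implies one
  of order \<open>K\<close>; different linear forms are nondegenerate at different orders, and all
  of them have to share one exponent and one constant.\<close>

lemma good_constant_arith:
  fixes l m \<epsilon> \<Lambda> g :: real
  assumes g: "g \<le> (real k + 1) * \<Lambda> * \<epsilon> * (2 * l / (m / 2 ^ Suc k)) ^ k"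
    and ml: "0 < m" "m \<le> l" and "0 \<le> \<Lambda>" "0 \<le> \<epsilon>" and k: "k \<le> K"
  shows "g * m ^ K \<le> (real K + 1) * \<Lambda> * (2 ^ (K + 2)) ^ K * \<epsilon> * l ^ K"
proof -
  have mK: "m ^ K = m ^ k * m ^ (K - k)" using k by (simp add: power_add[symmetric])
  have e: "2 * l / (m / 2 ^ Suc k) = 2 ^ (k + 2) * l / m" by simp
  have c: "(2 ^ (k + 2) * l / m) ^ k * m ^ K = (2 ^ (k + 2)) ^ k * (l ^ k * m ^ (K - k))"
  proof -
    have *: "(A * L / M) * (M * N) = A * (L * N)" if "M \<noteq> 0" for A L M N :: real using that by simp
    have "m ^ k \<noteq> 0" using ml by simp
    from *[OF this] show ?thesis unfolding mK power_divide power_mult_distrib .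
  qed
  have two: "((2::real) ^ (k + 2)) ^ k \<le> (2 ^ (K + 2)) ^ K"
  proof -
    have "(k + 2) * k \<le> (K + 2) * K" using k by (intro mult_mono) auto
    then have "(2::real) ^ ((k + 2) * k) \<le> 2 ^ ((K + 2) * K)" by (intro power_increasing) auto
    then show ?thesis by (simp only: power_mult)
  qed
  have "g * m ^ K \<le> (real k + 1) * \<Lambda> * \<epsilon> * (2 ^ (k + 2) * l / m) ^ k * m ^ K"
    using g[unfolded e] ml by (intro mult_right_mono) auto
  also have "\<dots> = ((real k + 1) * \<Lambda> * \<epsilon>) * ((2 ^ (k + 2)) ^ k * (l ^ k * m ^ (K - k)))"
    by (simp only: mult.assoc c)
  also have "\<dots> \<le> ((real K + 1) * \<Lambda> * \<epsilon>) * ((2 ^ (K + 2)) ^ K * (l ^ k * l ^ (K - k)))"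
    using assms by (intro mult_mono power_mono two) simp_all
  also have "l ^ k * l ^ (K - k) = l ^ K" using k by (simp add: power_add[symmetric])
  also have "(real K + 1) * \<Lambda> * \<epsilon> * ((2 ^ (K + 2)) ^ K * l ^ K) = (real K + 1) * \<Lambda> * (2 ^ (K + 2)) ^ K * \<epsilon> * l ^ K"
  proof -
    have "x * y * e * (z * w) = x * y * z * e * w" for x y z e w :: real by simp
    then show ?thesis .
  qed
  finally show ?thesis .
qed

lemma power_of_two_spacing:
  fixes m :: real
  assumes "0 < m"
  shows "0 < m / 2^(Suc k)" "m / 2^(Suc k) \<le> m" "real (2^k) * (m / 2^(Suc k)) < m"
proof -
  have "1 \<le> (2::real)^Suc k" by (rule one_le_power) simp
  then have "m * 1 \<le> m * 2^(Suc k)" using assms by (intro mult_left_mono) auto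
  then show "m / 2^(Suc k) \<le> m" by (subst pos_divide_le_eq) auto
  show "0 < m / 2^(Suc k)" "real (2^k) * (m / 2^(Suc k)) < m" using assms by simp_all
qed

text \<open>A sublevel set of measure \<open>m\<close> contains \<open>2 ^ k\<close> points at
  distances comparable to \<open>m\<close>. They force the \<open>k\<close>-th derivative to be
  small somewhere, hence everywhere up to the factor \<open>\<Lambda>\<close>, and descending
  through the derivatives bounds the function. As \<open>A2\<close> does not enter the constant, all
  multiples of a function are treated alike.\<close>

lemma good_on_derivative_bounds:
  fixes G :: "nat \<Rightarrow> real \<Rightarrow> real"
  assumes G: "\<And>j t. j < k \<Longrightarrow> t \<in> I \<Longrightarrow> (G j has_real_derivative G (Suc j) t) (at t)"
    and k: "1 \<le> k" "k \<le> K" and "0 < A2"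
    and bnd: "\<And>t. t \<in> I \<Longrightarrow> A2 \<le> \<bar>G k t\<bar>" "\<And>t. t \<in> I \<Longrightarrow> \<bar>G k t\<bar> \<le> \<Lambda> * A2"
    and "1 \<le> \<Lambda>"
  shows "good_on K ((real K + 1) * \<Lambda> * (2 ^ (K + 2)) ^ K) I (G 0)"
  unfolding good_on_def
proof (intro conjI allI impI)
  show cont: "continuous_on I (G 0)"
    using G[of 0] k by (intro continuous_at_imp_continuous_on) (auto intro: DERIV_isCont)
  fix a b \<epsilon> t :: real
  assume *: "a < b" "{a..b} \<subseteq> I" "0 < \<epsilon>" "t \<in> {a..b}"
  let ?E = "{s \<in> {a..b}. \<bar>G 0 s\<bar> < \<epsilon>}"
  let ?m = "measure lebesgue ?E"
  let ?l = "b - a"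
  let ?C = "(real K + 1) * \<Lambda> * (2 ^ (K + 2)) ^ K"
  have cab: "continuous_on {a..b} (G 0)" using cont *(2) by (rule continuous_on_subset)
  have E: "?E \<in> lmeasurable" by (intro sublevel_lmeasurable continuous_on_rabs cab)
  have ml: "?m \<le> ?l" using *(1) by (intro measure_sublevel_le cab) simp
  obtain m where m: "m = ?m" by blast
  have "\<bar>G 0 t\<bar> * m ^ K \<le> ?C * \<epsilon> * ?l ^ K"
  proof (cases "m = 0")
    case True
    then have "\<bar>G 0 t\<bar> * m ^ K = 0" using k by simp
    moreover have "0 \<le> ?C * \<epsilon> * ?l ^ K" using * \<open>1 \<le> \<Lambda>\<close> by simp
    ultimately show ?thesis by linarith
  next
    case False
    have "0 \<le> m" unfolding m by (rule measure_nonneg)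
    with False have m0: "0 < m" by simp
    have ml': "m \<le> ?l" unfolding m by (rule ml)
    define s where "s = m / 2^(Suc k)"
    have s: "0 < s" "s \<le> m" "real (2^k) * s < m"
      unfolding s_def by (rule power_of_two_spacing[OF m0])+
    have sE: "real (2^k) * s < measure lebesgue ?E" using s(3) unfolding m .
    have sl: "s \<le> ?l" using s(2) ml' by linarith
    have "?E \<subseteq> {a..b}" by auto
    from spaced_points_in_large_set[OF E this s(1) sE] obtain x :: "nat \<Rightarrow> real"
      where x': "(\<forall>i<2^k. x i \<in> ?E) \<and> (\<forall>i. Suc i < 2^k \<longrightarrow> x i + s \<le> x (Suc i))" ..
    have x: "x i \<in> ?E" if "i < 2^k" for i using x' that by simp
    have x2: "x i + s \<le> x (Suc i)" if "Suc i < 2^k" for i using x' that by simp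
    have small: "\<exists>\<xi>\<in>{a..b}. \<bar>G j \<xi>\<bar> \<le> \<epsilon> * (2/s)^j" if "j \<le> k" for j
    proof (rule spaced_points_derivative_small[of j a b G s \<epsilon> x])
      have le: "i < 2^k" if "i < 2^j" for i :: nat
        using that \<open>j \<le> k\<close> by (meson less_le_trans one_le_numeral power_increasing)
      show "(G i has_real_derivative G (Suc i) t) (at t)" if "i < j" "t \<in> {a..b}" for i t
      proof (rule G)
        show "i < k" using that \<open>j \<le> k\<close> by simp
        show "t \<in> I" using that *(2) by blast
      qed
      show "x i \<in> {a..b}" "\<bar>G 0 (x i)\<bar> \<le> \<epsilon>" if "i < 2^j" for i
        using x[OF le[OF that]] by auto
      show "x i + s \<le> x (Suc i)" if "Suc i < 2^j" for i
        using x2[OF le[OF that]] .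
      show "0 < s" "0 \<le> \<epsilon>" using s(1) *(3) by simp_all
    qed
    obtain \<xi> where \<xi>: "\<xi> \<in> {a..b}" "\<bar>G k \<xi>\<bar> \<le> \<epsilon> * (2/s)^k" using small[of k] by blast
    have "\<xi> \<in> I" using \<xi>(1) *(2) by blast
    then have A2: "A2 \<le> \<epsilon> * (2/s)^k" using bnd(1) \<xi>(2) by (meson order_trans)
    have "\<bar>G 0 t\<bar> \<le> (real k + 1) * \<Lambda> * \<epsilon> * (2 * ?l / s)^k"
    proof (rule derivative_chain_bound[of k a b G s \<epsilon> \<Lambda> t])
      show "\<bar>G k u\<bar> \<le> \<Lambda> * \<epsilon> * (2/s)^k" if "u \<in> {a..b}" for u
      proof -
        have "u \<in> I" using that *(2) by blast
        then have "\<bar>G k u\<bar> \<le> \<Lambda> * A2" by (rule bnd(2))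
        also have "\<dots> \<le> \<Lambda> * (\<epsilon> * (2/s)^k)" using A2 \<open>1 \<le> \<Lambda>\<close> by (intro mult_left_mono) simp_all
        finally show ?thesis by (simp only: mult.assoc)
      qed
      show "(G j has_real_derivative G (Suc j) t) (at t)" if "j < k" "t \<in> {a..b}" for j t
      proof (rule G[OF that(1)])
        show "t \<in> I" using that *(2) by blast
      qed
      show "0 < s" by (rule s(1))
      show "s \<le> b - a" by (rule sl)
      show "0 \<le> \<epsilon>" using *(3) by simp
      show "1 \<le> \<Lambda>" by fact
      show "t \<in> {a..b}" by (rule *(4))
      show "\<exists>\<xi>\<in>{a..b}. \<bar>G j \<xi>\<bar> \<le> \<epsilon> * (2/s)^j" if "j < k" for j
        by (rule small) (use that in simp)
    qed
    then have "\<bar>G 0 t\<bar> \<le> (real k + 1) * \<Lambda> * \<epsilon> * (2 * ?l / (m / 2 ^ Suc k)) ^ k"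
      unfolding s_def .
    moreover have "0 \<le> \<Lambda>" "0 \<le> \<epsilon>" using \<open>1 \<le> \<Lambda>\<close> *(3) by linarith+
    ultimately show ?thesis using m0 ml' k(2) by (intro good_constant_arith[of "\<bar>G 0 t\<bar>" k \<Lambda> \<epsilon> ?l m K])
  qed
  then show "\<bar>G 0 t\<bar> * ?m ^ K \<le> ?C * \<epsilon> * ?l ^ K" unfolding m .
qed

section \<open>Quantitative nondivergence on the line\<close>

lemma cball_real: "cball (c::real) r = {c - r..c + r}"
  by (auto simp: cball_def dist_real_def abs_le_iff)

text \<open>The marked points of Kleinbock and Margulis, for an abstract comparability relation. The
  rank takes the place of membership in \<open>F\<close>: an element comparable with all of
  \<open>F\<close> and of a rank not occurring there could still enlarge the flag. For subspaces the
  rank is the dimension, and comparable subspaces of equal dimension coincide.\<close>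

definition flag_marked ::
    "('s \<Rightarrow> 's \<Rightarrow> bool) \<Rightarrow> ('s \<Rightarrow> nat) \<Rightarrow> 's set \<Rightarrow> ('s \<Rightarrow> real \<Rightarrow> real) \<Rightarrow> real \<Rightarrow> real \<Rightarrow> real \<Rightarrow> bool" where
  "flag_marked cmp rk S \<psi> \<epsilon> D x \<longleftrightarrow>
     (\<exists>F\<subseteq>S. finite F \<and> (\<forall>f\<in>F. \<forall>g\<in>F. f \<noteq> g \<longrightarrow> cmp f g) \<and>
        (\<forall>f\<in>F. \<epsilon> \<le> \<psi> f x \<and> \<psi> f x \<le> D) \<and>
        (\<forall>s\<in>S. (\<forall>f\<in>F. cmp s f \<and> rk s \<noteq> rk f) \<longrightarrow> 1 \<le> \<psi> s x))"

lemma flag_markedI_empty: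
  assumes "\<And>s. s \<in> S \<Longrightarrow> 1 \<le> \<psi> s x"
  shows "flag_marked cmp rk S \<psi> \<epsilon> D x"
  unfolding flag_marked_def using assms by (intro exI[of _ "{}"]) simp

lemma flag_marked_insert:
  assumes "flag_marked cmp rk {s \<in> S. cmp s s0 \<and> rk s \<noteq> rk s0} \<psi> \<epsilon> D x"
    and "\<And>a b. cmp a b \<Longrightarrow> cmp b a" and "s0 \<in> S" "\<epsilon> \<le> \<psi> s0 x" "\<psi> s0 x \<le> D"
  shows "flag_marked cmp rk S \<psi> \<epsilon> D x"
proof -
  from assms(1)[unfolded flag_marked_def]
  obtain F where F: "F \<subseteq> {s \<in> S. cmp s s0 \<and> rk s \<noteq> rk s0}" "finite F"
    "\<forall>f\<in>F. \<forall>g\<in>F. f \<noteq> g \<longrightarrow> cmp f g" "\<forall>f\<in>F. \<epsilon> \<le> \<psi> f x \<and> \<psi> f x \<le> D"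
    "\<forall>s\<in>{s \<in> S. cmp s s0 \<and> rk s \<noteq> rk s0}. (\<forall>f\<in>F. cmp s f \<and> rk s \<noteq> rk f) \<longrightarrow> 1 \<le> \<psi> s x"
    by (elim exE conjE) (rule that)
  have 1: "insert s0 F \<subseteq> S" using F(1) assms(3) by blast
  have 2: "cmp f g" if "f \<in> insert s0 F" "g \<in> insert s0 F" "f \<noteq> g" for f g
  proof -
    have "f \<in> F \<or> f = s0" "g \<in> F \<or> g = s0" using that by auto
    moreover have "cmp h s0" if "h \<in> F" for h using that F(1) by auto
    ultimately show ?thesis using F(3) assms(2) \<open>f \<noteq> g\<close> by metis
  qed
  have 3: "1 \<le> \<psi> s x" if "s \<in> S" "\<forall>f\<in>insert s0 F. cmp s f \<and> rk s \<noteq> rk f" for s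
  proof -
    have "s \<in> {s \<in> S. cmp s s0 \<and> rk s \<noteq> rk s0}" "\<forall>f\<in>F. cmp s f \<and> rk s \<noteq> rk f" using that by auto
    then show ?thesis using F(5) by simp
  qed
  have 4: "\<epsilon> \<le> \<psi> f x \<and> \<psi> f x \<le> D" if "f \<in> insert s0 F" for f
    using that F(4) assms(4,5) by auto
  show ?thesis
    unfolding flag_marked_def
  proof (rule exI[of _ "insert s0 F"], intro conjI)
    show "finite (insert s0 F)" using F(2) by simp
    show "\<forall>f\<in>insert s0 F. \<forall>g\<in>insert s0 F. f \<noteq> g \<longrightarrow> cmp f g" by (intro ballI impI 2)
    show "\<forall>f\<in>insert s0 F. \<epsilon> \<le> \<psi> f x \<and> \<psi> f x \<le> D" by (intro ballI 4)
    show "\<forall>s\<in>S. (\<forall>f\<in>insert s0 F. cmp s f \<and> rk s \<noteq> rk f) \<longrightarrow> 1 \<le> \<psi> s x" using 3 by blast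
  qed (fact 1)
qed

lemma good_on_sublevel_measure:
  assumes good: "good_on K C I \<psi>" and "a < b" "{a..b} \<subseteq> I" and C: "1 \<le> C" and K: "1 \<le> K" and "0 < \<tau>"
    and t: "t \<in> {a..b}" "1 \<le> \<bar>\<psi> t\<bar>"
  shows "measure lebesgue {s \<in> {a..b}. \<bar>\<psi> s\<bar> < \<tau> ^ K} \<le> C * \<tau> * (b - a)"
proof -
  obtain m where m: "m = measure lebesgue {s \<in> {a..b}. \<bar>\<psi> s\<bar> < \<tau> ^ K}" by blast
  have m0: "0 \<le> m" unfolding m by (rule measure_nonneg)
  have "1 * m ^ K \<le> \<bar>\<psi> t\<bar> * m ^ K" using t m0 by (intro mult_right_mono) auto
  also have "\<dots> \<le> C * \<tau> ^ K * (b - a) ^ K"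
    unfolding m by (rule good_onD[OF good \<open>a < b\<close> \<open>{a..b} \<subseteq> I\<close> _ t(1)]) (use \<open>0 < \<tau>\<close> in simp)
  \<comment> \<open>Passing from \<open>C\<close> to \<open>C ^ K\<close> makes the right-hand side
    a perfect \<open>K\<close>-th power, so comparing bases gives an estimate linear in
    \<open>\<tau>\<close>.\<close>
  also have "\<dots> \<le> C ^ K * \<tau> ^ K * (b - a) ^ K"
  proof -
    have "C ^ 1 \<le> C ^ K" using C K by (intro power_increasing) auto
    then show ?thesis using \<open>0 < \<tau>\<close> \<open>a < b\<close> by (intro mult_right_mono) auto
  qed
  also have "\<dots> = (C * \<tau> * (b - a)) ^ K" by (simp only: power_mult_distrib)
  finally have "m ^ K \<le> (C * \<tau> * (b - a)) ^ K" by simp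
  moreover have "0 \<le> C * \<tau> * (b - a)" using C \<open>0 < \<tau>\<close> \<open>a < b\<close> by simp
  ultimately have "m \<le> C * \<tau> * (b - a)" using m0 K by (simp add: power_mono_iff)
  then show ?thesis unfolding m .
qed

text \<open>The inner ball makes up a fifth of the outer one and lies in the sublevel set at level
  1, so goodness at that level limits the growth. The result \<open>C * 5 ^ K\<close> is the upper
  bound demanded of the members of a flag.\<close>

lemma good_on_dilation_bound:
  assumes good: "good_on K C I \<psi>" and "0 < \<rho>" "cball x (5 * \<rho>) \<subseteq> I"
    and small: "\<And>t. t \<in> cball x \<rho> \<Longrightarrow> \<bar>\<psi> t\<bar> < 1" and t: "t \<in> cball x (5 * \<rho>)"
  shows "\<bar>\<psi> t\<bar> \<le> C * 5 ^ K"
proof -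
  let ?a = "x - 5 * \<rho>" and ?b = "x + 5 * \<rho>"
  obtain m where m: "m = measure lebesgue {s \<in> {?a..?b}. \<bar>\<psi> s\<bar> < 1}" by blast
  have I: "{?a..?b} \<subseteq> I" using assms(3) by (simp add: cball_real)
  have "measure lebesgue {x - \<rho>..x + \<rho>} \<le> m"
    unfolding m
  proof (rule measure_mono_fmeasurable)
    show "{x - \<rho>..x + \<rho>} \<subseteq> {s \<in> {?a..?b}. \<bar>\<psi> s\<bar> < 1}"
      using small \<open>0 < \<rho>\<close> by (auto simp: cball_real)
    show "{s \<in> {?a..?b}. \<bar>\<psi> s\<bar> < 1} \<in> lmeasurable"
      by (intro sublevel_lmeasurable continuous_on_rabs continuous_on_subset[OF good_on_continuous[OF good] I])
  qed simp
  then have m2: "2 * \<rho> \<le> m" using \<open>0 < \<rho>\<close> by simp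
  have "\<bar>\<psi> t\<bar> * (2 * \<rho>) ^ K \<le> \<bar>\<psi> t\<bar> * m ^ K"
    using m2 \<open>0 < \<rho>\<close> by (intro mult_left_mono power_mono) auto
  also have "\<dots> \<le> C * 1 * (?b - ?a) ^ K"
    unfolding m by (rule good_onD[OF good _ I]) (use t \<open>0 < \<rho>\<close> in \<open>auto simp: cball_real\<close>)
  also have "?b - ?a = 5 * (2 * \<rho>)" by simp
  also have "C * 1 * (5 * (2 * \<rho>)) ^ K = (C * 5 ^ K) * (2 * \<rho>) ^ K"
    by (simp only: power_mult_distrib[of 5 "2 * \<rho>"] mult_1_right mult.assoc)
  finally show ?thesis using \<open>0 < \<rho>\<close> by simp
qed

text \<open>Choosing the radius within a factor 2 of the supremum makes every function large on the doubled ball.\<close>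

lemma maximal_small_ball:
  assumes cont: "\<And>s. s \<in> S \<Longrightarrow> continuous_on I (\<psi> s)" and "open U" "U \<subseteq> I" "x \<in> U"
    and s: "s \<in> S" "\<bar>\<psi> s x\<bar> < (1::real)" and "x \<in> cball c r"
    and big: "\<And>s. s \<in> S \<Longrightarrow> \<exists>t\<in>cball c r. 1 \<le> \<bar>\<psi> s t\<bar>"
  shows "\<exists>\<rho> s. 0 < \<rho> \<and> \<rho> \<le> 2 * r \<and> s \<in> S \<and> (\<forall>t\<in>cball x \<rho>. \<bar>\<psi> s t\<bar> < 1) \<and>
           (\<forall>s\<in>S. \<exists>t\<in>cball (x::real) (2 * \<rho>). 1 \<le> \<bar>\<psi> s t\<bar>)"
proof -
  define P where "P = {\<rho>. 0 < \<rho> \<and> (\<exists>s\<in>S. \<forall>t\<in>cball x \<rho>. \<bar>\<psi> s t\<bar> < 1)}"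
  have "P \<noteq> {}"
  proof -
    have "continuous_on U (\<lambda>t. \<bar>\<psi> s t\<bar>)"
      by (intro continuous_on_rabs continuous_on_subset[OF cont[OF s(1)] \<open>U \<subseteq> I\<close>])
    then have "open (U \<inter> (\<lambda>t. \<bar>\<psi> s t\<bar>) -` {..<1})"
      using \<open>open U\<close> by (intro continuous_open_preimage) auto
    moreover have "x \<in> U \<inter> (\<lambda>t. \<bar>\<psi> s t\<bar>) -` {..<1}" using \<open>x \<in> U\<close> s(2) by auto
    ultimately obtain e where "0 < e" "cball x e \<subseteq> U \<inter> (\<lambda>t. \<bar>\<psi> s t\<bar>) -` {..<1}"
      by (meson open_contains_cball)
    then have "e \<in> P" using s(1) by (auto simp: P_def)
    then show ?thesis by blast
  qed
  \<comment> \<open>A radius beyond \<open>2 * r\<close> would make the ball swallow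
    \<open>cball c r\<close>, where every function reaches 1.\<close>
  have ub: "\<rho> \<le> 2 * r" if \<rho>P: "\<rho> \<in> P" for \<rho>
  proof (rule ccontr)
    assume "\<not> \<rho> \<le> 2 * r"
    then have "cball c r \<subseteq> cball x \<rho>" using \<open>x \<in> cball c r\<close> by (auto simp: cball_real)
    moreover obtain u where u: "u \<in> S" "\<forall>t\<in>cball x \<rho>. \<bar>\<psi> u t\<bar> < 1"
      using \<rho>P unfolding P_def by blast
    moreover obtain t where "t \<in> cball c r" "1 \<le> \<bar>\<psi> u t\<bar>" using big[OF u(1)] by blast
    ultimately show False by (meson not_less subsetD)
  qed
  then have bdd: "bdd_above P" by (meson bdd_aboveI)
  obtain \<rho>0 where \<rho>0: "\<rho>0 \<in> P" using \<open>P \<noteq> {}\<close> by blast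
  have "\<rho>0 \<le> Sup P" using bdd \<rho>0 by (rule cSup_upper[rotated])
  then have sp: "0 < Sup P" using \<rho>0 by (simp add: P_def)
  then obtain \<rho> where \<rho>: "\<rho> \<in> P" "Sup P / 2 < \<rho>"
    using less_cSupD[OF \<open>P \<noteq> {}\<close>, of "Sup P / 2"] by auto
  have "2 * \<rho> \<notin> P"
  proof
    assume "2 * \<rho> \<in> P"
    then have "2 * \<rho> \<le> Sup P" using bdd by (rule cSup_upper)
    then show False using \<rho>(2) by simp
  qed
  moreover have "0 < \<rho>" using \<rho>(1) by (simp add: P_def)
  ultimately have "\<forall>s\<in>S. \<exists>t\<in>cball x (2 * \<rho>). 1 \<le> \<bar>\<psi> s t\<bar>"
    unfolding P_def by (auto simp: not_less)
  moreover obtain s' where "s' \<in> S" "\<forall>t\<in>cball x \<rho>. \<bar>\<psi> s' t\<bar> < 1" using \<rho>(1) unfolding P_def by blast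
  ultimately show ?thesis using \<open>0 < \<rho>\<close> ub[OF \<rho>(1)] by blast
qed

text \<open>Induction on the number of ranks still available. Around a point where some function is
  below 1, a maximal ball singles out a responsible element; it joins the flag, and the induction
  hypothesis treats the elements comparable with it and of different rank. A ball centred in
  \<open>cball c r\<close> whose radius is 5 times at most \<open>2 * r\<close> reaches no further
  than \<open>11 * r\<close> from \<open>c\<close>; hence the factor 11 per stage.\<close>

lemma quantitative_nondivergence:
  assumes symp: "symp cmp" and C: "1 \<le> C" and K: "1 \<le> K"
  shows "\<exists>C'\<ge>0. \<forall>(S::'s set) R \<psi> c r \<tau>. finite R \<longrightarrow> card R = n \<longrightarrow> rk ` S \<subseteq> R \<longrightarrow> 0 < r \<longrightarrow> 0 < \<tau> \<longrightarrow>
     (\<forall>s\<in>S. good_on K C (cball c (11 ^ n * r)) (\<psi> s) \<and> (\<forall>t. 0 \<le> \<psi> s t) \<and> (\<exists>t\<in>cball c r. 1 \<le> \<psi> s t)) \<longrightarrow>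
     (\<exists>W\<in>lmeasurable. measure lebesgue W \<le> C' * \<tau> * r \<and>
        (\<forall>x\<in>cball c r - W. flag_marked cmp rk S \<psi> (\<tau> ^ K) (C * 5 ^ K) x))"
    (is "\<exists>C'\<ge>0. ?P n C'")
proof (induction n)
  case 0
  have "?P 0 0"
  proof (intro allI impI)
    fix S :: "'s set" and R :: "nat set" and \<psi> :: "'s \<Rightarrow> real \<Rightarrow> real" and c r \<tau> :: real
    assume "finite R" "card R = 0" "rk ` S \<subseteq> R"
    then have "S = {}" by auto
    then show "\<exists>W\<in>lmeasurable. measure lebesgue W \<le> 0 * \<tau> * r \<and>
        (\<forall>x\<in>cball c r - W. flag_marked cmp rk S \<psi> (\<tau> ^ K) (C * 5 ^ K) x)"
      by (intro bexI[of _ "{}"]) (auto intro: flag_markedI_empty)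
  qed
  then show ?case by blast
next
  case (Suc n)
  have sym: "cmp a b \<Longrightarrow> cmp b a" for a b using symp by (rule sympD)
  from Suc obtain C1 where C1: "0 \<le> C1" "?P n C1" by blast
  \<comment> \<open>The 5 is the dilation in the covering lemma, the 10 the length of a dilated ball
    in units of the radius, and the 3 bounds the sum of the radii of the disjoint balls, which lie
    in \<open>cball c (3 * r)\<close>.\<close>
  define C2 where "C2 = 3 * (C1 * 5 + C * 10)"
  have "?P (Suc n) C2"
  proof (intro allI impI)
    fix S :: "'s set" and R :: "nat set" and \<psi> :: "'s \<Rightarrow> real \<Rightarrow> real" and c r \<tau> :: real
    assume R: "finite R" "card R = Suc n" "rk ` S \<subseteq> R" and r: "0 < r" and \<tau>: "0 < \<tau>"
      and H: "\<forall>s\<in>S. good_on K C (cball c (11 ^ Suc n * r)) (\<psi> s) \<and> (\<forall>t. 0 \<le> \<psi> s t) \<and> (\<exists>t\<in>cball c r. 1 \<le> \<psi> s t)"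
    let ?I = "cball c (11 ^ Suc n * r)"
    have good: "good_on K C ?I (\<psi> s)" and nn: "0 \<le> \<psi> s t" if "s \<in> S" for s t
      using H that by blast+
    have ab: "\<bar>\<psi> s t\<bar> = \<psi> s t" if "s \<in> S" for s t using nn[OF that] by simp
    have p1: "(1::real) \<le> 11 ^ n" by simp
    have "11 * r \<le> 11 ^ Suc n * r" using p1 r by simp
    then have sub11: "cball c (11 * r) \<subseteq> ?I" by (intro subset_cball)
    define E where "E = {x \<in> cball c r. \<exists>s\<in>S. \<psi> s x < 1}"
    define ch where "ch x \<rho> s \<longleftrightarrow> 0 < \<rho> \<and> \<rho> \<le> 2 * r \<and> s \<in> S \<and> (\<forall>t\<in>cball x \<rho>. \<bar>\<psi> s t\<bar> < 1) \<and>
           (\<forall>s\<in>S. \<exists>t\<in>cball x (2 * \<rho>). 1 \<le> \<bar>\<psi> s t\<bar>)" for x \<rho> s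
    have "\<exists>\<rho> s. ch x \<rho> s" if x: "x \<in> E" for x
    proof -
      obtain s where s: "s \<in> S" "\<psi> s x < 1" "x \<in> cball c r" using x by (auto simp: E_def)
      show ?thesis
        unfolding ch_def
      proof (rule maximal_small_ball[of S ?I \<psi> "ball c (11 * r)" x s c r])
        show "continuous_on ?I (\<psi> s)" if "s \<in> S" for s by (rule good_on_continuous[OF good[OF that]])
        show "ball c (11 * r) \<subseteq> ?I" using ball_subset_cball sub11 by (rule order_trans)
        show "x \<in> ball c (11 * r)" using s(3) r by auto
        show "\<bar>\<psi> s x\<bar> < 1" using s ab by simp
        show "\<exists>t\<in>cball c r. 1 \<le> \<bar>\<psi> s t\<bar>" if "s \<in> S" for s using H that ab by simp
      qed (use s in auto)
    qed
    then obtain \<rho> s where ch: "\<And>x. x \<in> E \<Longrightarrow> ch x (\<rho> x) (s x)" by metis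
    have \<rho>: "\<And>x. x \<in> E \<Longrightarrow> 0 < \<rho> x" "\<And>x. x \<in> E \<Longrightarrow> \<rho> x \<le> 2 * r"
      "\<And>x. x \<in> E \<Longrightarrow> s x \<in> S" "\<And>x t. x \<in> E \<Longrightarrow> t \<in> cball x (\<rho> x) \<Longrightarrow> \<bar>\<psi> (s x) t\<bar> < 1"
      "\<And>x u. x \<in> E \<Longrightarrow> u \<in> S \<Longrightarrow> \<exists>t\<in>cball x (2 * \<rho> x). 1 \<le> \<bar>\<psi> u t\<bar>"
      using ch unfolding ch_def by blast+
    have "E \<subseteq> (\<Union>x\<in>E. cball x (\<rho> x))" using \<rho>(1) by (auto intro!: bexI simp: less_imp_le)
    then obtain Q where Q: "countable Q" "Q \<subseteq> E"
       "pairwise (\<lambda>i j. disjnt (cball i (\<rho> i)) (cball j (\<rho> j))) Q" "E \<subseteq> (\<Union>i\<in>Q. cball i (5 * \<rho> i))"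
      using Vitali_covering_lemma_cballs[of E "\<lambda>x. x" \<rho> E "2 * r"] \<rho>(1,2) by auto
    have Ex: "x \<in> cball c r" if "x \<in> E" for x using that by (auto simp: E_def)
    have sub: "cball x (11 ^ n * (5 * \<rho> x)) \<subseteq> ?I" if "x \<in> E" for x
    proof
      fix y assume "y \<in> cball x (11 ^ n * (5 * \<rho> x))"
      then have "dist x y \<le> 11 ^ n * (5 * \<rho> x)" by simp
      also have "\<dots> \<le> 11 ^ n * (10 * r)" using \<rho>(2)[OF that] by simp
      finally have "dist c y \<le> r + 11 ^ n * (10 * r)"
        using Ex[OF that] dist_triangle[of c y x] by simp
      also have "\<dots> \<le> 11 ^ n * r + 11 ^ n * (10 * r)" using p1 r by simp
      also have "\<dots> = 11 ^ Suc n * r" by (simp add: algebra_simps)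
      finally show "y \<in> ?I" by (simp only: mem_cball)
    qed
    have sub5: "cball x (5 * \<rho> x) \<subseteq> ?I" if "x \<in> E" for x
    proof -
      have "1 * (5 * \<rho> x) \<le> 11 ^ n * (5 * \<rho> x)" using p1 \<rho>(1)[OF that] by (intro mult_right_mono) auto
      then have "cball x (5 * \<rho> x) \<subseteq> cball x (11 ^ n * (5 * \<rho> x))" by (intro subset_cball) simp
      then show ?thesis using sub[OF that] by blast
    qed
    define Sx where "Sx x = {u \<in> S. cmp u (s x) \<and> rk u \<noteq> rk (s x)}" for x
    define ok where "ok x W \<longleftrightarrow> measure lebesgue W \<le> C1 * \<tau> * (5 * \<rho> x) \<and>
        (\<forall>y\<in>cball x (5 * \<rho> x) - W. flag_marked cmp rk (Sx x) \<psi> (\<tau> ^ K) (C * 5 ^ K) y)" for x W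
    have "\<exists>W\<in>lmeasurable. ok x W" if x: "x \<in> E" for x
    proof -
      have "finite (R - {rk (s x)})" "card (R - {rk (s x)}) = n" "rk ` Sx x \<subseteq> R - {rk (s x)}" "0 < 5 * \<rho> x"
        using R \<rho>(1,3)[OF x] by (auto simp: Sx_def)
      moreover have "\<forall>u\<in>Sx x. good_on K C (cball x (11 ^ n * (5 * \<rho> x))) (\<psi> u) \<and> (\<forall>t. 0 \<le> \<psi> u t) \<and>
          (\<exists>t\<in>cball x (5 * \<rho> x). 1 \<le> \<psi> u t)"
      proof
        fix u assume "u \<in> Sx x"
        then have u: "u \<in> S" by (simp add: Sx_def)
        obtain t where "t \<in> cball x (2 * \<rho> x)" "1 \<le> \<bar>\<psi> u t\<bar>" using \<rho>(5)[OF x u] by blast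
        then have "t \<in> cball x (5 * \<rho> x)" "1 \<le> \<psi> u t" using \<rho>(1)[OF x] ab[OF u] by auto
        then show "good_on K C (cball x (11 ^ n * (5 * \<rho> x))) (\<psi> u) \<and> (\<forall>t. 0 \<le> \<psi> u t) \<and>
          (\<exists>t\<in>cball x (5 * \<rho> x). 1 \<le> \<psi> u t)"
          using good_on_subset[OF good[OF u] sub[OF x]] nn[OF u] by blast
      qed
      ultimately show ?thesis unfolding ok_def using C1(2)[rule_format, of "R - {rk (s x)}" "Sx x" "5 * \<rho> x" \<tau> x \<psi>] \<tau> by blast
    qed
    then obtain W where W': "\<And>x. x \<in> E \<Longrightarrow> W x \<in> lmeasurable \<and> ok x (W x)" by metis
    have W: "\<And>x. x \<in> E \<Longrightarrow> W x \<in> lmeasurable"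
      "\<And>x. x \<in> E \<Longrightarrow> measure lebesgue (W x) \<le> C1 * \<tau> * (5 * \<rho> x)"
      "\<And>x y. x \<in> E \<Longrightarrow> y \<in> cball x (5 * \<rho> x) - W x \<Longrightarrow> flag_marked cmp rk (Sx x) \<psi> (\<tau> ^ K) (C * 5 ^ K) y"
      using W' unfolding ok_def by blast+
    \<comment> \<open>Two things can go wrong in a dilated ball: the induction hypothesis gives
      nothing on \<open>W x\<close>, and on \<open>V x\<close> the responsible function itself falls
      below the lower bound required in a flag.\<close>
    define V where "V x = {t \<in> {x - 5 * \<rho> x..x + 5 * \<rho> x}. \<bar>\<psi> (s x) t\<bar> < \<tau> ^ K}" for x
    have V1: "V x \<in> lmeasurable" if "x \<in> E" for x
      unfolding V_def using sub5[OF that]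
      by (intro sublevel_lmeasurable continuous_on_rabs continuous_on_subset[OF good_on_continuous[OF good[OF \<rho>(3)[OF that]]]])
        (simp add: cball_real)
    have V2: "measure lebesgue (V x) \<le> C * \<tau> * (10 * \<rho> x)" if x: "x \<in> E" for x
    proof -
      obtain t where t: "t \<in> cball x (2 * \<rho> x)" "1 \<le> \<bar>\<psi> (s x) t\<bar>" using \<rho>(5)[OF x \<rho>(3)[OF x]] by blast
      have "measure lebesgue (V x) \<le> C * \<tau> * ((x + 5 * \<rho> x) - (x - 5 * \<rho> x))"
        unfolding V_def
        by (rule good_on_sublevel_measure[OF good[OF \<rho>(3)[OF x]] _ _ C K \<tau> _ t(2)])
          (use \<rho>(1)[OF x] sub5[OF x] t(1) in \<open>auto simp: cball_real\<close>)
      also have "(x + 5 * \<rho> x) - (x - 5 * \<rho> x) = 10 * \<rho> x" by simp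
      finally show ?thesis .
    qed
    define B where "B = (\<Union>x\<in>Q. W x \<union> V x)"
    have fin: "measure lebesgue (\<Union>x\<in>Q'. W x \<union> V x) \<le> C2 * \<tau> * r" if Q': "Q' \<subseteq> Q" "finite Q'" for Q'
    proof -
      have E': "x \<in> E" if "x \<in> Q'" for x using that Q' Q(2) by blast
      have "measure lebesgue (\<Union>x\<in>Q'. W x \<union> V x) \<le> (\<Sum>x\<in>Q'. measure lebesgue (W x \<union> V x))"
        using W(1) V1 E' Q'(2) by (intro measure_UNION_le) auto
      also have "\<dots> \<le> (\<Sum>x\<in>Q'. C1 * \<tau> * (5 * \<rho> x) + C * \<tau> * (10 * \<rho> x))"
      proof (rule sum_mono)
        fix x assume "x \<in> Q'"
        note x = E'[OF this]
        have "measure lebesgue (W x \<union> V x) \<le> measure lebesgue (W x) + measure lebesgue (V x)"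
          using W(1)[OF x] V1[OF x] by (intro measure_Un_le) auto
        then show "measure lebesgue (W x \<union> V x) \<le> C1 * \<tau> * (5 * \<rho> x) + C * \<tau> * (10 * \<rho> x)"
          using W(2)[OF x] V2[OF x] by linarith
      qed
      also have "\<dots> = (C1 * 5 + C * 10) * \<tau> * (\<Sum>x\<in>Q'. \<rho> x)"
        unfolding sum_distrib_left by (intro sum.cong refl) (simp add: algebra_simps)
      also have "\<dots> \<le> (C1 * 5 + C * 10) * \<tau> * (3 * r)"
      proof (rule mult_left_mono)
        have "(\<Sum>x\<in>Q'. 2 * \<rho> x) = (\<Sum>x\<in>Q'. measure lebesgue (cball x (\<rho> x)))"
          using \<rho>(1) E' by (intro sum.cong) (auto simp: cball_real less_imp_le)
        also have "\<dots> = measure lebesgue (\<Union>x\<in>Q'. cball x (\<rho> x))"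
        proof (rule measure_UNION'[symmetric])
          show "pairwise (\<lambda>x y. disjnt (cball x (\<rho> x)) (cball y (\<rho> y))) Q'"
            using Q(3) Q'(1) by (rule pairwise_subset)
        qed (use Q'(2) in auto)
        also have "\<dots> \<le> measure lebesgue (cball c (3 * r))"
        proof (rule measure_mono_fmeasurable)
          show "(\<Union>x\<in>Q'. cball x (\<rho> x)) \<subseteq> cball c (3 * r)"
          proof clarify
            fix x y assume xy: "x \<in> Q'" "y \<in> cball x (\<rho> x)"
            then show "y \<in> cball c (3 * r)"
              using Ex[OF E'[OF xy(1)]] \<rho>(2)[OF E'[OF xy(1)]] dist_triangle[of c y x] by simp
          qed
        qed (use Q'(2) in auto)
        also have "\<dots> = 6 * r" using r by (simp add: cball_real)
        finally show "(\<Sum>x\<in>Q'. \<rho> x) \<le> 3 * r" by (simp add: sum_distrib_left[symmetric])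
        show "0 \<le> (C1 * 5 + C * 10) * \<tau>" using C1(1) C \<tau> by simp
      qed
      finally show ?thesis by (simp add: C2_def mult_ac)
    qed
    have WV: "W x \<union> V x \<in> lmeasurable" if "x \<in> Q" for x
      using W(1) V1 that Q(2) by blast
    have "B \<in> lmeasurable" "measure lebesgue B \<le> C2 * \<tau> * r"
      unfolding B_def using fmeasurable_UN_bound[OF Q(1) WV fin] measure_UN_bound[OF Q(1) WV fin] by blast+
    moreover have "flag_marked cmp rk S \<psi> (\<tau> ^ K) (C * 5 ^ K) y" if y: "y \<in> cball c r - B" for y
    proof (cases "y \<in> E")
      case False
      then show ?thesis using y by (intro flag_markedI_empty) (auto simp: E_def not_less)
    next
      case True
      then obtain x where x: "x \<in> Q" "y \<in> cball x (5 * \<rho> x)" using Q(4) by blast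
      then have xE: "x \<in> E" using Q(2) by blast
      have yW: "y \<notin> W x" "y \<notin> V x" using y x(1) by (auto simp: B_def)
      have "\<not> \<bar>\<psi> (s x) y\<bar> < \<tau> ^ K" using yW(2) x(2) unfolding V_def cball_real by blast
      then have low: "\<tau> ^ K \<le> \<psi> (s x) y" using ab[OF \<rho>(3)[OF xE]] by simp
      have "\<bar>\<psi> (s x) y\<bar> \<le> C * 5 ^ K"
        by (rule good_on_dilation_bound[OF good[OF \<rho>(3)[OF xE]] \<rho>(1)[OF xE] sub5[OF xE] \<rho>(4)[OF xE] x(2)])
      then have up: "\<psi> (s x) y \<le> C * 5 ^ K" using ab[OF \<rho>(3)[OF xE]] by simp
      show ?thesis
        using W(3)[OF xE, of y] x(2) yW(1) sym \<rho>(3)[OF xE] low up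
        unfolding Sx_def by (intro flag_marked_insert[of cmp rk S "s x"]) auto
    qed
    ultimately show "\<exists>W\<in>lmeasurable. measure lebesgue W \<le> C2 * \<tau> * r \<and>
        (\<forall>x\<in>cball c r - W. flag_marked cmp rk S \<psi> (\<tau> ^ K) (C * 5 ^ K) x)" by blast
  qed
  moreover have "0 \<le> C2" using C1(1) C by (simp add: C2_def)
  ultimately show ?case by blast
qed

section \<open>Linear forms and covolumes of integer lattices\<close>

lemma measure_box_cart:
  fixes a b :: "real^'m"
  assumes "\<And>i. a $ i \<le> b $ i"
  shows "measure lebesgue (box a b) = (\<Prod>i\<in>UNIV. b $ i - a $ i)"
proof -
  have "measure lebesgue (box a b) = measure lborel (box a b)" by simp
  also have "\<dots> = measure lborel (cbox a b)" by (simp add: measure_lborel_box_eq measure_lborel_cbox_eq)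
  also have "\<dots> = (\<Prod>i\<in>UNIV. b $ i - a $ i)"
    using assms by (intro content_cbox_cart) (simp add: interval_ne_empty_cart)
  finally show ?thesis .
qed

lemma measure_cbox_cart:
  fixes a b :: "real^'m"
  assumes "\<And>i. a $ i \<le> b $ i"
  shows "measure lebesgue (cbox a b) = (\<Prod>i\<in>UNIV. b $ i - a $ i)"
  using content_cbox_cart[of a b] assms by (simp add: interval_ne_empty_cart)

text \<open>A packing argument. If the conclusion failed, the translates of an open cube of side
  \<open>s\<close> by the images of integer vectors would be disjoint. Comparing the volume of those
  belonging to a box of side \<open>N\<close> with the image of a slightly larger box, and letting
  \<open>N\<close> grow, gives \<open>s ^ CARD('m) \<le> \<bar>det M\<bar>\<close>.\<close>

lemma minkowski_linear_forms:
  fixes M :: "real^'m::{finite,wellorder}^'m::_"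
  assumes M: "det M \<noteq> 0" and s: "0 < s" and small: "\<bar>det M\<bar> < s ^ CARD('m)"
  shows "\<exists>a. int_vec a \<and> a \<noteq> 0 \<and> (\<forall>i. \<bar>(a v* M) $ i\<bar> < s)"
proof (rule ccontr)
  assume neg: "\<not> ?thesis"
  let ?m = "CARD('m)"
  define f where "f x = transpose M *v x" for x
  have lin: "linear f" unfolding f_def by (rule matrix_vector_mul_linear)
  have f: "f a = a v* M" for a by (simp add: f_def)
  have mf: "\<bar>det (matrix f)\<bar> = \<bar>det M\<bar>" 
  proof -
    have "matrix f = transpose M" unfolding f_def[abs_def] by (rule matrix_of_matrix_vector_mul)
    then show ?thesis by (simp only: det_transpose)
  qed
  have "inj f" using det_nz_iff_inj[OF lin] mf M by auto
  then obtain g where g: "linear g" "\<And>x. f (g x) = x"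
    using linear_injective_isomorphism[OF lin] by blast
  \<comment> \<open>Two points of this open cube differ by less than \<open>s\<close> in each
    coordinate, so overlapping translates would produce a forbidden integer vector.\<close>
  define U :: "(real^'m::_) set" where "U = box 0 (\<chi> i. s)"
  have memU: "u \<in> U \<longleftrightarrow> (\<forall>i. 0 < u $ i \<and> u $ i < s)" for u
    by (auto simp: U_def mem_box_cart)
  have mU: "measure lebesgue U = s ^ ?m" unfolding U_def using s by (subst measure_box_cart) auto
  have "bounded (g ` U)" unfolding U_def using g(1) by (intro bounded_linear_image) (auto simp: linear_conv_bounded_linear)
  then obtain c where c: "\<And>u. u \<in> U \<Longrightarrow> norm (g u) \<le> c" by (auto simp: bounded_iff)
  have "0 \<le> c"
  proof -
    have "(\<chi> i. s / 2) \<in> U" using s by (simp add: memU)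
    from c[OF this] show ?thesis using norm_ge_zero order_trans by blast
  qed
  have main: "real N ^ ?m * s ^ ?m \<le> \<bar>det M\<bar> * (real N + 2 * c) ^ ?m" for N :: nat
  proof -
    define H :: "('m::_ \<Rightarrow> nat) set" where "H = (UNIV \<rightarrow>\<^sub>E {..<N})"
    define v :: "('m::_ \<Rightarrow> nat) \<Rightarrow> real^'m::_" where "v h = (\<chi> i. real (h i))" for h
    have finH: "finite H" and cardH: "card H = N ^ ?m"
      unfolding H_def by (auto simp: finite_PiE card_PiE)
    have U1: "(+) (f (v h)) ` U \<in> lmeasurable" for h
      unfolding U_def by (intro measurable_translation) (rule lmeasurable_box)
    have disj: "pairwise (\<lambda>h k. disjnt ((+) (f (v h)) ` U) ((+) (f (v k)) ` U)) H"
    proof (rule pairwiseI)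
      fix h k :: "'m::_ \<Rightarrow> nat" assume "h \<noteq> k"
      show "disjnt ((+) (f (v h)) ` U) ((+) (f (v k)) ` U)"
      proof (rule ccontr)
        assume "\<not> disjnt ((+) (f (v h)) ` U) ((+) (f (v k)) ` U)"
        then obtain x y where xy: "x \<in> U" "y \<in> U" "f (v h) + x = f (v k) + y"
          by (auto simp: disjnt_iff)
        have "f (v h - v k) = y - x" using xy(3) by (simp add: linear_diff[OF lin] algebra_simps)
        moreover have "\<bar>(y - x) $ i\<bar> < s" for i
          using xy(1,2)[unfolded memU, rule_format, of i] by auto
        moreover have "int_vec (v h - v k)" by (simp add: int_vec_def v_def)
        moreover have "v h - v k \<noteq> 0" using \<open>h \<noteq> k\<close> by (auto simp: v_def vec_eq_iff)
        ultimately show False using neg f by metis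
      qed
    qed
    have "real N ^ ?m * s ^ ?m = (\<Sum>h\<in>H. measure lebesgue ((+) (f (v h)) ` U))"
      using cardH by (simp add: measure_translation mU)
    also have "\<dots> = measure lebesgue (\<Union>h\<in>H. (+) (f (v h)) ` U)"
      using measure_UNION'[OF finH U1 disj] by simp
    also have "\<dots> \<le> measure lebesgue (f ` cbox (\<chi> i. - c) (\<chi> i. real N + c))"
    proof (rule measure_mono_fmeasurable)
      show "(\<Union>h\<in>H. (+) (f (v h)) ` U) \<subseteq> f ` cbox (\<chi> i. - c) (\<chi> i. real N + c)"
      proof clarify
        fix h u assume h: "h \<in> H" and u: "u \<in> U"
        have "f (v h) + u = f (v h + g u)" by (simp add: linear_add[OF lin] g(2))
        moreover have "v h + g u \<in> cbox (\<chi> i. - c) (\<chi> i. real N + c)"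
          unfolding mem_box_cart
        proof
          fix i
          have "\<bar>g u $ i\<bar> \<le> c" using c[OF u] component_le_norm_cart[of "g u" i] by linarith
          moreover have "h i < N" using h by (auto simp: H_def)
          ultimately show "(\<chi> i. - c) $ i \<le> (v h + g u) $ i \<and> (v h + g u) $ i \<le> (\<chi> i. real N + c) $ i"
            by (auto simp: v_def abs_le_iff)
        qed
        ultimately show "f (v h) + u \<in> f ` cbox (\<chi> i. - c) (\<chi> i. real N + c)" by (metis imageI)
      qed
      show "f ` cbox (\<chi> i. - c) (\<chi> i. real N + c) \<in> lmeasurable"
        by (rule measurable_linear_image[OF lin]) simp
    qed (use U1 finH in auto)
    also have "\<dots> = \<bar>det M\<bar> * measure lebesgue (cbox (\<chi> i. - c) (\<chi> i. real N + c) :: (real^'m::_) set)"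
      by (subst measure_linear_image[OF lin]) (simp_all add: mf)
    also have "measure lebesgue (cbox (\<chi> i. - c) (\<chi> i. real N + c) :: (real^'m::_) set) = (real N + 2 * c) ^ ?m"
      using \<open>0 \<le> c\<close> by (subst measure_cbox_cart) (auto simp: algebra_simps)
    finally show ?thesis .
  qed
  have "s ^ ?m \<le> \<bar>det M\<bar> * (1 + 2 * c / real (Suc N)) ^ ?m" for N
  proof -
    have "real (Suc N) ^ ?m * s ^ ?m \<le> \<bar>det M\<bar> * (real (Suc N) + 2 * c) ^ ?m" by (rule main)
    also have "real (Suc N) + 2 * c = real (Suc N) * (1 + 2 * c / real (Suc N))"
      by (simp add: distrib_left)
    also have "\<bar>det M\<bar> * (real (Suc N) * (1 + 2 * c / real (Suc N))) ^ ?m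
        = real (Suc N) ^ ?m * (\<bar>det M\<bar> * (1 + 2 * c / real (Suc N)) ^ ?m)"
      by (simp only: power_mult_distrib mult.left_commute)
    finally show ?thesis by (simp only: mult_le_cancel_left_pos zero_less_power of_nat_0_less_iff zero_less_Suc)
  qed
  moreover have "(\<lambda>N. \<bar>det M\<bar> * (1 + 2 * c / real (Suc N)) ^ ?m) \<longlonglongrightarrow> \<bar>det M\<bar> * (1 + 0) ^ ?m"
    by (intro tendsto_intros LIMSEQ_Suc[OF lim_const_over_n])
  ultimately have "s ^ ?m \<le> \<bar>det M\<bar> * (1 + 0) ^ ?m"
    by (intro LIMSEQ_le_const) auto
  then show False using small by simp
qed

section \<open>Covolumes of tuples of vectors\<close>

definition vidx :: "'m::finite \<Rightarrow> nat" where "vidx = to_nat_on UNIV"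

lemma bij_vidx: "bij_betw (vidx :: 'm::finite \<Rightarrow> nat) UNIV {..<CARD('m)}"
  unfolding vidx_def by (rule to_nat_on_finite) simp

lemma vidx_less: "vidx (a::'m::finite) < CARD('m)"
  using bij_betwE[OF bij_vidx[where 'm='m]] by simp

lemma vidx_eq_iff [simp]: "vidx a = vidx b \<longleftrightarrow> a = (b::'m::finite)"
  using bij_betw_imp_inj_on[OF bij_vidx[where 'm='m]] by (auto dest: injD)

lemma vidx_surj: "j < CARD('m) \<Longrightarrow> \<exists>a::'m::finite. vidx a = j"
  using bij_betw_imp_surj_on[OF bij_vidx[where 'm='m]] by (metis imageE lessThan_iff)

lemma bij_vidx_less:
  assumes "j \<le> CARD('m)"
  shows "bij_betw vidx {a::'m::finite. vidx a < j} {..<j}"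
proof (rule bij_betw_imageI)
  show "vidx ` {a::'m. vidx a < j} = {..<j}"
  proof
    show "{..<j} \<subseteq> vidx ` {a::'m. vidx a < j}"
    proof
      fix i assume i: "i \<in> {..<j}"
      then obtain a :: 'm where "vidx a = i" using vidx_surj[where 'm='m, of i] assms by auto
      then show "i \<in> vidx ` {a::'m. vidx a < j}" using i by force
    qed
  qed auto
qed (simp add: inj_on_def)

lemma det_row_expand:
  fixes R :: "'m::finite \<Rightarrow> real^'m"
  assumes "finite S"
  shows "det (\<chi> a. if a = a0 then (\<Sum>i\<in>S. c i *s r i) else R a) =
    (\<Sum>i\<in>S. c i * det (\<chi> a. if a = a0 then r i else R a))"
  using det_linear_row_sum[OF assms, of a0 "\<lambda>_ i. c i *s r i" R] by (simp add: det_row_mul)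

lemma det_two_equal_rows:
  fixes A :: "real^'m^'m"
  assumes "a \<noteq> b" "A $ a = A $ b"
  shows "det A = 0"
  using assms by (intro det_identical_rows[of a b]) (auto simp: row_def)

text \<open>Only the values of \<open>\<sigma>\<close> at rows numbered \<open>j\<close> or higher
  enter, and a repetition among them makes the determinant vanish. So \<open>\<sigma>\<close> may
  range over all functions without enlarging the maximum of the minors.\<close>

definition dmat :: "nat \<Rightarrow> (nat \<Rightarrow> real^'m) \<Rightarrow> ('m \<Rightarrow> 'm) \<Rightarrow> real^'m^'m" where
  "dmat j w \<sigma> = (\<chi> a. if vidx a < j then w (vidx a) else axis (\<sigma> a) 1)"

text \<open>Up to constants, the covolume of the lattice spanned by \<open>w 0, \<dots>, w (j - 1)\<close>: its
  \<open>j\<close>-minors are obtained by completing the vectors with coordinate vectors.\<close>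

definition wvol :: "nat \<Rightarrow> (nat \<Rightarrow> real^'m) \<Rightarrow> real" where
  "wvol j w = Max (range (\<lambda>\<sigma>. \<bar>det (dmat j w \<sigma>)\<bar>))"

lemma det_le_wvol: "\<bar>det (dmat j w \<sigma>)\<bar> \<le> wvol j w"
  unfolding wvol_def by (intro Max_ge) auto

lemma wvol_attained: obtains \<sigma> where "wvol j w = \<bar>det (dmat j w \<sigma>)\<bar>"
proof -
  have "wvol j w \<in> range (\<lambda>\<sigma>. \<bar>det (dmat j w \<sigma>)\<bar>)" unfolding wvol_def by (intro Max_in) auto
  then show ?thesis using that by blast
qed

lemma wvol_nonneg: "0 \<le> wvol j w"
  using det_le_wvol[of j w] abs_ge_zero order_trans by blast

lemma wvol_leI: "(\<And>\<sigma>. \<bar>det (dmat j w \<sigma>)\<bar> \<le> B) \<Longrightarrow> wvol j w \<le> B"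
  using wvol_attained[of j w] by metis

lemma dmat_update_row:
  assumes "vidx a0 \<ge> j"
  shows "(\<chi> a. if a = a0 then axis i 1 else dmat j w \<sigma> $ a) = dmat j w (\<sigma>(a0 := i))"
  using assms by (auto simp: dmat_def vec_eq_iff)

lemma axis_expansion: "(x :: real^'m) = (\<Sum>i\<in>UNIV. x $ i *s axis i 1)"
  by (simp add: basis_expansion)

text \<open>Expanding the last row in coordinate vectors writes the determinants of the longer tuple
  in terms of those of the shorter one. A short vector thus forces a small ratio of covolumes, which
  is how bounds on covolumes become lower bounds on lengths.\<close>

lemma wvol_Suc_le:
  fixes w :: "nat \<Rightarrow> real^'m"
  assumes j: "j < CARD('m)"
  shows "wvol (Suc j) (w(j := u)) \<le> real CARD('m) * norm u * wvol j w"
proof (rule wvol_leI)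
  fix \<sigma> :: "'m \<Rightarrow> 'm"
  obtain a0 :: 'm where a0: "vidx a0 = j" using vidx_surj[OF j] by blast
  have "dmat (Suc j) (w(j := u)) \<sigma> = (\<chi> a. if a = a0 then u else dmat j w \<sigma> $ a)"
    using a0 vidx_eq_iff[of _ a0] by (auto simp: dmat_def vec_eq_iff less_Suc_eq)
  also have "\<dots> = (\<chi> a. if a = a0 then (\<Sum>i\<in>UNIV. u $ i *s axis i 1) else dmat j w \<sigma> $ a)"
    by (simp only: axis_expansion[symmetric])
  finally have "det (dmat (Suc j) (w(j := u)) \<sigma>) = (\<Sum>i\<in>UNIV. u $ i * det (dmat j w (\<sigma>(a0 := i))))"
    by (simp add: det_row_expand dmat_update_row a0)
  also have "\<bar>\<dots>\<bar> \<le> (\<Sum>i\<in>(UNIV::'m set). norm u * wvol j w)"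
    by (rule order_trans[OF sum_abs sum_mono]) 
      (auto simp: abs_mult intro!: mult_mono component_le_norm_cart det_le_wvol)
  finally show "\<bar>det (dmat (Suc j) (w(j := u)) \<sigma>)\<bar> \<le> real CARD('m) * norm u * wvol j w" by simp
qed

text \<open>The factor is the determinant of \<open>A\<close> completed by an identity block, the
  same for every tuple and every completion.\<close>

lemma det_dmat_change_basis:
  assumes j: "j \<le> CARD('m)"
  shows "\<exists>l. \<forall>(w :: nat \<Rightarrow> real^'m) w' \<sigma>. (\<forall>a<j. w' a = (\<Sum>b<j. A a b *\<^sub>R w b)) \<longrightarrow>
           det (dmat j w' \<sigma>) = l * det (dmat j w \<sigma>)"
proof -
  define B :: "real^'m^'m" where "B = (\<chi> a b. if vidx a < j then (if vidx b < j then A (vidx a) (vidx b) else 0)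
     else if a = b then 1 else 0)"
  have "det (dmat j w' \<sigma>) = det B * det (dmat j w \<sigma>)"
    if w': "\<forall>a<j. w' a = (\<Sum>b<j. A a b *\<^sub>R w b)" for w w' :: "nat \<Rightarrow> real^'m" and \<sigma>
  proof -
    have "(B ** dmat j w \<sigma>) $ a $ i = dmat j w' \<sigma> $ a $ i" for a i
    proof (cases "vidx a < j")
      case True
      have "(B ** dmat j w \<sigma>) $ a $ i = (\<Sum>b\<in>(UNIV::'m set). if vidx b < j then A (vidx a) (vidx b) * w (vidx b) $ i else 0)"
        unfolding matrix_matrix_mult_def vec_lambda_beta
        by (rule sum.cong[OF refl]) (simp add: True B_def dmat_def)
      also have "\<dots> = (\<Sum>b\<in>{b::'m. vidx b < j}. A (vidx a) (vidx b) * w (vidx b) $ i)"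
        by (simp add: sum.If_cases)
      also have "\<dots> = (\<Sum>b<j. A (vidx a) b * w b $ i)"
        by (rule sum.reindex_bij_betw[OF bij_vidx_less[OF j]])
      also have "\<dots> = dmat j w' \<sigma> $ a $ i" using True w' by (simp add: dmat_def)
      finally show ?thesis .
    next
      case False
      have "(B ** dmat j w \<sigma>) $ a $ i = (\<Sum>b\<in>UNIV. if a = b then dmat j w \<sigma> $ b $ i else 0)"
        unfolding matrix_matrix_mult_def vec_lambda_beta
        by (rule sum.cong[OF refl]) (simp add: False B_def)
      then show ?thesis using False by (simp add: dmat_def)
    qed
    then have "B ** dmat j w \<sigma> = dmat j w' \<sigma>" by (simp add: vec_eq_iff)
    then show ?thesis by (metis det_mul)
  qed
  then show ?thesis by blast
qed

lemma wvol_pos: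
  fixes w :: "nat \<Rightarrow> real^'m"
  assumes j: "j \<le> CARD('m)" and inj: "inj_on w {..<j}" and ind: "independent (w ` {..<j})"
  shows "0 < wvol j w"
proof -
  let ?S = "w ` {..<j}" and ?X = "range (\<lambda>i. axis i 1) :: (real^'m) set"
  obtain B where B: "?S \<subseteq> B" "B \<subseteq> ?S \<union> ?X" "independent B" "?S \<union> ?X \<subseteq> span B"
    using maximal_independent_subset_extend[of ?S "?S \<union> ?X"] ind by auto
  have "(x::real^'m) \<in> span B" for x
  proof -
    have "(\<Sum>i\<in>UNIV. x $ i *s axis i 1) \<in> span B"
      using B(4) by (intro span_sum) (auto simp: scalar_mult_eq_scaleR intro!: span_scale)
    then show ?thesis by (simp only: axis_expansion[symmetric])
  qed
  then have sB: "span B = UNIV" by auto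
  have finB: "finite B" using B(3) by (rule independent_imp_finite)
  have "card B = CARD('m)"
    using dim_eq_card_independent[OF B(3)] dim_span[of B] by (simp add: sB)
  moreover have "card ?S = j" using inj by (simp add: card_image)
  ultimately have "card (B - ?S) = CARD('m) - j" using B(1) finB by (simp add: card_Diff_subset finite_subset)
  moreover have "card {a::'m. \<not> vidx a < j} = CARD('m) - j"
  proof -
    have "card {a::'m. vidx a < j} = j" using bij_betw_same_card[OF bij_vidx_less[OF j]] by simp
    moreover have "{a::'m. \<not> vidx a < j} = UNIV - {a. vidx a < j}" by auto
    ultimately show ?thesis by (simp add: card_Diff_subset)
  qed
  ultimately obtain h where h: "bij_betw h {a::'m. \<not> vidx a < j} (B - ?S)"
    using finite_same_card_bij[of "{a::'m. \<not> vidx a < j}" "B - ?S"] finB by auto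
  have "\<exists>i. \<not> vidx a < j \<longrightarrow> h a = axis i 1" for a
    using bij_betwE[OF h] B(2) by fastforce
  then obtain \<sigma> where \<sigma>: "\<And>a. \<not> vidx a < j \<Longrightarrow> h a = axis (\<sigma> a) 1" by metis
  have "B \<subseteq> rows (dmat j w \<sigma>)"
  proof
    fix x assume x: "x \<in> B"
    have rw: "row a (dmat j w \<sigma>) = dmat j w \<sigma> $ a" for a by (simp add: row_def)
    show "x \<in> rows (dmat j w \<sigma>)"
    proof (cases "x \<in> ?S")
      case True
      then obtain i where i: "i < j" "x = w i" by auto
      obtain a :: 'm where "vidx a = i" using vidx_surj[where 'm='m, of i] i(1) j by auto
      then have "row a (dmat j w \<sigma>) = x" unfolding rw using i by (simp add: dmat_def)
      then show ?thesis unfolding rows_def by blast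
    next
      case False
      then obtain a where "\<not> vidx a < j" "x = h a" using x bij_betw_imp_surj_on[OF h] by blast
      then have "row a (dmat j w \<sigma>) = x" unfolding rw using \<sigma> by (simp add: dmat_def)
      then show ?thesis unfolding rows_def by blast
    qed
  qed
  then have "span (rows (dmat j w \<sigma>)) = UNIV" using sB span_mono by blast
  then obtain A :: "real^'m^'m" where "A ** dmat j w \<sigma> = mat 1"
    using matrix_left_invertible_span_rows by blast
  then have "det A * det (dmat j w \<sigma>) = 1" by (metis det_I det_mul)
  then have "0 < \<bar>det (dmat j w \<sigma>)\<bar>" by auto
  then show ?thesis using det_le_wvol[of j w \<sigma>] by linarith
qed

text \<open>Minkowski's theorem for a lattice of rank \<open>j\<close>, reduced to full rank. The
  lattice is completed by \<open>s\<close> times coordinate vectors, chosen to maximise the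
  determinant, and the theorem yields a vector with tiny coordinates. Its component \<open>u\<close>
  in the given lattice is nonzero. The coordinates of \<open>u\<close> away from the completing
  directions are tiny at once; the others follow as in Cramer's rule, with the maximal determinant
  as denominator.\<close>

lemma wvol_lower_bound:
  fixes w :: "nat \<Rightarrow> real^'m::{finite,wellorder}"
  assumes j: "j \<le> CARD('m)" and inj: "inj_on w {..<j}" and ind: "independent (w ` {..<j})"
    and long: "\<And>c :: nat \<Rightarrow> real. (\<And>i. c i \<in> \<int>) \<Longrightarrow> \<exists>i<j. c i \<noteq> 0 \<Longrightarrow> 1 \<le> norm (\<Sum>i<j. c i *\<^sub>R w i)"
  shows "(1 / (2 * real CARD('m) ^ 2)) ^ CARD('m) \<le> wvol j w"
proof (rule ccontr)
  let ?m = "real CARD('m)"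
  \<comment> \<open>Chosen so that the final estimate \<open>?m ^ 2 * s\<close> for the norm of
    \<open>u\<close> equals 1/2.\<close>
  define s where "s = 1 / (2 * ?m ^ 2)"
  assume "\<not> ?thesis"
  then have small: "wvol j w < s ^ CARD('m)" by (simp add: s_def)
  have m1: "1 \<le> ?m" by (simp add: Suc_leI)
  then have "1 \<le> ?m ^ 2" by (rule one_le_power)
  then have "1 \<le> 2 * ?m ^ 2" by linarith
  then have s: "0 < s" "s \<le> 1"
    unfolding s_def by (auto simp only: zero_less_divide_1_iff divide_le_eq_1_pos)
  obtain \<sigma> where \<sigma>: "wvol j w = \<bar>det (dmat j w \<sigma>)\<bar>" by (rule wvol_attained)
  define N where "N = dmat j w \<sigma>"
  define d where "d = \<bar>det N\<bar>"
  have d: "d = wvol j w" "0 < d" using \<sigma> wvol_pos[OF j inj ind] by (simp_all add: d_def N_def)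
  have N1: "N $ a = w (vidx a)" if "vidx a < j" for a using that by (simp add: N_def dmat_def)
  have N2: "N $ a = axis (\<sigma> a) 1" if "\<not> vidx a < j" for a using that by (simp add: N_def dmat_def)
  have inj\<sigma>: "a = b" if "\<not> vidx a < j" "\<not> vidx b < j" "\<sigma> a = \<sigma> b" for a b
  proof (rule ccontr)
    assume "a \<noteq> b"
    then have "det N = 0" using that N2 by (intro det_two_equal_rows[of a b]) auto
    then show False using d(2) by (simp add: d_def)
  qed
  define e where "e a = (if vidx a < j then 1 else s)" for a :: 'm
  define M where "M = (\<chi> a. e a *s N $ a)"
  have detM: "det M = prod e UNIV * det N"
    unfolding M_def by (subst det_rows_mul) simp
  have e: "0 < e a" "e a \<le> 1" for a using s by (auto simp: e_def)
  have pe: "0 < prod e UNIV" "prod e UNIV \<le> 1" using less_imp_le[OF e(1)] e by (auto intro!: prod_pos prod_le_1)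
  have "\<bar>det M\<bar> = prod e UNIV * d" by (simp only: detM abs_mult abs_of_pos[OF pe(1)] d_def)
  then have "0 < \<bar>det M\<bar>" "\<bar>det M\<bar> \<le> d"
    using pe d(2) by (simp_all only: mult_pos_pos mult_left_le_one_le less_imp_le)
  then obtain b where b: "int_vec b" "b \<noteq> 0" "\<And>i. \<bar>(b v* M) $ i\<bar> < s"
    using minkowski_linear_forms[of M s] s small d by force
  define u where "u = (\<Sum>a\<in>{a. vidx a < j}. b $ a *\<^sub>R w (vidx a))"
  have bM: "(b v* M) $ i = u $ i + (\<Sum>a\<in>{a. \<not> vidx a < j}. b $ a * (s * axis (\<sigma> a) 1 $ i))" for i
  proof -
    have "(b v* M) $ i = (\<Sum>a\<in>UNIV. if vidx a < j then b $ a * w (vidx a) $ i else b $ a * (s * axis (\<sigma> a) 1 $ i))"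
      by (auto simp: vector_matrix_mult_def M_def e_def N1 N2 mult_ac intro!: sum.cong)
    also have "\<dots> = (\<Sum>a\<in>{a. vidx a < j}. b $ a * w (vidx a) $ i)
        + (\<Sum>a\<in>{a. \<not> vidx a < j}. b $ a * (s * axis (\<sigma> a) 1 $ i))"
      by (simp add: sum.If_cases Collect_neg_eq)
    finally show ?thesis by (simp add: u_def)
  qed
  have out: "\<bar>u $ i\<bar> < s" if "\<And>a. \<not> vidx a < j \<Longrightarrow> \<sigma> a \<noteq> i" for i
  proof -
    have "(\<Sum>a\<in>{a. \<not> vidx a < j}. b $ a * (s * axis (\<sigma> a) 1 $ i)) = 0"
      using that by (intro sum.neutral) (auto simp: axis_def)
    then show ?thesis using b(3)[of i] bM[of i] by simp
  qed
  \<comment> \<open>Otherwise only completing rows would contribute, and some coordinate would be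
    \<open>s\<close> times a nonzero integer, which is not below \<open>s\<close>.\<close>
  have "\<exists>a. vidx a < j \<and> b $ a \<noteq> 0"
  proof (rule ccontr)
    assume "\<not> ?thesis"
    then have z: "\<And>a. vidx a < j \<Longrightarrow> b $ a = 0" by blast
    obtain a0 where a0: "b $ a0 \<noteq> 0" using b(2) by (auto simp: vec_eq_iff)
    then have v0: "\<not> vidx a0 < j" using z by blast
    have "u = 0" unfolding u_def using z by (intro sum.neutral) auto
    moreover have "(\<Sum>a\<in>{a. \<not> vidx a < j}. b $ a * (s * axis (\<sigma> a) 1 $ \<sigma> a0))
      = (\<Sum>a\<in>{a. \<not> vidx a < j}. if a = a0 then b $ a0 * s else 0)"
      using inj\<sigma> v0 by (intro sum.cong) (auto simp: axis_def)
    moreover have "\<dots> = b $ a0 * s" using v0 by simp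
    ultimately have "\<bar>b $ a0 * s\<bar> < s" using b(3)[of "\<sigma> a0"] bM[of "\<sigma> a0"] by simp
    moreover have "1 \<le> \<bar>b $ a0\<bar>" using b(1) a0 by (simp add: int_vec_def Ints_nonzero_abs_ge1)
    ultimately show False using s by (simp add: abs_mult mult_less_cancel_right1)
  qed
  then obtain a1 where a1: "vidx a1 < j" "b $ a1 \<noteq> 0" by blast
  have "1 \<le> norm u"
  proof -
    define inv where "inv = the_inv_into {a::'m. vidx a < j} vidx"
    have "bij_betw inv {..<j} {a::'m. vidx a < j}"
      unfolding inv_def by (rule bij_betw_the_inv_into[OF bij_vidx_less[OF j]])
    have "inv (vidx a1) = a1"
      unfolding inv_def using a1(1) by (intro the_inv_into_f_f) (auto simp: inj_on_def)
    have "u = (\<Sum>i<j. b $ inv i *\<^sub>R w i)"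
    proof -
      have "(\<Sum>a\<in>{a::'m. vidx a < j}. b $ inv (vidx a) *\<^sub>R w (vidx a)) = (\<Sum>i<j. b $ inv i *\<^sub>R w i)"
        by (rule sum.reindex_bij_betw[OF bij_vidx_less[OF j]])
      moreover have "inv (vidx a) = a" if "vidx a < j" for a
        unfolding inv_def using that by (intro the_inv_into_f_f) (auto simp: inj_on_def)
      ultimately show ?thesis by (simp add: u_def)
    qed
    moreover have "1 \<le> norm (\<Sum>i<j. b $ inv i *\<^sub>R w i)"
    proof (rule long)
      show "\<exists>i<j. b $ inv i \<noteq> 0" using a1 \<open>inv (vidx a1) = a1\<close> by (intro exI[of _ "vidx a1"]) simp
      show "b $ inv i \<in> \<int>" for i using b(1) by (simp add: int_vec_def)
    qed
    ultimately show ?thesis by simp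
  qed
  have bound: "\<bar>u $ i\<bar> \<le> ?m * s" for i
  proof (cases "\<exists>a. \<not> vidx a < j \<and> \<sigma> a = i")
    case False
    then have "\<bar>u $ i\<bar> \<le> s" using out[of i] by force
    also have "1 * s \<le> ?m * s" using m1 s by (intro mult_right_mono) auto
    finally show ?thesis by simp
  next
    case True
    then obtain a0 where a0: "\<not> vidx a0 < j" "\<sigma> a0 = i" by blast
    define D where "D k = det (dmat j w (\<sigma>(a0 := k)))" for k
    have D: "det (\<chi> a. if a = a0 then axis k 1 else N $ a) = D k" for k
      unfolding N_def D_def using a0 by (subst dmat_update_row) auto
    \<comment> \<open>Since \<open>u\<close> is a combination of the first \<open>j\<close> rows,
      putting it into row \<open>a0\<close> gives determinant 0. Expanding this in the coordinates
      of \<open>u\<close> isolates \<open>u $ i\<close>, whose coefficient is the full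
      determinant.\<close>
    have "0 = det (\<chi> a. if a = a0 then (\<Sum>a\<in>{a. vidx a < j}. b $ a *s w (vidx a)) else N $ a)"
    proof -
      have "det (\<chi> a. if a = a0 then w (vidx a') else N $ a) = 0" if "vidx a' < j" for a' :: 'm
        using that a0 N1[OF that] by (intro det_two_equal_rows[of a0 a']) auto
      then show ?thesis by (simp add: det_row_expand)
    qed
    also have "(\<Sum>a\<in>{a. vidx a < j}. b $ a *s w (vidx a)) = (\<Sum>k\<in>UNIV. u $ k *s axis k 1)"
      unfolding axis_expansion[of u, symmetric] by (simp add: u_def scalar_mult_eq_scaleR)
    also have "det (\<chi> a. if a = a0 then (\<Sum>k\<in>UNIV. u $ k *s axis k 1) else N $ a) = (\<Sum>k\<in>UNIV. u $ k * D k)"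
      by (simp add: det_row_expand D)
    also have "\<dots> = u $ i * D i + (\<Sum>k\<in>UNIV - {i}. u $ k * D k)"
      by (rule sum.remove) auto
    finally have "\<bar>u $ i\<bar> * \<bar>D i\<bar> = \<bar>\<Sum>k\<in>UNIV - {i}. u $ k * D k\<bar>"
      by (simp add: abs_mult[symmetric] eq_neg_iff_add_eq_0[symmetric])
    also have "\<dots> \<le> (\<Sum>k\<in>UNIV - {i}. s * d)"
    proof (rule order_trans[OF sum_abs sum_mono])
      fix k assume k: "k \<in> UNIV - {i}"
      \<comment> \<open>If \<open>k\<close> is another completing direction, a row is repeated and
        the term vanishes; otherwise \<open>u $ k\<close> is below \<open>s\<close> and the minor is
        at most the maximal one.\<close>
      show "\<bar>u $ k * D k\<bar> \<le> s * d"
      proof (cases "\<exists>a. \<not> vidx a < j \<and> \<sigma> a = k")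
        case True
        then obtain a' where a': "\<not> vidx a' < j" "\<sigma> a' = k" by blast
        have "a' \<noteq> a0" using a' a0 k by auto
        then have "D k = 0" unfolding D_def using a' a0
          by (intro det_two_equal_rows[of a0 a']) (auto simp: dmat_def)
        then show ?thesis using s d by simp
      next
        case False
        then have "\<bar>u $ k\<bar> \<le> s" using out[of k] by force
        moreover have "\<bar>D k\<bar> \<le> d" unfolding D_def d(1) by (rule det_le_wvol)
        ultimately show ?thesis unfolding abs_mult using s by (intro mult_mono) auto
      qed
    qed
    also have "\<dots> \<le> ?m * (s * d)"
      using s d by (simp add: card_Diff_subset)
    also have "D i = det N" using a0(2) by (auto simp: D_def N_def)
    finally have "\<bar>u $ i\<bar> * d \<le> (?m * s) * d" by (simp add: d_def mult_ac)
    then show ?thesis using d(2) by simp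
  qed
  have "norm u \<le> (\<Sum>i\<in>UNIV. \<bar>u $ i\<bar>)" by (rule norm_le_l1_cart)
  also have "\<dots> \<le> (\<Sum>i\<in>(UNIV::'m set). ?m * s)" by (intro sum_mono bound)
  also have "\<dots> = ?m ^ 2 * s" by (simp add: power2_eq_square)
  also have "\<dots> = 1 / 2" using m1 by (simp add: s_def)
  finally show False using \<open>1 \<le> norm u\<close> by simp
qed

section \<open>Rational subspaces\<close>

text \<open>The index type of the vectors \<open>(p, q)\<close>: one index for \<open>p\<close> and one for each component of \<open>q\<close>. It is
  well ordered because the library's formula for the volume of a linear image asks for that.\<close>

typedef ('n::finite) coord = "{..CARD('n)}" morphisms coord_nat nat_coord
  by auto

lemma UNIV_coord: "(UNIV :: 'n::finite coord set) = nat_coord ` {..CARD('n)}"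
  using type_definition.Abs_image[OF type_definition_coord] by auto

instance coord :: (finite) finite
  by standard (simp add: UNIV_coord)

instantiation coord :: (finite) linorder
begin

definition less_eq_coord :: "'a coord \<Rightarrow> 'a coord \<Rightarrow> bool" where
  "less_eq_coord x y \<longleftrightarrow> coord_nat x \<le> coord_nat y"

definition less_coord :: "'a coord \<Rightarrow> 'a coord \<Rightarrow> bool" where
  "less_coord x y \<longleftrightarrow> coord_nat x < coord_nat y"

instance
  by standard (auto simp: less_eq_coord_def less_coord_def coord_nat_inject)

end

instance coord :: (finite) wellorder
proof
  fix P :: "'a coord \<Rightarrow> bool" and a
  assume step: "\<And>x. (\<And>y. y < x \<Longrightarrow> P y) \<Longrightarrow> P x"
  show "P a"
    by (induction a rule: measure_induct_rule[of coord_nat]) (auto intro: step simp: less_coord_def)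
qed

definition c0 :: "'n::finite coord" where "c0 = nat_coord 0"

definition cpos :: "'n::finite \<Rightarrow> 'n coord" where "cpos j = nat_coord (Suc (vidx j))"

lemma coord_nat_cpos: "coord_nat (cpos j) = Suc (vidx j)"
  using vidx_less[of j] by (simp add: cpos_def nat_coord_inverse)

lemma coord_nat_c0: "coord_nat c0 = 0"
  by (simp add: c0_def nat_coord_inverse)

lemma cpos_neq_c0 [simp]: "cpos j \<noteq> c0" "c0 \<noteq> cpos j"
  using coord_nat_cpos[of j] coord_nat_c0 by (metis nat.simps(3))+

lemma inj_cpos: "inj cpos"
  by (rule injI) (metis Suc_inject coord_nat_cpos vidx_eq_iff)

lemma coord_cases: "i = c0 \<or> (\<exists>j. i = cpos (j::'n::finite))"
proof (cases "coord_nat i")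
  case 0
  then show ?thesis by (metis coord_nat_c0 coord_nat_inject)
next
  case (Suc k)
  have "coord_nat i \<in> {..CARD('n)}" by (rule coord_nat)
  then obtain j :: 'n where "vidx j = k" using Suc vidx_surj[where 'm='n, of k] by auto
  then have "i = cpos j" using Suc by (metis coord_nat_cpos coord_nat_inject)
  then show ?thesis by blast
qed

section \<open>The linear map attached to a point\<close>

definition qpart :: "real^'n::finite coord \<Rightarrow> real^'n" where
  "qpart z = (\<chi> j. z $ cpos j)"

definition form_map :: "real \<Rightarrow> real \<Rightarrow> real^'n::finite \<Rightarrow> real^'n coord \<Rightarrow> real^'n coord" where
  "form_map A B y z = (\<chi> i. if i = c0 then A * (z $ c0 + y \<bullet> qpart z) else B * z $ i)"

lemma qpart_add: "qpart (x + z) = qpart x + qpart z"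
  by (simp add: qpart_def vec_eq_iff)

lemma qpart_scaleR: "qpart (r *\<^sub>R x) = r *\<^sub>R qpart x"
  by (simp add: qpart_def vec_eq_iff)

lemma linear_form_map: "linear (form_map A B (y :: real^'n::finite))"
  by (rule linearI)
    (simp_all add: form_map_def vec_eq_iff qpart_add qpart_scaleR inner_add_right algebra_simps)

lemma norm_form_map_ge1: "\<bar>A * (z $ c0 + y \<bullet> qpart z)\<bar> \<le> norm (form_map A B y z)"
  using component_le_norm_cart[of "form_map A B y z" c0] by (simp add: form_map_def)

lemma norm_form_map_ge2: "\<bar>B\<bar> * norm (qpart z) \<le> norm (form_map A B y z)"
proof -
  have "(norm (B *\<^sub>R qpart z))\<^sup>2 = (\<Sum>j\<in>UNIV. (form_map A B y z $ cpos j)\<^sup>2)"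
    by (simp add: norm_vec_def L2_set_def sum_nonneg form_map_def qpart_def)
  also have "\<dots> = (\<Sum>i\<in>range cpos. (form_map A B y z $ i)\<^sup>2)"
    using sum.reindex[OF inj_cpos, of "\<lambda>i. (form_map A B y z $ i)\<^sup>2"] by (simp add: o_def)
  also have "\<dots> \<le> (\<Sum>i\<in>UNIV. (form_map A B y z $ i)\<^sup>2)" by (intro sum_mono2) auto
  also have "\<dots> = (norm (form_map A B y z))\<^sup>2" by (simp add: norm_vec_def L2_set_def sum_nonneg)
  finally have "norm (B *\<^sub>R qpart z) \<le> norm (form_map A B y z)"
    by (rule power2_le_imp_le) simp
  then show ?thesis by simp
qed

lemma norm_form_map_le:
  "norm (form_map A B y z) \<le> \<bar>A * (z $ c0 + y \<bullet> qpart z)\<bar> + \<bar>B\<bar> * (real CARD('n) * norm (qpart (z :: real^'n::finite coord)))"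
proof -
  have "norm (form_map A B y z) \<le> (\<Sum>i\<in>UNIV. \<bar>form_map A B y z $ i\<bar>)" by (rule norm_le_l1_cart)
  also have "(UNIV :: 'n coord set) = insert c0 (range cpos)" using coord_cases by blast
  also have "(\<Sum>i\<in>insert c0 (range cpos). \<bar>form_map A B y z $ i\<bar>)
      = \<bar>A * (z $ c0 + y \<bullet> qpart z)\<bar> + (\<Sum>i\<in>range cpos. \<bar>form_map A B y z $ i\<bar>)"
    by (subst sum.insert) (auto simp: form_map_def)
  also have "(\<Sum>i\<in>range cpos. \<bar>form_map A B y z $ i\<bar>) = (\<Sum>j\<in>UNIV. \<bar>B\<bar> * \<bar>qpart z $ j\<bar>)"
    using sum.reindex[OF inj_cpos, of "\<lambda>i. \<bar>form_map A B y z $ i\<bar>"]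
    by (simp add: o_def form_map_def qpart_def abs_mult)
  also have "\<dots> \<le> (\<Sum>j\<in>(UNIV::'n set). \<bar>B\<bar> * norm (qpart z))"
    by (intro sum_mono mult_left_mono component_le_norm_cart) auto
  finally show ?thesis by (simp add: mult_ac)
qed

text \<open>The point \<open>y\<close> enters a single column, the one of \<open>c0\<close>, and
  does so affinely; the determinant is linear in that column, which the transpose turns into a
  row.\<close>

lemma det_form_map_affine:
  fixes z :: "nat \<Rightarrow> real^'n::finite coord"
  shows "\<exists>\<alpha> \<beta>. \<forall>y. det (dmat j (\<lambda>i. form_map A B y (z i)) \<sigma>) = \<alpha> + y \<bullet> \<beta>"
proof -
  define N where "N y = dmat j (\<lambda>i. form_map A B y (z i)) \<sigma>" for y
  define R where "R i = (\<chi> a. N 0 $ a $ i)" for i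
  define u0 where "u0 = (\<chi> a. if vidx a < j then A * z (vidx a) $ c0 else axis (\<sigma> a) 1 $ c0)"
  define u :: "'n \<Rightarrow> real^'n coord" where "u k = (\<chi> a. if vidx a < j then A * z (vidx a) $ cpos k else 0)" for k
  have "transpose (N y) = (\<chi> i. if i = c0 then u0 + (\<Sum>k\<in>UNIV. y $ k *s u k) else R i)" for y
  proof -
    have "N y $ a $ i = (if i = c0 then u0 + (\<Sum>k\<in>UNIV. y $ k *s u k) else R i) $ a" for a i
      by (simp add: N_def dmat_def form_map_def R_def u0_def u_def inner_vec_def qpart_def
          distrib_left sum_distrib_left mult_ac)
    then show ?thesis by (simp add: transpose_def vec_eq_iff)
  qed
  then have "det (N y) = det (\<chi> i. if i = c0 then u0 else R i)
      + (\<Sum>k\<in>UNIV. y $ k * det (\<chi> i. if i = c0 then u k else R i))" for y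
    by (simp add: det_transpose[of "N y", symmetric] det_row_add det_row_expand)
  then have "det (N y) = det (\<chi> i. if i = c0 then u0 else R i)
      + y \<bullet> (\<chi> k. det (\<chi> i. if i = c0 then u k else R i))" for y
    by (simp add: inner_vec_def)
  then show ?thesis unfolding N_def by blast
qed

section \<open>Rational subspaces and integer tuples of minimal covolume\<close>

definition int_vecs_in :: "(real^'m) set \<Rightarrow> (real^'m) set" where
  "int_vecs_in V = {z \<in> V. int_vec z}"

definition rational_subspace :: "(real^'m) set \<Rightarrow> bool" where
  "rational_subspace V \<longleftrightarrow> subspace V \<and> V = span (int_vecs_in V)"

text \<open>The vectors span \<open>V\<close> but may generate only a sublattice of its integer
  points. Minimising the covolume later stands in for the choice of a lattice basis.\<close>

definition lattice_tuple :: "(real^'m) set \<Rightarrow> (nat \<Rightarrow> real^'m) \<Rightarrow> bool" where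
  "lattice_tuple V z \<longleftrightarrow> (\<forall>i<dim V. z i \<in> V \<and> int_vec (z i)) \<and>
     inj_on z {..<dim V} \<and> independent (z ` {..<dim V})"

lemma lattice_tuple_span:
  assumes "subspace V" "lattice_tuple V z"
  shows "span (z ` {..<dim V}) = V"
proof
  show "span (z ` {..<dim V}) \<subseteq> V"
    using assms by (intro span_minimal) (auto simp: lattice_tuple_def)
  show "V \<subseteq> span (z ` {..<dim V})"
    using assms by (intro card_ge_dim_independent) (auto simp: lattice_tuple_def card_image)
qed

lemma lattice_tuple_exists:
  assumes "rational_subspace V"
  shows "\<exists>z. lattice_tuple V z"
proof -
  obtain B where B: "B \<subseteq> int_vecs_in V" "independent B" "int_vecs_in V \<subseteq> span B" "card B = dim (int_vecs_in V)"
    using basis_exists by blast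
  have "dim (int_vecs_in V) = dim V" using assms dim_span unfolding rational_subspace_def by metis
  then have "card B = dim V" using B(4) by simp
  then obtain z where "bij_betw z {..<dim V} B"
    using finite_same_card_bij[of "{..<dim V}" B] independent_imp_finite[OF B(2)] by auto
  then have "lattice_tuple V z"
    using B(1,2) unfolding lattice_tuple_def bij_betw_def int_vecs_in_def by auto
  then show ?thesis by blast
qed

lemma det_int: "(\<And>i j. A $ i $ j \<in> \<int>) \<Longrightarrow> det (A :: real^'m^'m) \<in> \<int>"
  unfolding det_def by (intro Ints_sum Ints_mult Ints_prod) auto

lemma wvol_int:
  assumes "\<And>i. i < j \<Longrightarrow> int_vec (z i)"
  shows "wvol j z \<in> \<int>"
proof -
  obtain \<sigma> where "wvol j z = \<bar>det (dmat j z \<sigma>)\<bar>" by (rule wvol_attained)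
  moreover have "det (dmat j z \<sigma>) \<in> \<int>"
    using assms by (intro det_int) (auto simp: dmat_def int_vec_def axis_def)
  ultimately show ?thesis by simp
qed

text \<open>Covolumes of integer tuples are nonnegative integers, so the least one is
  attained.\<close>

lemma minimal_lattice_tuple_exists:
  assumes "rational_subspace V"
  shows "\<exists>z. lattice_tuple V z \<and> (\<forall>z'. lattice_tuple V z' \<longrightarrow> wvol (dim V) z \<le> wvol (dim V) z')"
proof -
  obtain z0 where "lattice_tuple V z0" using lattice_tuple_exists[OF assms] by blast
  then obtain z where z: "lattice_tuple V z"
    "\<And>z'. lattice_tuple V z' \<Longrightarrow> nat \<lfloor>wvol (dim V) z\<rfloor> \<le> nat \<lfloor>wvol (dim V) z'\<rfloor>"
    using ex_has_least_nat[of "lattice_tuple V" z0 "\<lambda>z. nat \<lfloor>wvol (dim V) z\<rfloor>"] by blast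
  have i: "wvol (dim V) x = real (nat \<lfloor>wvol (dim V) x\<rfloor>)" if "lattice_tuple V x" for x
  proof -
    have "wvol (dim V) x \<in> \<int>" using that by (intro wvol_int) (simp add: lattice_tuple_def)
    then show ?thesis using wvol_nonneg[of "dim V" x] by (auto elim!: Ints_cases)
  qed
  have "wvol (dim V) z \<le> wvol (dim V) z'" if "lattice_tuple V z'" for z'
    using i[OF z(1)] i[OF that] z(2)[OF that] by linarith
  then show ?thesis using z(1) by blast
qed

text \<open>Replacing a lattice tuple by another one of the same subspace multiplies \<open>wvol\<close> by a factor that does not
  depend on the linear map applied to it, so one tuple is minimal for all maps simultaneously.\<close>

definition min_tuple :: "(real^'m) set \<Rightarrow> nat \<Rightarrow> real^'m" where
  "min_tuple V = (SOME z. lattice_tuple V z \<and> (\<forall>z'. lattice_tuple V z' \<longrightarrow> wvol (dim V) z \<le> wvol (dim V) z'))"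

lemma min_tuple:
  assumes "rational_subspace V"
  shows "lattice_tuple V (min_tuple V)"
    and "lattice_tuple V z \<Longrightarrow> wvol (dim V) (min_tuple V) \<le> wvol (dim V) z"
  using someI_ex[OF minimal_lattice_tuple_exists[OF assms]] unfolding min_tuple_def by blast+

lemma dim_le_CARD: "dim (V :: (real^'m) set) \<le> CARD('m)"
  using dim_subset_UNIV[of V] by simp

lemma wvol_min_tuple_le:
  fixes V :: "(real^'m) set"
  assumes V: "rational_subspace V" and z: "lattice_tuple V z" and T: "linear (T :: real^'m \<Rightarrow> real^'m)"
  shows "wvol (dim V) (\<lambda>i. T (min_tuple V i)) \<le> wvol (dim V) (\<lambda>i. T (z i))"
proof -
  let ?d = "dim V" and ?b = "min_tuple V"
  note b = min_tuple(1)[OF V]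
  have sV: "subspace V" using V by (simp add: rational_subspace_def)
  have "\<exists>c. z a = (\<Sum>i<?d. c i *\<^sub>R ?b i)" if "a < ?d" for a
  proof -
    have "z a \<in> span (?b ` {..<?d})" using z that lattice_tuple_span[OF sV b] by (simp add: lattice_tuple_def)
    then obtain u where "z a = (\<Sum>v\<in>?b ` {..<?d}. u v *\<^sub>R v)" by (auto simp: span_finite)
    also have "\<dots> = (\<Sum>i<?d. u (?b i) *\<^sub>R ?b i)"
      using b by (subst sum.reindex) (auto simp: lattice_tuple_def)
    finally show ?thesis by (rule exI[of _ "\<lambda>i. u (?b i)"])
  qed
  then obtain A where A: "\<And>a. a < ?d \<Longrightarrow> z a = (\<Sum>i<?d. A a i *\<^sub>R ?b i)" by metis
  obtain l where l: "\<And>(w :: nat \<Rightarrow> real^'m) w' \<sigma>. \<forall>a<?d. w' a = (\<Sum>i<?d. A a i *\<^sub>R w i) \<Longrightarrow>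
           det (dmat ?d w' \<sigma>) = l * det (dmat ?d w \<sigma>)"
    using det_dmat_change_basis[OF dim_le_CARD[of V], of A] by blast
  have scale: "wvol ?d w' = \<bar>l\<bar> * wvol ?d w" if w: "\<forall>a<?d. w' a = (\<Sum>i<?d. A a i *\<^sub>R w i)" for w w' :: "nat \<Rightarrow> real^'m"
  proof (rule antisym)
    show "wvol ?d w' \<le> \<bar>l\<bar> * wvol ?d w"
      by (rule wvol_leI) (simp add: l[OF w] abs_mult mult_left_mono det_le_wvol)
    obtain \<sigma> where "wvol ?d w = \<bar>det (dmat ?d w \<sigma>)\<bar>" by (rule wvol_attained)
    then show "\<bar>l\<bar> * wvol ?d w \<le> wvol ?d w'"
      using det_le_wvol[of ?d w' \<sigma>] by (simp add: l[OF w] abs_mult)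
  qed
  \<comment> \<open>Minimality concerns the tuples before \<open>T\<close> is applied and says just
    \<open>1 \<le> \<bar>l\<bar>\<close>; the same \<open>l\<close> then governs the tuples after
    \<open>T\<close>.\<close>
  have "wvol ?d z = \<bar>l\<bar> * wvol ?d ?b" using A by (intro scale) blast
  moreover have "wvol ?d ?b \<le> wvol ?d z" by (rule min_tuple(2)[OF V z])
  moreover have "0 < wvol ?d ?b" using b by (intro wvol_pos dim_le_CARD) (auto simp: lattice_tuple_def)
  ultimately have "1 \<le> \<bar>l\<bar>" by simp
  moreover have "wvol ?d (\<lambda>i. T (z i)) = \<bar>l\<bar> * wvol ?d (\<lambda>i. T (?b i))"
    by (rule scale) (simp add: A linear_sum[OF T] linear_scale[OF T])
  ultimately show ?thesis using wvol_nonneg[of ?d "\<lambda>i. T (?b i)"] mult_right_mono[of 1 "\<bar>l\<bar>"] by fastforce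
qed

text \<open>Appending \<open>u\<close> to the minimal tuple of \<open>V\<close> gives a competitor
  for the minimal tuple of \<open>V'\<close>, and the row expansion compares its covolume with that
  of \<open>V\<close>.\<close>

lemma rational_extension:
  fixes V :: "(real^'m) set"
  assumes V: "rational_subspace V" and u: "int_vec u" "u \<notin> V" and T: "linear (T :: real^'m \<Rightarrow> real^'m)"
  defines "V' \<equiv> span (insert u V)"
  shows "rational_subspace V'" "dim V' = Suc (dim V)"
    "wvol (dim V') (\<lambda>i. T (min_tuple V' i)) \<le> real CARD('m) * norm (T u) * wvol (dim V) (\<lambda>i. T (min_tuple V i))"
proof -
  let ?d = "dim V"
  have sV: "subspace V" and eV: "V = span (int_vecs_in V)" using V by (auto simp: rational_subspace_def)
  have "V' \<subseteq> span (int_vecs_in V')"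
  proof -
    have "insert u (int_vecs_in V) \<subseteq> int_vecs_in V'"
      using u by (auto simp: V'_def int_vecs_in_def intro: span_base)
    then have "span (insert u (int_vecs_in V)) \<subseteq> span (int_vecs_in V')" by (rule span_mono)
    moreover have "insert u V \<subseteq> span (insert u (int_vecs_in V))"
      using eV span_mono[of "int_vecs_in V" "insert u (int_vecs_in V)"] by (auto intro: span_base)
    ultimately show ?thesis unfolding V'_def by (meson span_minimal subspace_span order_trans)
  qed
  moreover have "span (int_vecs_in V') \<subseteq> V'"
    by (rule span_minimal) (auto simp: int_vecs_in_def V'_def)
  ultimately show rV: "rational_subspace V'" by (auto simp: rational_subspace_def V'_def)
  have uV: "u \<notin> span V" using u(2) sV by (simp add: span_eq_iff[THEN iffD2])
  then show dV: "dim V' = Suc (dim V)" by (simp add: V'_def dim_insert)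
  define z where "z = (min_tuple V)(?d := u)"
  note b = min_tuple(1)[OF V, unfolded lattice_tuple_def]
  have sb: "span (min_tuple V ` {..<?d}) = V" by (rule lattice_tuple_span[OF sV min_tuple(1)[OF V]])
  have im: "z ` {..<Suc ?d} = insert u (min_tuple V ` {..<?d})"
    by (auto simp: z_def lessThan_Suc)
  have "lattice_tuple V' z"
    unfolding lattice_tuple_def dV
  proof (intro conjI allI impI)
    show "independent (z ` {..<Suc ?d})"
      unfolding im using b u(2) sb by (subst independent_insert) auto
    have "u \<notin> min_tuple V ` {..<?d}" using u(2) b by auto
    then show "inj_on z {..<Suc ?d}"
      using b by (auto simp: z_def inj_on_def less_Suc_eq image_iff)
    fix i assume "i < Suc ?d"
    then show "z i \<in> V'" "int_vec (z i)"
      using b u(1) by (auto simp: z_def V'_def less_Suc_eq intro: span_base)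
  qed
  from wvol_min_tuple_le[OF rV this T]
  have "wvol (dim V') (\<lambda>i. T (min_tuple V' i)) \<le> wvol (Suc ?d) (\<lambda>i. T (z i))" by (simp add: dV)
  also have "(\<lambda>i. T (z i)) = (\<lambda>i. T (min_tuple V i))(?d := T u)" by (auto simp: z_def)
  also have "wvol (Suc ?d) \<dots> \<le> real CARD('m) * norm (T u) * wvol ?d (\<lambda>i. T (min_tuple V i))"
    using dV dim_le_CARD[of V'] by (intro wvol_Suc_le) simp
  finally show "wvol (dim V') (\<lambda>i. T (min_tuple V' i)) \<le> real CARD('m) * norm (T u) * wvol (dim V) (\<lambda>i. T (min_tuple V i))" .
qed

lemma wvol_rational_lower_bound:
  fixes V :: "(real^'m::{finite,wellorder}) set"
  assumes V: "rational_subspace V" and T: "linear (T :: real^'m::_ \<Rightarrow> real^'m::_)"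
    and long: "\<And>z. int_vec z \<Longrightarrow> z \<noteq> 0 \<Longrightarrow> 1 \<le> norm (T z)"
    and inj: "inj T"
  shows "(1 / (2 * real CARD('m) ^ 2)) ^ CARD('m) \<le> wvol (dim V) (\<lambda>i. T (min_tuple V i))"
proof (rule wvol_lower_bound[OF dim_le_CARD])
  let ?d = "dim V" and ?b = "min_tuple V"
  note b = min_tuple(1)[OF V, unfolded lattice_tuple_def]
  show "inj_on (\<lambda>i. T (?b i)) {..<?d}" using b inj by (auto simp: inj_on_def dest: injD)
  have "(\<lambda>i. T (?b i)) ` {..<?d} = T ` ?b ` {..<?d}" by auto
  then show "independent ((\<lambda>i. T (?b i)) ` {..<?d})"
    using linear_independent_injective_image[OF T] b inj by (auto simp: inj_on_def dest: injD)
  fix c :: "nat \<Rightarrow> real"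
  assume c: "\<And>i. c i \<in> \<int>" "\<exists>i<?d. c i \<noteq> 0"
  let ?z = "\<Sum>i<?d. c i *\<^sub>R ?b i"
  have "?z \<noteq> 0"
  proof
    assume z0: "?z = 0"
    have "?z = (\<Sum>v\<in>?b ` {..<?d}. c (the_inv_into {..<?d} ?b v) *\<^sub>R v)"
      using b by (subst sum.reindex) (auto simp: the_inv_into_f_f intro!: sum.cong)
    with z0 have "(\<Sum>v\<in>?b ` {..<?d}. c (the_inv_into {..<?d} ?b v) *\<^sub>R v) = 0" by simp
    moreover obtain i where i: "i < ?d" "c i \<noteq> 0" using c(2) by blast
    ultimately have "c (the_inv_into {..<?d} ?b (?b i)) = 0"
      using b independentD[of "?b ` {..<?d}" "?b ` {..<?d}" "\<lambda>v. c (the_inv_into {..<?d} ?b v)" "?b i"] by auto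
    then show False using i b by (simp add: the_inv_into_f_f)
  qed
  moreover have "int_vec ?z"
    using b c(1) by (auto simp: int_vec_def intro!: Ints_sum Ints_mult)
  ultimately have "1 \<le> norm (T ?z)" by (intro long)
  then show "1 \<le> norm (\<Sum>i<?d. c i *\<^sub>R T (?b i))" by (simp add: linear_sum[OF T] linear_scale[OF T])
qed

lemma chain_finite_maximal:
  assumes "finite F" "\<forall>V\<in>F. \<forall>V'\<in>F. V \<subseteq> V' \<or> V' \<subseteq> V" "F \<noteq> {}"
  shows "\<exists>M\<in>F. \<forall>V\<in>F. V \<subseteq> M"
  using assms(1,3,2)
proof (induction F rule: finite_ne_induct)
  case (insert x F)
  then obtain M where "M \<in> F" "\<forall>V\<in>F. V \<subseteq> M" by auto
  then show ?case using insert.prems by (metis insert_iff order_refl order_trans)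
qed auto

lemma rational_zero: "rational_subspace {0 :: real^'m}"
proof -
  have "int_vecs_in {0 :: real^'m} = {0}" by (auto simp: int_vecs_in_def int_vec_def)
  then show ?thesis by (simp add: rational_subspace_def subspace_0)
qed

text \<open>With no vectors given, the matrix is a permutation matrix or has a repeated row. This
  bounds the covolume of the zero subspace, where a flag may have to start.\<close>

lemma wvol_0: "wvol 0 w \<le> 1"
proof (rule wvol_leI)
  fix \<sigma> :: "'a \<Rightarrow> 'a"
  show "\<bar>det (dmat 0 w \<sigma>)\<bar> \<le> 1"
  proof (cases "inj \<sigma>")
    case True
    then have "bij \<sigma>" using finite_UNIV_inj_surj[OF finite_class.finite_UNIV True] by (simp add: bij_def)
    then have "\<sigma> permutes UNIV" by (rule bij_imp_permutes) simp
    then have "det (\<chi> i. (mat 1 :: real^'a^'a) $ \<sigma> i) = of_int (sign \<sigma>) * det (mat 1 :: real^'a^'a)"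
      by (rule det_permute_rows)
    moreover have "dmat 0 w \<sigma> = (\<chi> i. (mat 1 :: real^'a^'a) $ \<sigma> i)"
      by (auto simp: dmat_def mat_def axis_def vec_eq_iff)
    ultimately show ?thesis by (simp add: sign_def)
  next
    case False
    then obtain a b where "a \<noteq> b" "\<sigma> a = \<sigma> b" by (auto simp: inj_def)
    then have "det (dmat 0 w \<sigma>) = 0" by (intro det_two_equal_rows[of a b]) (auto simp: dmat_def)
    then show ?thesis by simp
  qed
qed

definition comparable :: "'a set \<Rightarrow> 'a set \<Rightarrow> bool" where
  "comparable V V' \<longleftrightarrow> V \<subseteq> V' \<or> V' \<subseteq> V"

text \<open>The integer vector \<open>u\<close> enlarges the largest member of the flag avoiding it to a subspace that is
  comparable with the whole flag, whose covolume is therefore not small.\<close>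

lemma flag_marked_imp_long:
  fixes T :: "real \<Rightarrow> real^'m \<Rightarrow> real^'m"
  assumes marked: "flag_marked comparable dim {V. rational_subspace V}
      (\<lambda>V x. wvol (dim V) (\<lambda>i. T x (min_tuple V i)) / \<kappa>) \<epsilon> D x"
    and T: "linear (T x)" and \<kappa>: "0 < \<kappa>" and \<epsilon>: "\<epsilon> \<le> 1" and u: "int_vec u" "u \<noteq> 0"
  shows "\<epsilon> \<le> real CARD('m) * norm (T x u) * max D (1 / \<kappa>)"
proof -
  define \<psi> where "\<psi> V = wvol (dim V) (\<lambda>i. T x (min_tuple V i)) / \<kappa>" for V
  have "\<exists>F\<subseteq>{V. rational_subspace V}. finite F \<and> (\<forall>f\<in>F. \<forall>g\<in>F. f \<noteq> g \<longrightarrow> comparable f g) \<and>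
        (\<forall>f\<in>F. \<epsilon> \<le> \<psi> f \<and> \<psi> f \<le> D) \<and>
        (\<forall>s\<in>{V. rational_subspace V}. (\<forall>f\<in>F. comparable s f \<and> dim s \<noteq> dim f) \<longrightarrow> 1 \<le> \<psi> s)"
    using marked unfolding flag_marked_def \<psi>_def .
  then obtain F where F': "F \<subseteq> {V. rational_subspace V}" "finite F"
    "\<forall>f\<in>F. \<forall>g\<in>F. f \<noteq> g \<longrightarrow> comparable f g" "\<forall>f\<in>F. \<epsilon> \<le> \<psi> f \<and> \<psi> f \<le> D"
    "\<forall>s\<in>{V. rational_subspace V}. (\<forall>f\<in>F. comparable s f \<and> dim s \<noteq> dim f) \<longrightarrow> 1 \<le> \<psi> s"
    by (elim exE conjE) (rule that)
  have F1: "rational_subspace V" if "V \<in> F" for V using F'(1) that by blast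
  have F3: "comparable V V'" if "V \<in> F" "V' \<in> F" "V \<noteq> V'" for V V' using F'(3) that by blast
  have F4: "\<epsilon> \<le> \<psi> V" "\<psi> V \<le> D" if "V \<in> F" for V using F'(4) that by simp_all
  have F5: "1 \<le> \<psi> V" if "rational_subspace V" "\<forall>f\<in>F. comparable V f \<and> dim V \<noteq> dim f" for V
    using F'(5) that by (simp only: mem_Collect_eq)
  have chain: "V \<subseteq> V' \<or> V' \<subseteq> V" if "V \<in> F" "V' \<in> F" for V V'
    using F3[OF that] by (cases "V = V'") (auto simp: comparable_def)
  let ?F = "{V \<in> F. u \<notin> V}"
  have "\<exists>V. rational_subspace V \<and> u \<notin> V \<and> \<psi> V \<le> max D (1 / \<kappa>) \<and> (\<forall>V'\<in>?F. V' \<subseteq> V) \<and> (\<forall>V'\<in>F. u \<in> V' \<longrightarrow> V \<subseteq> V')"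
  \<comment> \<open>If every member of the flag contains \<open>u\<close>, the zero subspace is the
    one to be enlarged; its covolume is at most 1, which accounts for \<open>1 / \<kappa>\<close> in
    the maximum.\<close>
  proof (cases "?F = {}")
    case True
    have sub: "{0} \<subseteq> V" if "V \<in> F" for V
      using F1[OF that] by (auto simp: rational_subspace_def subspace_0)
    have "\<psi> {0} \<le> 1 / \<kappa>" using wvol_0[of "\<lambda>i. T x (min_tuple {0} i)"] \<kappa> by (simp add: \<psi>_def divide_right_mono)
    then have le: "\<psi> {0} \<le> max D (1 / \<kappa>)" by linarith
    show ?thesis
      by (rule exI[of _ "{0}"], intro conjI) (use le sub u True rational_zero in auto)
  next
    case False
    then obtain V where V: "V \<in> ?F" "\<forall>V'\<in>?F. V' \<subseteq> V"
      using chain_finite_maximal[of ?F] F'(2) chain by auto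
    moreover have "V \<subseteq> V'" if "V' \<in> F" "u \<in> V'" for V' using chain[of V V'] V(1) that by auto
    moreover have "\<psi> V \<le> max D (1 / \<kappa>)" using F4(2)[of V] V(1) by auto
    ultimately show ?thesis using F1[of V] V by (intro exI[of _ V]) auto
  qed
  then obtain V where V: "rational_subspace V" "u \<notin> V" "\<psi> V \<le> max D (1 / \<kappa>)"
    "\<And>V'. V' \<in> F \<Longrightarrow> u \<notin> V' \<Longrightarrow> V' \<subseteq> V" "\<And>V'. V' \<in> F \<Longrightarrow> u \<in> V' \<Longrightarrow> V \<subseteq> V'" by auto
  define V' where "V' = span (insert u V)"
  note ext = rational_extension[OF V(1) u(1) V(2) T, folded V'_def]
  have "V \<subseteq> V'" by (auto simp: V'_def intro: span_base)
  have up: "V' \<subseteq> G" if "G \<in> F" "u \<in> G" for G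
    unfolding V'_def using V(5)[OF that] F1[OF that(1)] that(2)
    by (intro span_minimal) (auto simp: rational_subspace_def)
  have cmp: "comparable V' G" if "G \<in> F" for G
    using up[OF that] V(4)[OF that] \<open>V \<subseteq> V'\<close> by (cases "u \<in> G") (auto simp: comparable_def)
  have "\<epsilon> \<le> \<psi> V'"
  \<comment> \<open>Either the dimension of \<open>V'\<close> is new to the flag and marking gives
    at least 1, or \<open>V'\<close> is comparable with a member of equal dimension and so equal to
    it.\<close>
  proof (cases "\<forall>G\<in>F. dim V' \<noteq> dim G")
    case True
    then have "1 \<le> \<psi> V'" using cmp ext(1) by (intro F5) auto
    then show ?thesis using \<epsilon> by linarith
  next
    case False
    then obtain G where G: "G \<in> F" "dim V' = dim G" by blast
    have sub: "subspace G" "subspace V'" using F1[OF G(1)] ext(1) by (auto simp: rational_subspace_def)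
    have "V' = G"
      using cmp[OF G(1)] subspace_dim_equal[OF sub(1,2)] subspace_dim_equal[OF sub(2,1)] G(2)
      unfolding comparable_def by auto
    then show ?thesis using F4[OF G(1)] by simp
  qed
  also have "\<psi> V' \<le> real CARD('m) * norm (T x u) * \<psi> V"
    using ext(3) \<kappa> by (simp add: \<psi>_def divide_right_mono)
  also have "\<dots> \<le> real CARD('m) * norm (T x u) * max D (1 / \<kappa>)"
    using V(3) by (intro mult_left_mono) auto
  finally show ?thesis .
qed

section \<open>Nondegenerate curves\<close>

lemma good_on_cong:
  assumes "good_on K C I f" and eq: "\<And>t. t \<in> I \<Longrightarrow> f t = g t"
  shows "good_on K C I g"
  unfolding good_on_def
proof (intro conjI allI impI)
  show "continuous_on I g" using good_on_continuous[OF assms(1)] eq by (simp cong: continuous_on_cong)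
  fix a b \<epsilon> t :: real
  assume *: "a < b" "{a..b} \<subseteq> I" "0 < \<epsilon>" "t \<in> {a..b}"
  have "{s \<in> {a..b}. \<bar>g s\<bar> < \<epsilon>} = {s \<in> {a..b}. \<bar>f s\<bar> < \<epsilon>}"
    using *(2) eq by (intro Collect_cong conj_cong refl) (metis subsetD)
  moreover have "g t = f t" using eq * by (metis subsetD)
  ultimately show "\<bar>g t\<bar> * measure lebesgue {s \<in> {a..b}. \<bar>g s\<bar> < \<epsilon>} ^ K \<le> C * \<epsilon> * (b - a) ^ K"
    using good_onD[OF assms(1) *] by (simp only:)
qed

text \<open>Only the component of a linear form inside the direction \<open>V\<close> varies along the curve.\<close>

lemma affine_form_decomposition:
  fixes \<beta> :: "'a::euclidean_space"
  assumes "subspace V"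
  obtains \<beta>' where "\<beta>' \<in> V" "\<And>x. x \<in> V \<Longrightarrow> x \<bullet> \<beta> = x \<bullet> \<beta>'"
proof -
  obtain y z where y: "y \<in> span V" and z: "\<And>w. w \<in> span V \<Longrightarrow> orthogonal z w" and "\<beta> = y + z"
    using orthogonal_subspace_decomp_exists[of V \<beta>] by blast
  have sp: "span V = V" using assms by simp
  have "x \<bullet> \<beta> = x \<bullet> y" if "x \<in> V" for x
    using z[of x] that sp \<open>\<beta> = y + z\<close> by (simp add: inner_add_right orthogonal_def inner_commute)
  then show ?thesis using that y sp by metis
qed

text \<open>\<open>H j\<close> is the \<open>j\<close>-th derivative of the curve
  \<open>H 0\<close>. For each direction \<open>w\<close> in \<open>V\<close> one order
  \<open>j\<close> works on all of \<open>I\<close>, and \<open>\<kappa>\<close> and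
  \<open>\<Lambda>\<close> are independent of \<open>w\<close>; the later uniform constants are
  drawn from this.\<close>

locale nondegenerate_curve =
  fixes H :: "nat \<Rightarrow> real \<Rightarrow> real^'n::finite" and K :: nat and I :: "real set" and V :: "(real^'n) set"
    and \<kappa> \<Lambda> :: real
  assumes derivs: "\<And>j t. j < K \<Longrightarrow> t \<in> I \<Longrightarrow> (H j has_vector_derivative H (Suc j) t) (at t)"
    and V: "subspace V"
    and diff_in: "\<And>t t'. t \<in> I \<Longrightarrow> t' \<in> I \<Longrightarrow> H 0 t - H 0 t' \<in> V"
    and nondeg: "\<And>w. w \<in> V \<Longrightarrow> \<exists>j\<in>{1..K}. \<forall>t\<in>I. \<kappa> * norm w \<le> \<bar>H j t \<bullet> w\<bar> \<and> \<bar>H j t \<bullet> w\<bar> \<le> \<Lambda> * (\<kappa> * norm w)"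
    and \<kappa>: "0 < \<kappa>" and \<Lambda>: "1 \<le> \<Lambda>" and K: "1 \<le> K"
begin

definition "Cgood = (real K + 1) * \<Lambda> * (2 ^ (K + 2)) ^ K"

lemma Cgood_ge_1: "1 \<le> Cgood"
proof -
  have "(1::real) \<le> (2 ^ (K + 2)) ^ K" by (intro one_le_power) simp
  moreover have "1 \<le> (real K + 1) * \<Lambda>" using mult_mono[of 1 "real K + 1" 1 \<Lambda>] \<Lambda> by simp
  ultimately show ?thesis unfolding Cgood_def using mult_mono[of 1 "(real K + 1) * \<Lambda>" 1 "(2 ^ (K + 2)) ^ K"] by simp
qed

lemma form_derivs:
  assumes "j < K" "t \<in> I"
  shows "((\<lambda>t. H j t \<bullet> \<beta>) has_real_derivative H (Suc j) t \<bullet> \<beta>) (at t)"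
  using bounded_linear.has_vector_derivative[OF bounded_linear_inner_left derivs[OF assms]]
  by (simp add: has_real_derivative_iff_has_vector_derivative)

text \<open>On the curve the form agrees with one whose coefficient vector lies in \<open>V\<close>.
  The bounds of \<open>nondeg\<close> are homogeneous in that vector, so one constant serves all
  forms; if the vector is 0, the form is constant on the curve.\<close>

lemma good_affine_form:
  assumes c: "c \<in> I"
  shows "good_on K Cgood I (\<lambda>t. \<alpha> + H 0 t \<bullet> \<beta>)"
proof -
  obtain \<beta>' where \<beta>': "\<beta>' \<in> V" "\<And>x. x \<in> V \<Longrightarrow> x \<bullet> \<beta> = x \<bullet> \<beta>'" using affine_form_decomposition[OF V] by blast
  define \<alpha>' where "\<alpha>' = \<alpha> + H 0 c \<bullet> \<beta> - H 0 c \<bullet> \<beta>'"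
  have eq: "\<alpha>' + H 0 t \<bullet> \<beta>' = \<alpha> + H 0 t \<bullet> \<beta>" if "t \<in> I" for t
    using \<beta>'(2)[OF diff_in[OF that c]] by (simp add: \<alpha>'_def inner_diff_left)
  show ?thesis
  proof (cases "\<beta>' = 0")
    case True
    have "good_on K Cgood I (\<lambda>_. \<alpha>')" using Cgood_ge_1 K by (rule good_on_const)
    then show ?thesis by (rule good_on_cong) (use eq True in simp)
  next
    case False
    obtain j where j: "j \<in> {1..K}" "\<And>t. t \<in> I \<Longrightarrow> \<kappa> * norm \<beta>' \<le> \<bar>H j t \<bullet> \<beta>'\<bar>"
      "\<And>t. t \<in> I \<Longrightarrow> \<bar>H j t \<bullet> \<beta>'\<bar> \<le> \<Lambda> * (\<kappa> * norm \<beta>')" using nondeg[OF \<beta>'(1)] by blast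
    define G where "G i t = (if i = 0 then \<alpha>' + H 0 t \<bullet> \<beta>' else H i t \<bullet> \<beta>')" for i t
    have "good_on K ((real K + 1) * \<Lambda> * (2 ^ (K + 2)) ^ K) I (G 0)"
    proof (rule good_on_derivative_bounds[of j I G K "\<kappa> * norm \<beta>'" \<Lambda>])
      show "(G i has_real_derivative G (Suc i) t) (at t)" if "i < j" "t \<in> I" for i t
      proof -
        have "i < K" using that j(1) by auto
        from form_derivs[OF this that(2), of \<beta>'] show ?thesis
          unfolding G_def by (cases i) (auto intro!: derivative_eq_intros)
      qed
      show "\<kappa> * norm \<beta>' \<le> \<bar>G j t\<bar>" "\<bar>G j t\<bar> \<le> \<Lambda> * (\<kappa> * norm \<beta>')" if "t \<in> I" for t
        using j(1) j(2,3)[OF that] by (auto simp: G_def)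
      show "0 < \<kappa> * norm \<beta>'" using \<kappa> False by simp
    qed (use j \<Lambda> in auto)
    then show ?thesis unfolding Cgood_def by (rule good_on_cong) (simp add: G_def eq)
  qed
qed

text \<open>If a form is small on a piece of the curve, a derivative of it is small at some point,
  and nondegeneracy bounds the component of its coefficients in \<open>V\<close>. From the centre of
  the piece to \<open>y0\<close> the form changes only through this component. The constant
  \<open>b\<close> may depend on \<open>y0\<close>, but not on the form.\<close>

lemma affine_form_sup:
  assumes r: "0 < r" and sub: "cball c r \<subseteq> I" and y0: "y0 - H 0 c \<in> V"
  obtains b where "0 < b"
    "\<And>\<alpha> \<beta> \<epsilon>. (\<And>t. t \<in> cball c r \<Longrightarrow> \<bar>\<alpha> + H 0 t \<bullet> \<beta>\<bar> \<le> \<epsilon>) \<Longrightarrow> \<bar>\<alpha> + y0 \<bullet> \<beta>\<bar> \<le> b * \<epsilon>"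
proof -
  \<comment> \<open>\<open>2 ^ K\<close> points with this spacing fit into an interval of length
    \<open>2 * r\<close>.\<close>
  define s where "s = 2 * r / 2 ^ K"
  have s: "0 < s" using r by (simp add: s_def)
  define Z where "Z = (max 1 (2 / s)) ^ K"
  have Z: "0 < Z" by (simp add: Z_def)
  define b where "b = 1 + norm (y0 - H 0 c) * (Z / \<kappa>)"
  have "0 < b" using Z \<kappa> by (simp add: b_def add_pos_nonneg)
  moreover have "\<bar>\<alpha> + y0 \<bullet> \<beta>\<bar> \<le> b * \<epsilon>"
    if small: "\<And>t. t \<in> cball c r \<Longrightarrow> \<bar>\<alpha> + H 0 t \<bullet> \<beta>\<bar> \<le> \<epsilon>" for \<alpha> \<beta> \<epsilon>
  proof -
    have c: "c \<in> cball c r" using r by simp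
    then have cI: "c \<in> I" using sub by blast
    have \<epsilon>: "0 \<le> \<epsilon>" using small[OF c] abs_ge_zero order_trans by blast
    obtain \<beta>' where \<beta>': "\<beta>' \<in> V" "\<And>x. x \<in> V \<Longrightarrow> x \<bullet> \<beta> = x \<bullet> \<beta>'" using affine_form_decomposition[OF V] by blast
    define \<alpha>' where "\<alpha>' = \<alpha> + H 0 c \<bullet> \<beta> - H 0 c \<bullet> \<beta>'"
    have eq: "\<alpha>' + H 0 t \<bullet> \<beta>' = \<alpha> + H 0 t \<bullet> \<beta>" if "t \<in> I" for t
      using \<beta>'(2)[OF diff_in[OF that cI]] by (simp add: \<alpha>'_def inner_diff_left)
    obtain j where j: "j \<in> {1..K}" "\<And>t. t \<in> I \<Longrightarrow> \<kappa> * norm \<beta>' \<le> \<bar>H j t \<bullet> \<beta>'\<bar>" using nondeg[OF \<beta>'(1)] by blast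
    define G where "G i t = (if i = 0 then \<alpha>' + H 0 t \<bullet> \<beta>' else H i t \<bullet> \<beta>')" for i t
    define x where "x i = c - r + real i * s" for i :: nat
    have xin: "x i \<in> {c - r..c + r}" if "i < 2 ^ j" for i
    proof -
      have "(2::nat) ^ j \<le> 2 ^ K" using j(1) by (intro power_increasing) auto
      then have "i \<le> 2 ^ K" using that by linarith
      then have "real i \<le> 2 ^ K" by (metis of_nat_le_iff of_nat_numeral of_nat_power)
      then have "real i * s \<le> 2 ^ K * s" using s by (intro mult_right_mono) auto
      also have "\<dots> = 2 * r" by (simp add: s_def)
      finally show ?thesis using s by (simp add: x_def)
    qed
    have cb: "{c - r..c + r} \<subseteq> I" using sub by (simp add: cball_real)
    have "\<exists>\<xi>\<in>{c - r..c + r}. \<bar>G j \<xi>\<bar> \<le> \<epsilon> * (2/s)^j"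
    proof (rule spaced_points_derivative_small[of j "c - r" "c + r" G s \<epsilon> x])
      show "(G i has_real_derivative G (Suc i) t) (at t)" if "i < j" "t \<in> {c - r..c + r}" for i t
      proof -
        have "i < K" "t \<in> I" using that j(1) cb by auto
        from form_derivs[OF this, of \<beta>'] show ?thesis
          unfolding G_def by (cases i) (auto intro!: derivative_eq_intros)
      qed
      show "\<bar>G 0 (x i)\<bar> \<le> \<epsilon>" if "i < 2 ^ j" for i
      proof -
        have "x i \<in> cball c r" using xin[OF that] by (simp add: cball_real)
        then show ?thesis using small[of "x i"] eq[of "x i"] sub by (auto simp: G_def)
      qed
      show "x i + s \<le> x (Suc i)" for i by (simp add: x_def algebra_simps)
    qed (use xin s \<epsilon> in auto)
    then obtain \<xi> where \<xi>: "\<xi> \<in> I" "\<bar>G j \<xi>\<bar> \<le> \<epsilon> * (2/s)^j" using cb by blast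
    have "\<kappa> * norm \<beta>' \<le> \<epsilon> * (2/s)^j" using \<xi> j(1) j(2)[OF \<xi>(1)] by (auto simp: G_def)
    also have "(2/s)^j \<le> (max 1 (2/s))^j" using s by (intro power_mono) auto
    also have "\<dots> \<le> Z" unfolding Z_def using j(1) by (intro power_increasing) auto
    finally have "\<kappa> * norm \<beta>' \<le> \<epsilon> * Z" using \<epsilon> by (simp add: mult_left_mono)
    then have n\<beta>: "norm \<beta>' \<le> (Z / \<kappa>) * \<epsilon>" using \<kappa> by (simp add: field_simps)
    have "\<alpha> + y0 \<bullet> \<beta> = (\<alpha> + H 0 c \<bullet> \<beta>) + (y0 - H 0 c) \<bullet> \<beta>'"
      using \<beta>'(2)[OF y0] by (simp add: inner_diff_left)
    also have "\<bar>\<dots>\<bar> \<le> \<epsilon> + norm (y0 - H 0 c) * norm \<beta>'"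
      using small[OF c] Cauchy_Schwarz_ineq2[of "y0 - H 0 c" \<beta>'] by linarith
    also have "\<dots> \<le> \<epsilon> + norm (y0 - H 0 c) * ((Z / \<kappa>) * \<epsilon>)"
      using n\<beta> by (intro add_left_mono mult_left_mono) auto
    finally show ?thesis by (simp add: b_def algebra_simps)
  qed
  ultimately show ?thesis using that by blast
qed

lemma good_wvol:
  assumes "c \<in> I"
  shows "good_on K Cgood I (\<lambda>t. wvol j (\<lambda>i. form_map A B (H 0 t) (z i)))"
proof -
  have "\<exists>\<alpha> \<beta>. \<forall>y. det (dmat j (\<lambda>i. form_map A B y (z i)) \<sigma>) = \<alpha> + y \<bullet> \<beta>" for \<sigma>
    by (rule det_form_map_affine)
  then obtain \<alpha> \<beta> where ab: "\<And>\<sigma> y. det (dmat j (\<lambda>i. form_map A B y (z i)) \<sigma>) = \<alpha> \<sigma> + y \<bullet> \<beta> \<sigma>" by metis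
  show ?thesis
    unfolding wvol_def ab by (intro good_on_Max good_affine_form[OF assms]) auto
qed

text \<open>The determinant that attains the covolume at \<open>y0\<close> is an affine form in the
  point, so it cannot be small throughout \<open>J\<close>. The factor 2 makes the contradiction
  strict.\<close>

lemma wvol_sup:
  assumes b: "0 < b" and bound: "\<And>\<alpha> \<beta> \<epsilon>. (\<And>t. t \<in> J \<Longrightarrow> \<bar>\<alpha> + H 0 t \<bullet> \<beta>\<bar> \<le> \<epsilon>) \<Longrightarrow> \<bar>\<alpha> + y0 \<bullet> \<beta>\<bar> \<le> b * \<epsilon>"
    and a: "0 < a" "a \<le> wvol j (\<lambda>i. form_map A B y0 (z i))"
  shows "\<exists>t\<in>J. a / (2 * b) \<le> wvol j (\<lambda>i. form_map A B (H 0 t) (z i))"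
proof (rule ccontr)
  assume neg: "\<not> ?thesis"
  obtain \<sigma> where \<sigma>: "wvol j (\<lambda>i. form_map A B y0 (z i)) = \<bar>det (dmat j (\<lambda>i. form_map A B y0 (z i)) \<sigma>)\<bar>"
    by (rule wvol_attained)
  obtain \<alpha> \<beta> where ab: "\<And>y. det (dmat j (\<lambda>i. form_map A B y (z i)) \<sigma>) = \<alpha> + y \<bullet> \<beta>"
    using det_form_map_affine by blast
  have "\<bar>\<alpha> + H 0 t \<bullet> \<beta>\<bar> \<le> a / (2 * b)" if "t \<in> J" for t
    using neg that det_le_wvol[of j "\<lambda>i. form_map A B (H 0 t) (z i)" \<sigma>] unfolding ab by force
  then have "\<bar>\<alpha> + y0 \<bullet> \<beta>\<bar> \<le> b * (a / (2 * b))" by (rule bound)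
  also have "\<dots> = a / 2" using b by simp
  finally show False using a \<sigma> unfolding ab by linarith
qed

end

section \<open>Diophantine conditions and short lattice vectors\<close>

lemma finite_int_vecs: "finite {q :: real^'n. int_vec q \<and> norm q \<le> B}"
proof (rule finite_subset)
  let ?F = "UNIV \<rightarrow>\<^sub>E {- \<lceil>B\<rceil>..\<lceil>B\<rceil>} :: ('n \<Rightarrow> int) set"
  show "{q :: real^'n. int_vec q \<and> norm q \<le> B} \<subseteq> (\<lambda>f. \<chi> i. of_int (f i)) ` ?F"
  proof
    fix q :: "real^'n" assume "q \<in> {q. int_vec q \<and> norm q \<le> B}"
    then have q: "\<And>i. q $ i \<in> \<int>" "norm q \<le> B" by (auto simp: int_vec_def)
    have fl: "of_int \<lfloor>q $ i\<rfloor> = q $ i" for i using q(1)[of i] by (auto elim: Ints_cases)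
    have "\<bar>q $ i\<bar> \<le> B" for i using component_le_norm_cart[of q i] q(2) by linarith
    then have "- B \<le> q $ i" "q $ i \<le> B" for i by (simp_all add: abs_le_iff minus_le_iff)
    then have "\<lfloor>q $ i\<rfloor> \<in> {- \<lceil>B\<rceil>..\<lceil>B\<rceil>}" for i
      using fl[of i] by (smt (verit) atLeastAtMost_iff le_of_int_ceiling of_int_le_iff of_int_minus)
    then have "(\<lambda>i. \<lfloor>q $ i\<rfloor>) \<in> ?F" by auto
    moreover have "q = (\<chi> i. of_int \<lfloor>q $ i\<rfloor>)" by (simp add: vec_eq_iff fl)
    ultimately show "q \<in> (\<lambda>f. \<chi> i. of_int (f i)) ` ?F" by (intro image_eqI[where x="\<lambda>i. \<lfloor>q $ i\<rfloor>"])
  qed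
  show "finite ((\<lambda>f. \<chi> i. of_int (f i) :: real^'n) ` ?F)" by (intro finite_imageI finite_PiE) auto
qed

definition approximable :: "real \<Rightarrow> real^'n \<Rightarrow> bool" where
  "approximable v y \<longleftrightarrow>
     infinite {q. int_vec q \<and> (\<exists>p::int. \<bar>y \<bullet> q + of_int p\<bar> < norm q powr (- v))}"

lemma form_map_zero_iff:
  fixes z :: "real^'n::finite coord"
  assumes "A \<noteq> 0" "B \<noteq> 0" "form_map A B y z = 0"
  shows "z = 0"
proof -
  have q: "z $ cpos j = 0" for j
    using assms(3)[unfolded vec_eq_iff, rule_format, of "cpos j"] assms(2) by (simp add: form_map_def)
  then have "qpart z = 0" by (simp add: qpart_def vec_eq_iff)
  then have "z $ c0 = 0"
    using assms(3)[unfolded vec_eq_iff, rule_format, of c0] assms(1) by (simp add: form_map_def)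
  then show ?thesis using q coord_cases by (metis vec_eq_iff zero_index)
qed

text \<open>This is the Dani correspondence. The Diophantine condition is invoked only for nonzero
  \<open>q\<close> of norm below \<open>X\<close>, where the expansion by
  \<open>X powr v / c\<close> compensates \<open>c * norm q powr (- v)\<close>; longer
  \<open>q\<close> remain long after division by \<open>X\<close>, and for \<open>q = 0\<close> a
  nonzero integer is expanded.\<close>

lemma form_map_long:
  fixes y :: "real^'n::finite"
  assumes v: "0 < v" and c: "0 < c" "c \<le> 1" and X: "1 \<le> X"
    and dio: "\<And>q (p::int). int_vec q \<Longrightarrow> q \<noteq> 0 \<Longrightarrow> c * norm q powr (- v) \<le> \<bar>y \<bullet> q + of_int p\<bar>"
    and z: "int_vec z" "z \<noteq> 0"
  shows "1 \<le> norm (form_map (X powr v / c) (1 / X) y z)"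
proof -
  let ?A = "X powr v / c"
  have Xv: "1 \<le> X powr v" using X v by (simp add: ge_one_powr_ge_zero)
  have A: "1 \<le> ?A" using Xv c by (simp add: field_simps)
  then have A': "\<bar>?A\<bar> = ?A" by linarith
  obtain p where p: "z $ c0 = of_int p" using z(1) by (auto simp: int_vec_def elim: Ints_cases)
  have iq: "int_vec (qpart z)" using z(1) by (auto simp: int_vec_def qpart_def)
  consider "qpart z = 0" | "qpart z \<noteq> 0" "X \<le> norm (qpart z)" | "qpart z \<noteq> 0" "norm (qpart z) < X" by linarith
  then show ?thesis
  proof cases
    case 1
    then have "z $ cpos j = 0" for j by (simp add: qpart_def vec_eq_iff)
    then have "p \<noteq> 0" using z(2) p coord_cases by (metis of_int_0 vec_eq_iff zero_index)
    then have "1 \<le> \<bar>z $ c0\<bar>" using p by linarith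
    then have "1 * 1 \<le> ?A * \<bar>z $ c0\<bar>" using A by (intro mult_mono) auto
    also have "\<dots> = \<bar>?A * (z $ c0 + y \<bullet> qpart z)\<bar>" using A' 1 by (simp only: abs_mult) simp
    finally show ?thesis using norm_form_map_ge1[of ?A z y "1 / X"] by linarith
  next
    case 2
    then have "1 \<le> \<bar>1 / X\<bar> * norm (qpart z)" using X by (simp add: field_simps)
    then show ?thesis using norm_form_map_ge2 by (rule order_trans)
  next
    case 3
    have "X powr (- v) \<le> norm (qpart z) powr (- v)" using 3 v X by (intro powr_mono2') auto
    then have "c * X powr (- v) \<le> c * norm (qpart z) powr (- v)" using c by (intro mult_left_mono) auto
    also have "\<dots> \<le> \<bar>y \<bullet> qpart z + of_int p\<bar>" by (rule dio[OF iq 3(1)])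
    finally have "?A * (c * X powr (- v)) \<le> ?A * \<bar>z $ c0 + y \<bullet> qpart z\<bar>"
      using A p by (intro mult_left_mono) (auto simp: add.commute)
    moreover have "?A * (c * X powr (- v)) = 1" using c X by (simp add: powr_minus)
    moreover have "\<bar>?A * (z $ c0 + y \<bullet> qpart z)\<bar> = ?A * \<bar>z $ c0 + y \<bullet> qpart z\<bar>"
      using A' by (simp only: abs_mult)
    ultimately show ?thesis using norm_form_map_ge1[of ?A z y "1 / X"] by linarith
  qed
qed

definition mk_coord :: "real \<Rightarrow> real^'n::finite \<Rightarrow> real^'n coord" where
  "mk_coord p q = (\<chi> i. if i = c0 then p else q $ (inv cpos i))"

lemma mk_coord_simps [simp]: "mk_coord p q $ c0 = p" "qpart (mk_coord p q) = q"
  by (simp_all add: mk_coord_def qpart_def vec_eq_iff inv_f_f[OF inj_cpos])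

lemma int_vec_mk_coord: "p \<in> \<int> \<Longrightarrow> int_vec q \<Longrightarrow> int_vec (mk_coord p q)"
  by (auto simp: int_vec_def mk_coord_def)

context nondegenerate_curve
begin

text \<open>The constants \<open>C'\<close> and \<open>c2\<close> precede the quantifiers over
  \<open>X\<close> and \<open>\<tau>\<close>: the covolumes at \<open>y0\<close> are bounded below
  in terms of the dimension alone, and the transfer to the curve is uniform in the form. Thus the
  same ball \<open>cball c r\<close> serves all scales.\<close>

lemma nondivergence_at_scale:
  assumes r: "0 < r" and sub: "cball c (11 ^ Suc CARD('n coord) * r) \<subseteq> I" and y0: "y0 - H 0 c \<in> V"
    and v: "0 < v" and d: "0 < d" "d \<le> 1"
    and dio: "\<And>q (p::int). int_vec q \<Longrightarrow> q \<noteq> 0 \<Longrightarrow> d * norm q powr (- v) \<le> \<bar>y0 \<bullet> q + of_int p\<bar>"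
  shows "\<exists>C' c2. 0 \<le> C' \<and> 0 < c2 \<and> (\<forall>X \<tau>. 1 \<le> X \<longrightarrow> 0 < \<tau> \<longrightarrow> \<tau> \<le> 1 \<longrightarrow>
    (\<exists>W\<in>lmeasurable. measure lebesgue W \<le> C' * \<tau> * r \<and>
      (\<forall>t\<in>cball c r - W. \<forall>u. int_vec u \<longrightarrow> u \<noteq> 0 \<longrightarrow>
         c2 * \<tau> ^ K \<le> norm (form_map (X powr v / d) (1 / X) (H 0 t) u))))"
proof -
  let ?m = "CARD('n coord)"
  let ?S = "{V :: (real^'n coord) set. rational_subspace V}"
  \<comment> \<open>The dimensions 0 to \<open>?m\<close> are \<open>Suc ?m\<close> ranks; hence the
    exponent of 11 in the hypothesis.\<close>
  let ?R = "{..?m}"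
  let ?D = "Cgood * 5 ^ K"
  have "(1::real) \<le> 11 ^ Suc ?m" by (rule one_le_power) simp
  then have "1 * r \<le> 11 ^ Suc ?m * r" using r by (intro mult_right_mono) auto
  then have "cball c r \<subseteq> cball c (11 ^ Suc ?m * r)" by (intro subset_cball) simp
  then have sub1: "cball c r \<subseteq> I" using sub by blast
  then have cI: "c \<in> I" using r by auto
  obtain b where b: "0 < b"
    "\<And>\<alpha> \<beta> \<epsilon>. (\<And>t. t \<in> cball c r \<Longrightarrow> \<bar>\<alpha> + H 0 t \<bullet> \<beta>\<bar> \<le> \<epsilon>) \<Longrightarrow> \<bar>\<alpha> + y0 \<bullet> \<beta>\<bar> \<le> b * \<epsilon>"
    using affine_form_sup[OF r sub1 y0] by blast
  define a where "a = (1 / (2 * real ?m ^ 2)) ^ ?m"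
  have "0 < real ?m" by simp
  then have a: "0 < a" unfolding a_def by (intro zero_less_power divide_pos_pos mult_pos_pos) auto
  \<comment> \<open>Divided by this number, every covolume reaches 1 somewhere on the ball.\<close>
  define \<kappa>0 where "\<kappa>0 = a / (2 * b)"
  have \<kappa>0: "0 < \<kappa>0" using a b by (simp add: \<kappa>0_def)
  have csym: "symp (comparable :: (real^'n coord) set \<Rightarrow> _)" by (auto simp: symp_def comparable_def)
  obtain C' where C': "0 \<le> C'" and nd: "\<And>(S::(real^'n coord) set set) R \<psi> c r \<tau>. finite R \<Longrightarrow> card R = Suc ?m \<Longrightarrow> dim ` S \<subseteq> R \<Longrightarrow> 0 < r \<Longrightarrow> 0 < \<tau> \<Longrightarrow>
     (\<forall>s\<in>S. good_on K Cgood (cball c (11 ^ Suc ?m * r)) (\<psi> s) \<and> (\<forall>t. 0 \<le> \<psi> s t) \<and> (\<exists>t\<in>cball c r. 1 \<le> \<psi> s t)) \<Longrightarrow>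
     (\<exists>W\<in>lmeasurable. measure lebesgue W \<le> C' * \<tau> * r \<and>
        (\<forall>x\<in>cball c r - W. flag_marked comparable dim S \<psi> (\<tau> ^ K) ?D x))"
    using quantitative_nondivergence[OF csym Cgood_ge_1 K, of "Suc ?m" dim]
    by metis
  define c2 where "c2 = 1 / (real ?m * max ?D (1 / \<kappa>0))"
  have mx: "0 < real ?m * max ?D (1 / \<kappa>0)" using \<kappa>0 by (intro mult_pos_pos) (auto simp: less_max_iff_disj)
  then have c2: "0 < c2" by (simp add: c2_def)
  have "\<exists>W\<in>lmeasurable. measure lebesgue W \<le> C' * \<tau> * r \<and>
      (\<forall>t\<in>cball c r - W. \<forall>u. int_vec u \<longrightarrow> u \<noteq> 0 \<longrightarrow>
         c2 * \<tau> ^ K \<le> norm (form_map (X powr v / d) (1 / X) (H 0 t) u))"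
    if X: "1 \<le> X" and \<tau>: "0 < \<tau>" "\<tau> \<le> 1" for X \<tau>
  proof -
    define T where "T y = form_map (X powr v / d) (1 / X) y" for y :: "real^'n"
    have linT: "linear (T y)" for y unfolding T_def by (rule linear_form_map)
    have nz: "X powr v / d \<noteq> 0" "1 / X \<noteq> 0" using X d by auto
    have injT: "inj (T y0)"
      using form_map_zero_iff[OF nz] linear_injective_0[OF linT] by (auto simp: T_def)
    define \<psi> where "\<psi> V t = wvol (dim V) (\<lambda>i. T (H 0 t) (min_tuple V i)) / \<kappa>0" for V t
    have "\<exists>W\<in>lmeasurable. measure lebesgue W \<le> C' * \<tau> * r \<and>
        (\<forall>x\<in>cball c r - W. flag_marked comparable dim ?S \<psi> (\<tau> ^ K) ?D x)"
    proof (rule nd)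
      show "finite ?R" "card ?R = Suc ?m" "dim ` ?S \<subseteq> ?R" using dim_le_CARD[where 'm="'n coord"] by auto
      show "\<forall>V\<in>?S. good_on K Cgood (cball c (11 ^ Suc ?m * r)) (\<psi> V) \<and> (\<forall>t. 0 \<le> \<psi> V t) \<and> (\<exists>t\<in>cball c r. 1 \<le> \<psi> V t)"
      proof (intro ballI conjI allI)
        fix V assume "V \<in> ?S"
        then have V: "rational_subspace V" by simp
        have "good_on K Cgood I (\<lambda>t. (1 / \<kappa>0) * wvol (dim V) (\<lambda>i. T (H 0 t) (min_tuple V i)))"
          unfolding T_def using \<kappa>0 by (intro good_on_scale good_wvol[OF cI]) simp
        then have "good_on K Cgood I (\<psi> V)" unfolding \<psi>_def[abs_def] by simp
        then show "good_on K Cgood (cball c (11 ^ Suc ?m * r)) (\<psi> V)" using sub by (rule good_on_subset)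
        show "0 \<le> \<psi> V t" for t unfolding \<psi>_def using wvol_nonneg \<kappa>0 by (rule divide_nonneg_pos)
        have "a \<le> wvol (dim V) (\<lambda>i. T y0 (min_tuple V i))"
          unfolding a_def by (rule wvol_rational_lower_bound[OF V linT _ injT])
            (unfold T_def, rule form_map_long[OF v d X dio])
        then obtain t where "t \<in> cball c r" "\<kappa>0 \<le> wvol (dim V) (\<lambda>i. T (H 0 t) (min_tuple V i))"
          using wvol_sup[OF b a] unfolding T_def \<kappa>0_def by blast
        then show "\<exists>t\<in>cball c r. 1 \<le> \<psi> V t" using \<kappa>0 by (auto simp: \<psi>_def)
      qed
    qed (use r \<tau> in auto)
    then obtain W where W: "W \<in> lmeasurable" "measure lebesgue W \<le> C' * \<tau> * r"
      "\<And>x. x \<in> cball c r - W \<Longrightarrow> flag_marked comparable dim ?S \<psi> (\<tau> ^ K) ?D x" by blast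
    have "c2 * \<tau> ^ K \<le> norm (T (H 0 t) u)" if t: "t \<in> cball c r - W" and u: "int_vec u" "u \<noteq> 0" for t u
    proof -
      have "\<tau> ^ K \<le> 1" using \<tau> by (simp add: power_le_one)
      then have "\<tau> ^ K \<le> real ?m * norm (T (H 0 t) u) * max ?D (1 / \<kappa>0)"
        using flag_marked_imp_long[of "\<lambda>t. T (H 0 t)" \<kappa>0 "\<tau> ^ K" ?D t, OF W(3)[OF t, unfolded \<psi>_def[abs_def]] linT \<kappa>0 _ u]
        by simp
      then have "c2 * \<tau> ^ K \<le> c2 * (real ?m * norm (T (H 0 t) u) * max ?D (1 / \<kappa>0))"
        using c2 by (intro mult_left_mono) auto
      also have "\<dots> = norm (T (H 0 t) u) * (c2 * (real ?m * max ?D (1 / \<kappa>0)))" by (simp only: mult_ac)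
      also have "c2 * (real ?m * max ?D (1 / \<kappa>0)) = 1" 
      proof -
        have "1 / z * z = 1" if "0 < z" for z :: real using that by simp
        from this[OF mx] show ?thesis unfolding c2_def .
      qed
      finally show ?thesis by simp
    qed
    then show ?thesis using W(1,2) unfolding T_def by blast
  qed
  then show ?thesis using C' c2 by blast
qed

text \<open>Borel-Cantelli over dyadic scales. Off sets of summable measure, nonzero lattice vectors
  at scale \<open>X\<close> have at least the length \<open>c2 * X powr (- \<delta>)\<close>. An
  approximation with exponent \<open>v'\<close> would produce a shorter one: its \<open>q\<close>
  part is short because \<open>norm q\<close> is below a small multiple of
  \<open>X powr (1 - \<delta>)\<close>, its first coordinate because \<open>v'\<close> exceeds
  \<open>v\<close>.\<close>

lemma approximable_null:
  assumes r: "0 < r" and sub: "cball c (11 ^ Suc CARD('n coord) * r) \<subseteq> I" and y0: "y0 - H 0 c \<in> V"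
    and v: "0 < v" "v < v'" and d: "0 < d" "d \<le> 1"
    and dio: "\<And>q (p::int). int_vec q \<Longrightarrow> q \<noteq> 0 \<Longrightarrow> d * norm q powr (- v) \<le> \<bar>y0 \<bullet> q + of_int p\<bar>"
  shows "negligible {t \<in> cball c r. approximable v' (H 0 t)}"
proof -
  let ?n = "real CARD('n)"
  \<comment> \<open>Small enough that \<open>v' * (1 - \<delta>)\<close> still exceeds
    \<open>v + \<delta>\<close>; the surplus \<open>\<mu>\<close> gives geometric decay in the
    number of the scale.\<close>
  define \<delta> where "\<delta> = (v' - v) / (2 * (1 + v'))"
  have "(v' - v) / (2 * b) * b = (v' - v) / 2" if "b \<noteq> 0" for b :: real using that by simp
  from this[of "1 + v'"] have "\<delta> * (1 + v') = (v' - v) / 2" using v by (simp add: \<delta>_def)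
  then have \<delta>: "0 < \<delta>" "\<delta> < 1" "\<delta> * (1 + v') < v' - v"
    using v by (simp_all add: \<delta>_def)
  define \<mu> where "\<mu> = v' * (1 - \<delta>) - (v + \<delta>)"
  have \<mu>: "0 < \<mu>" using \<delta>(3) by (simp add: \<mu>_def algebra_simps)
  obtain C' c2 where C': "0 \<le> C'" and c2: "0 < c2" and nd: "\<And>X \<tau>. 1 \<le> X \<Longrightarrow> 0 < \<tau> \<Longrightarrow> \<tau> \<le> 1 \<Longrightarrow>
    (\<exists>W\<in>lmeasurable. measure lebesgue W \<le> C' * \<tau> * r \<and>
      (\<forall>t\<in>cball c r - W. \<forall>u. int_vec u \<longrightarrow> u \<noteq> 0 \<longrightarrow>
         c2 * \<tau> ^ K \<le> norm (form_map (X powr v / d) (1 / X) (H 0 t) u)))"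
    using nondivergence_at_scale[OF r sub y0 v(1) d dio] by metis
  define X where "X N = 2 powr (real N + 1)" for N :: nat
  have X: "1 \<le> X N" for N by (simp add: X_def ge_one_powr_ge_zero)
  \<comment> \<open>This makes \<open>\<tau> N ^ K\<close> equal to
    \<open>X N powr (- \<delta>)\<close>, while \<open>\<tau> N\<close> itself, which controls the
    measure, is a geometric sequence.\<close>
  define \<tau> where "\<tau> N = X N powr (- \<delta> / real K)" for N
  have \<tau>: "0 < \<tau> N" "\<tau> N \<le> 1" for N
  proof -
    show "0 < \<tau> N" using X[of N] by (simp add: \<tau>_def)
    have "X N powr (- \<delta> / real K) \<le> X N powr 0" using X[of N] \<delta> by (intro powr_mono) auto
    then show "\<tau> N \<le> 1" using X[of N] by (simp add: \<tau>_def)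
  qed
  have \<tau>K: "\<tau> N ^ K = X N powr (- \<delta>)" for N
  proof -
    have "\<tau> N ^ K = X N powr (real K * (- \<delta> / real K))"
      unfolding \<tau>_def using X[of N] by (subst powr_power) auto
    also have "real K * (- \<delta> / real K) = - \<delta>" using K by simp
    finally show ?thesis .
  qed
  have "\<exists>W. W \<in> lmeasurable \<and> measure lebesgue W \<le> C' * \<tau> N * r \<and>
      (\<forall>t\<in>cball c r - W. \<forall>u. int_vec u \<longrightarrow> u \<noteq> 0 \<longrightarrow>
         c2 * \<tau> N ^ K \<le> norm (form_map (X N powr v / d) (1 / X N) (H 0 t) u))" for N
    using nd[OF X \<tau>] by blast
  then obtain W where W: "\<And>N. W N \<in> lmeasurable" "\<And>N. measure lebesgue (W N) \<le> C' * \<tau> N * r"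
    "\<And>N t u. t \<in> cball c r - W N \<Longrightarrow> int_vec u \<Longrightarrow> u \<noteq> 0 \<Longrightarrow>
         c2 * \<tau> N ^ K \<le> norm (form_map (X N powr v / d) (1 / X N) (H 0 t) u)"
    by metis
  have "summable (\<lambda>N. measure lebesgue (W N))"
  proof (rule summable_comparison_test')
    define g where "g = 2 powr (- \<delta> / real K)"
    have "- \<delta> / real K < 0" using \<delta> K by (simp add: divide_neg_pos)
    then have g: "0 < g" "g < 1" by (auto simp: g_def powr_less_one)
    have \<tau>g: "\<tau> N = g * g ^ N" for N
    proof -
      have "\<tau> N = g powr (real N + 1)" by (simp add: \<tau>_def X_def g_def powr_powr mult.commute)
      then show ?thesis using g by (simp add: powr_add powr_realpow)
    qed
    have "summable (\<lambda>N. (C' * r * g) * g ^ N)" using g by (intro summable_mult summable_geometric) auto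
    then show "summable (\<lambda>N. C' * \<tau> N * r)" by (simp add: \<tau>g mult_ac)
    show "norm (measure lebesgue (W N)) \<le> C' * \<tau> N * r" if "N \<ge> 0" for N using W(2)[of N] by simp
  qed
  moreover have "emeasure lebesgue (W N) < \<infinity>" for N
    unfolding infinity_ennreal_def less_top[symmetric] by (rule fmeasurableD2[OF W(1)])
  ultimately have null: "limsup W \<in> null_sets lebesgue"
    by (intro borel_cantelli_limsup1 fmeasurableD[OF W(1)])
  have "\<not> approximable v' (H 0 t)" if t: "t \<in> cball c r" "t \<notin> limsup W" for t
  proof -
    obtain N0 where N0: "\<And>N. N \<ge> N0 \<Longrightarrow> t \<notin> W N"
      using t(2) unfolding limsup_INF_SUP by auto
    let ?y = "H 0 t"
    \<comment> \<open>With this factor the \<open>q\<close> part accounts for less than half of the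
      lower bound \<open>c2 * X N powr (- \<delta>)\<close>.\<close>
    define a1 where "a1 = c2 / (2 * ?n)"
    have a1: "0 < a1" using c2 by (simp add: a1_def)
    \<comment> \<open>\<open>Q (Suc N)\<close> is \<open>a1 * X N powr (1 - \<delta>)\<close>:
      vectors with norm from \<open>Q N\<close> up to \<open>Q (Suc N)\<close> are tested at the
      scale \<open>X N\<close>.\<close>
    define Q where "Q N = a1 * 2 powr ((1 - \<delta>) * real N)" for N :: nat
    have Q0: "0 < Q N" for N using a1 by (simp add: Q_def)
    have Qmono: "Q N \<le> Q M" if "N \<le> M" for N M
      unfolding Q_def using a1 \<delta> that by (intro mult_left_mono powr_mono) auto
    have Qtop: "\<exists>M. B < Q M" for B
    proof -
      have "1 < 2 powr (1 - \<delta>)" using \<delta> by (simp add: gr_one_powr)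
      then obtain M where "B / a1 < (2 powr (1 - \<delta>)) ^ M" using real_arch_pow by blast
      moreover have "(2 powr (1 - \<delta>)) ^ M = 2 powr ((1 - \<delta>) * real M)" by (simp add: powr_power mult.commute)
      ultimately show ?thesis using a1 by (auto simp: Q_def field_simps)
    qed
    have "\<forall>\<^sub>F N in sequentially. (a1 powr (- v') / d * 2 powr (v + \<delta>)) * (2 powr (- \<mu>)) ^ N < c2 / 2"
    proof (rule order_tendstoD(2))
      have "(2::real) powr (- \<mu>) < 1" using \<mu> by (simp add: powr_less_one)
      then have "(\<lambda>N. (2 powr (- \<mu>)) ^ N) \<longlonglongrightarrow> (0::real)" by (intro LIMSEQ_power_zero) simp
      then show "(\<lambda>N. (a1 powr (- v') / d * 2 powr (v + \<delta>)) * (2 powr (- \<mu>)) ^ N) \<longlonglongrightarrow> 0"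
        by (rule tendsto_mult_right_zero)
    qed (use c2 in simp)
    then obtain N1 where N1: "\<And>N. N \<ge> N1 \<Longrightarrow> (a1 powr (- v') / d * 2 powr (v + \<delta>)) * (2 powr (- \<mu>)) ^ N < c2 / 2"
      by (auto simp: eventually_sequentially)
    have main: "norm q < Q (max N0 N1)"
      if q: "int_vec q" and p: "\<bar>?y \<bullet> q + of_int p\<bar> < norm q powr (- v')" for q and p :: int
    proof (rule ccontr)
      assume "\<not> norm q < Q (max N0 N1)"
      define M where "M = (LEAST M. norm q < Q M)"
      have M1: "norm q < Q M" unfolding M_def using Qtop by (rule LeastI_ex)
      have "\<not> M \<le> max N0 N1" using Qmono[of M "max N0 N1"] M1 \<open>\<not> norm q < Q (max N0 N1)\<close> by linarith
      then obtain N where N: "M = Suc N" "N \<ge> N0" "N \<ge> N1" by (cases M) auto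
      have "\<not> norm q < Q N" using not_less_Least[of N "\<lambda>M. norm q < Q M"] N(1) by (simp add: M_def)
      then have low: "Q N \<le> norm q" by simp
      then have "0 < norm q" using Q0[of N] by linarith
      then have q0: "q \<noteq> 0" by simp
      let ?u = "mk_coord (of_int p) q"
      have "?u \<noteq> 0"
      proof
        assume "?u = 0"
        then have "qpart ?u = qpart 0" by (simp only:)
        also have "qpart 0 = (0 :: real^'n)" by (simp add: qpart_def vec_eq_iff)
        finally show False using q0 by (simp only: mk_coord_simps)
      qed
      have XN: "X N powr s = 2 powr (s * (real N + 1))" for s by (simp add: X_def powr_powr mult.commute)
      have "c2 * X N powr (- \<delta>) \<le> norm (form_map (X N powr v / d) (1 / X N) ?y ?u)"
        using W(3)[of t N ?u] t(1) N0[OF N(2)] int_vec_mk_coord[of "of_int p" q] q \<open>?u \<noteq> 0\<close> by (simp add: \<tau>K)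
      also have "\<dots> \<le> \<bar>X N powr v / d * (of_int p + ?y \<bullet> q)\<bar> + \<bar>1 / X N\<bar> * (?n * norm q)"
        using norm_form_map_le[of "X N powr v / d" "1 / X N" ?y ?u] by simp
      also have "\<bar>1 / X N\<bar> * (?n * norm q) < \<bar>1 / X N\<bar> * (?n * Q M)"
        using M1 X[of N] by (intro mult_strict_left_mono) auto
      also have "\<bar>1 / X N\<bar> * (?n * Q M) = c2 / 2 * X N powr (- \<delta>)"
      proof -
        have "\<bar>1 / X N\<bar> = 1 / X N" using X[of N] by simp
        also have "\<dots> = 2 powr (- (real N + 1))" by (simp only: X_def powr_minus inverse_eq_divide)
        finally have "\<bar>1 / X N\<bar> = 2 powr (- (real N + 1))" .
        moreover have "2 powr (- (real N + 1)) * 2 powr ((1 - \<delta>) * (real N + 1)) = X N powr (- \<delta>)"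
          unfolding XN powr_add[symmetric] by (simp add: algebra_simps)
        ultimately show ?thesis by (simp add: Q_def N(1) a1_def add.commute)
      qed
      finally have 1: "c2 / 2 * X N powr (- \<delta>) < \<bar>X N powr v / d * (of_int p + ?y \<bullet> q)\<bar>"
        by linarith
      have "\<bar>X N powr v / d * (of_int p + ?y \<bullet> q)\<bar> = X N powr v / d * \<bar>?y \<bullet> q + of_int p\<bar>"
        using d by (simp add: abs_mult add.commute)
      also have "\<dots> \<le> X N powr v / d * Q N powr (- v')"
      proof (rule mult_left_mono)
        have "norm q powr (- v') \<le> Q N powr (- v')" using low Q0[of N] v by (intro powr_mono2') auto
        then show "\<bar>?y \<bullet> q + of_int p\<bar> \<le> Q N powr (- v')" using p by linarith
      qed (use d in simp)
      also have "\<dots> = (a1 powr (- v') / d * 2 powr (v + \<delta>)) * (2 powr (- \<mu>)) ^ N * X N powr (- \<delta>)"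
      proof -
        have "Q N powr (- v') = a1 powr (- v') * 2 powr ((1 - \<delta>) * real N * (- v'))"
          using a1 by (simp add: Q_def powr_mult powr_powr)
        moreover have "2 powr (v * (real N + 1)) * 2 powr ((1 - \<delta>) * real N * (- v'))
            = 2 powr (v + \<delta>) * 2 powr (- \<mu> * real N) * 2 powr (- \<delta> * (real N + 1))"
          unfolding powr_add[symmetric] by (simp add: \<mu>_def algebra_simps)
        moreover have "(2 powr (- \<mu>)) ^ N = 2 powr (- \<mu> * real N)" by (simp add: powr_power mult.commute)
        ultimately show ?thesis unfolding XN by simp
      qed
      also have "\<dots> \<le> c2 / 2 * X N powr (- \<delta>)" using N1[OF N(3)] by (intro mult_right_mono) auto
      finally show False using 1 by linarith
    qed
    have "{q. int_vec q \<and> (\<exists>p::int. \<bar>?y \<bullet> q + of_int p\<bar> < norm q powr (- v'))}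
        \<subseteq> {q. int_vec q \<and> norm q \<le> Q (max N0 N1)}" using main by (auto intro: less_imp_le)
    then show ?thesis unfolding approximable_def using finite_int_vecs finite_subset by blast
  qed
  then have "{t \<in> cball c r. approximable v' (H 0 t)} \<subseteq> limsup W" by blast
  moreover have "negligible (limsup W)" using null by (simp add: negligible_iff_null_sets)
  ultimately show ?thesis by (rule negligible_subset[rotated])
qed

end

section \<open>Iterated partial derivatives and moment curves\<close>

lemma smooth_onD: "smooth_on U f \<Longrightarrow> x \<in> U \<Longrightarrow> pderivs is f differentiable (at x)"
  by (simp add: smooth_on_def)

lemma pderivs_has_derivative:
  fixes f :: "real^'d \<Rightarrow> real^'n"
  assumes "smooth_on U f" "x \<in> U"
  shows "(pderivs is f has_derivative (\<lambda>h. \<Sum>i\<in>UNIV. h $ i *\<^sub>R pderivs (i # is) f x)) (at x)"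
proof -
  let ?D = "frechet_derivative (pderivs is f) (at x)"
  have D: "(pderivs is f has_derivative ?D) (at x)"
    using smooth_onD[OF assms] by (simp add: frechet_derivative_works)
  then have lin: "linear ?D" by (rule has_derivative_linear)
  have "?D h = (\<Sum>i\<in>UNIV. h $ i *\<^sub>R pderivs (i # is) f x)" for h
  proof -
    have "?D h = ?D (\<Sum>i\<in>UNIV. h $ i *\<^sub>R axis i 1)"
      using basis_expansion[of h] by (simp add: scalar_mult_eq_scaleR)
    then show ?thesis by (simp add: linear_sum[OF lin] linear_scale[OF lin] pderiv1_def)
  qed
  then have "?D = (\<lambda>h. \<Sum>i\<in>UNIV. h $ i *\<^sub>R pderivs (i # is) f x)" by (rule ext)
  then show ?thesis using D by (simp only:)
qed

lemma pderivs_continuous_on: "smooth_on U f \<Longrightarrow> continuous_on U (pderivs is f)"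
  by (intro continuous_at_imp_continuous_on ballI differentiable_imp_continuous_within smooth_onD)

lemma pderivs_curve:
  fixes f :: "real^'d \<Rightarrow> real^'n"
  assumes "smooth_on U f" "x + \<gamma> t \<in> U" and \<gamma>: "(\<gamma> has_vector_derivative \<gamma>') (at t)"
  shows "((\<lambda>t. pderivs is f (x + \<gamma> t)) has_vector_derivative
     (\<Sum>i\<in>UNIV. \<gamma>' $ i *\<^sub>R pderivs (i # is) f (x + \<gamma> t))) (at t)"
proof -
  have "((\<lambda>t. x + \<gamma> t) has_derivative (\<lambda>h. h *\<^sub>R \<gamma>')) (at t)"
    using \<gamma> unfolding has_vector_derivative_def by (auto intro!: derivative_eq_intros)
  from has_derivative_compose[OF this pderivs_has_derivative[OF assms(1,2)]]
  show ?thesis unfolding has_vector_derivative_def by (simp add: scaleR_sum_right)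
qed

section \<open>Symmetry of mixed partial derivatives\<close>

lemma mixed_differences:
  fixes \<phi> :: "'a::real_normed_vector \<Rightarrow> real"
  assumes h: "0 < h" and box: "\<And>s t. 0 \<le> s \<Longrightarrow> s \<le> h \<Longrightarrow> 0 \<le> t \<Longrightarrow> t \<le> h \<Longrightarrow> x + s *\<^sub>R a + t *\<^sub>R b \<in> B"
    and \<phi>a: "\<And>y s. y + s *\<^sub>R a \<in> B \<Longrightarrow> ((\<lambda>s. \<phi> (y + s *\<^sub>R a)) has_real_derivative \<phi>a (y + s *\<^sub>R a)) (at s)"
    and \<phi>ab: "\<And>y s. y + s *\<^sub>R b \<in> B \<Longrightarrow> ((\<lambda>s. \<phi>a (y + s *\<^sub>R b)) has_real_derivative \<phi>ab (y + s *\<^sub>R b)) (at s)"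
  shows "\<exists>s t. 0 \<le> s \<and> s \<le> h \<and> 0 \<le> t \<and> t \<le> h \<and>
    \<phi> (x + h *\<^sub>R a + h *\<^sub>R b) - \<phi> (x + h *\<^sub>R a) - \<phi> (x + h *\<^sub>R b) + \<phi> x = h * (h * \<phi>ab (x + s *\<^sub>R a + t *\<^sub>R b))"
proof -
  define u where "u s = \<phi> ((x + h *\<^sub>R b) + s *\<^sub>R a) - \<phi> (x + s *\<^sub>R a)" for s
  have du: "(u has_real_derivative \<phi>a ((x + h *\<^sub>R b) + s *\<^sub>R a) - \<phi>a (x + s *\<^sub>R a)) (at s)" if "0 \<le> s" "s \<le> h" for s
    unfolding u_def
  proof (rule DERIV_diff)
    show "((\<lambda>s. \<phi> (x + h *\<^sub>R b + s *\<^sub>R a)) has_real_derivative \<phi>a (x + h *\<^sub>R b + s *\<^sub>R a)) (at s)"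
      using box[of s h] that h by (intro \<phi>a) (simp add: ac_simps)
    show "((\<lambda>s. \<phi> (x + s *\<^sub>R a)) has_real_derivative \<phi>a (x + s *\<^sub>R a)) (at s)"
      using box[of s 0] that h by (intro \<phi>a) simp
  qed
  obtain s where s: "0 < s" "s < h" "u h - u 0 = (h - 0) * (\<phi>a ((x + h *\<^sub>R b) + s *\<^sub>R a) - \<phi>a (x + s *\<^sub>R a))"
    using MVT2[OF h du] by blast
  have "\<exists>t>0. t < h \<and> \<phi>a ((x + s *\<^sub>R a) + h *\<^sub>R b) - \<phi>a ((x + s *\<^sub>R a) + 0 *\<^sub>R b)
      = (h - 0) * \<phi>ab ((x + s *\<^sub>R a) + t *\<^sub>R b)"
    using MVT2[OF h, of "\<lambda>t. \<phi>a ((x + s *\<^sub>R a) + t *\<^sub>R b)" "\<lambda>t. \<phi>ab ((x + s *\<^sub>R a) + t *\<^sub>R b)"] \<phi>ab box s by auto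
  then obtain t where t: "0 < t" "t < h"
    "\<phi>a ((x + s *\<^sub>R a) + h *\<^sub>R b) - \<phi>a (x + s *\<^sub>R a) = h * \<phi>ab ((x + s *\<^sub>R a) + t *\<^sub>R b)" by auto
  have "u h - u 0 = h * (h * \<phi>ab (x + s *\<^sub>R a + t *\<^sub>R b))"
    using s(3) t(3) by (simp add: ac_simps)
  moreover have "u h - u 0 = \<phi> (x + h *\<^sub>R a + h *\<^sub>R b) - \<phi> (x + h *\<^sub>R a) - \<phi> (x + h *\<^sub>R b) + \<phi> x"
    by (simp add: u_def ac_simps)
  ultimately show ?thesis using s t by (intro exI[of _ s] exI[of _ t]) auto
qed

text \<open>The second difference over a parallelogram is symmetric in \<open>a\<close> and
  \<open>b\<close>, and the mean value theorem expresses it by either mixed derivative at a nearby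
  point. Iterated partials are indexed by lists, but monomials see only multisets; this symmetry
  reconciles the two.\<close>

lemma mixed_partials_commute:
  fixes \<phi> :: "'a::real_normed_vector \<Rightarrow> real"
  assumes B: "open B" "x \<in> B"
    and \<phi>a: "\<And>y s. y + s *\<^sub>R a \<in> B \<Longrightarrow> ((\<lambda>s. \<phi> (y + s *\<^sub>R a)) has_real_derivative \<phi>a (y + s *\<^sub>R a)) (at s)"
    and \<phi>b: "\<And>y s. y + s *\<^sub>R b \<in> B \<Longrightarrow> ((\<lambda>s. \<phi> (y + s *\<^sub>R b)) has_real_derivative \<phi>b (y + s *\<^sub>R b)) (at s)"
    and \<phi>ab: "\<And>y s. y + s *\<^sub>R b \<in> B \<Longrightarrow> ((\<lambda>s. \<phi>a (y + s *\<^sub>R b)) has_real_derivative \<phi>ab (y + s *\<^sub>R b)) (at s)"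
    and \<phi>ba: "\<And>y s. y + s *\<^sub>R a \<in> B \<Longrightarrow> ((\<lambda>s. \<phi>b (y + s *\<^sub>R a)) has_real_derivative \<phi>ba (y + s *\<^sub>R a)) (at s)"
    and cont: "isCont \<phi>ab x" "isCont \<phi>ba x"
  shows "\<phi>ab x = \<phi>ba x"
proof (rule ccontr)
  assume "\<phi>ab x \<noteq> \<phi>ba x"
  define e where "e = \<bar>\<phi>ab x - \<phi>ba x\<bar> / 2"
  have e: "0 < e" using \<open>\<phi>ab x \<noteq> \<phi>ba x\<close> by (simp add: e_def)
  obtain d0 where d0: "0 < d0" "ball x d0 \<subseteq> B" using B by (meson open_contains_ball)
  obtain d1 where d1: "0 < d1" "\<And>y. dist y x < d1 \<Longrightarrow> dist (\<phi>ab y) (\<phi>ab x) < e"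
    using cont(1) e unfolding continuous_at_eps_delta by blast
  obtain d2 where d2: "0 < d2" "\<And>y. dist y x < d2 \<Longrightarrow> dist (\<phi>ba y) (\<phi>ba x) < e"
    using cont(2) e unfolding continuous_at_eps_delta by blast
  define d where "d = min d0 (min d1 d2)"
  define h where "h = d / (2 * (norm a + norm b + 1))"
  have d: "0 < d" using d0 d1 d2 by (simp add: d_def)
  have nab: "0 < norm a + norm b + 1" by (simp add: add_nonneg_pos)
  have h: "0 < h" using d nab by (simp add: h_def)
  have hd: "h * (norm a + norm b + 1) < d"
  proof -
    have "d / (2 * z) * z < d" if "0 < z" for z using d that by simp
    from this[OF nab] show ?thesis unfolding h_def .
  qed
  have near: "dist (x + s *\<^sub>R a + t *\<^sub>R b) x < d" if "0 \<le> s" "s \<le> h" "0 \<le> t" "t \<le> h" for s t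
  proof -
    have "dist (x + s *\<^sub>R a + t *\<^sub>R b) x = norm (s *\<^sub>R a + t *\<^sub>R b)" by (simp add: dist_norm)
    also have "\<dots> \<le> s * norm a + t * norm b"
      using norm_triangle_ineq[of "s *\<^sub>R a" "t *\<^sub>R b"] that by simp
    also have "\<dots> \<le> h * norm a + h * norm b" using that by (intro add_mono mult_right_mono) auto
    also have "\<dots> < d" using hd h by (simp add: algebra_simps)
    finally show ?thesis .
  qed
  have box: "x + s *\<^sub>R a + t *\<^sub>R b \<in> B" if "0 \<le> s" "s \<le> h" "0 \<le> t" "t \<le> h" for s t
    using near[OF that] d0(2) by (auto simp: d_def dist_commute)
  have box': "x + s *\<^sub>R b + t *\<^sub>R a \<in> B" if "0 \<le> s" "s \<le> h" "0 \<le> t" "t \<le> h" for s t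
    using box[of t s] that by (simp add: ac_simps)
  obtain s t where st: "0 \<le> s" "s \<le> h" "0 \<le> t" "t \<le> h"
    "\<phi> (x + h *\<^sub>R a + h *\<^sub>R b) - \<phi> (x + h *\<^sub>R a) - \<phi> (x + h *\<^sub>R b) + \<phi> x = h * (h * \<phi>ab (x + s *\<^sub>R a + t *\<^sub>R b))"
    using mixed_differences[OF h box \<phi>a \<phi>ab] by blast
  obtain s' t' where st': "0 \<le> s'" "s' \<le> h" "0 \<le> t'" "t' \<le> h"
    "\<phi> (x + h *\<^sub>R b + h *\<^sub>R a) - \<phi> (x + h *\<^sub>R b) - \<phi> (x + h *\<^sub>R a) + \<phi> x = h * (h * \<phi>ba (x + s' *\<^sub>R b + t' *\<^sub>R a))"
    using mixed_differences[OF h box' \<phi>b \<phi>ba] by blast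
  have "x + h *\<^sub>R b + h *\<^sub>R a = x + h *\<^sub>R a + h *\<^sub>R b" by (simp add: ac_simps)
  then have "h * (h * \<phi>ab (x + s *\<^sub>R a + t *\<^sub>R b)) = h * (h * \<phi>ba (x + s' *\<^sub>R b + t' *\<^sub>R a))"
    using st(5) st'(5) by (simp only: diff_right_commute)
  then have eq: "\<phi>ab (x + s *\<^sub>R a + t *\<^sub>R b) = \<phi>ba (x + s' *\<^sub>R b + t' *\<^sub>R a)" using h by simp
  have "dist (\<phi>ab (x + s *\<^sub>R a + t *\<^sub>R b)) (\<phi>ab x) < e"
    using near[OF st(1-4)] by (intro d1(2)) (simp add: d_def)
  moreover have "dist (\<phi>ba (x + s' *\<^sub>R b + t' *\<^sub>R a)) (\<phi>ba x) < e"
  proof (rule d2(2))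
    have "dist (x + t' *\<^sub>R a + s' *\<^sub>R b) x < d" using near st' by blast
    then show "dist (x + s' *\<^sub>R b + t' *\<^sub>R a) x < d2" by (simp add: d_def ac_simps)
  qed
  moreover have False if "\<bar>u - p\<bar> < \<bar>p - q\<bar> / 2" "\<bar>u - q\<bar> < \<bar>p - q\<bar> / 2" for u p q :: real
    using that by (auto simp: abs_if split: if_splits)
  ultimately show False unfolding eq e_def dist_real_def by blast
qed

lemma pderivs_line:
  fixes f :: "real^'d \<Rightarrow> real^'n"
  assumes "smooth_on U f" "y + s *\<^sub>R axis i 1 \<in> U"
  shows "((\<lambda>s. w \<bullet> pderivs is f (y + s *\<^sub>R axis i 1)) has_real_derivative
     w \<bullet> pderivs (i # is) f (y + s *\<^sub>R axis i 1)) (at s)"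
proof -
  have "((\<lambda>s. s *\<^sub>R axis i (1::real)) has_vector_derivative axis i 1) (at s)"
    by (auto intro!: derivative_eq_intros)
  from pderivs_curve[OF assms this, of "is"]
  have "((\<lambda>s. pderivs is f (y + s *\<^sub>R axis i 1)) has_vector_derivative
     (\<Sum>k\<in>UNIV. axis i 1 $ k *\<^sub>R pderivs (k # is) f (y + s *\<^sub>R axis i 1))) (at s)" .
  also have "(\<Sum>k\<in>UNIV. axis i 1 $ k *\<^sub>R pderivs (k # is) f (y + s *\<^sub>R axis i 1))
      = (\<Sum>k\<in>UNIV. if k = i then pderivs (i # is) f (y + s *\<^sub>R axis i 1) else 0)"
    by (intro sum.cong) (auto simp: axis_def)
  finally have "((\<lambda>s. pderivs is f (y + s *\<^sub>R axis i 1)) has_vector_derivative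
     pderivs (i # is) f (y + s *\<^sub>R axis i 1)) (at s)" by simp
  from bounded_linear.has_vector_derivative[OF bounded_linear_inner_right this, of w]
  show ?thesis by (simp add: has_real_derivative_iff_has_vector_derivative)
qed

lemma pderivs_swap:
  fixes f :: "real^'d \<Rightarrow> real^'n"
  assumes f: "smooth_on U f" and U: "open U" and x: "x \<in> U"
  shows "pderivs (i # j # is) f x = pderivs (j # i # is) f x"
proof -
  have c: "isCont (\<lambda>y. w \<bullet> pderivs js f y) x" for w js
    using pderivs_continuous_on[OF f, of js] x U
    by (intro continuous_intros) (simp add: continuous_on_eq_continuous_at)
  have "w \<bullet> pderivs (i # j # is) f x = w \<bullet> pderivs (j # i # is) f x" for w
    by (rule mixed_partials_commute[OF U x pderivs_line[OF f] pderivs_line[OF f] pderivs_line[OF f] pderivs_line[OF f] c c])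
  then show ?thesis using vector_eq_rdot by (metis inner_commute)
qed

lemma pderivs_Cons_cong:
  assumes U: "open U" and x: "x \<in> U" and eq: "\<And>y. y \<in> U \<Longrightarrow> pderivs is f y = pderivs js f y"
    and f: "smooth_on U f"
  shows "pderivs (i # is) f x = pderivs (i # js) f x"
proof -
  have "(pderivs js f has_derivative frechet_derivative (pderivs js f) (at x)) (at x)"
    using smooth_onD[OF f x] by (simp only: frechet_derivative_works)
  then have "(pderivs is f has_derivative frechet_derivative (pderivs js f) (at x)) (at x)"
    by (rule has_derivative_transform_within_open[OF _ U x]) (rule eq[symmetric])
  then have "frechet_derivative (pderivs js f) (at x) = frechet_derivative (pderivs is f) (at x)"
    by (rule frechet_derivative_at)
  then show ?thesis by (simp add: pderiv1_def)
qed

lemma pderivs_move: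
  assumes f: "smooth_on U f" and U: "open U"
  shows "x \<in> U \<Longrightarrow> pderivs (us @ i # vs) f x = pderivs (i # us @ vs) f x"
proof (induction us arbitrary: x)
  case (Cons u us)
  have "pderivs (u # us @ i # vs) f x = pderivs (u # i # us @ vs) f x"
    by (rule pderivs_Cons_cong[OF U Cons.prems _ f]) (rule Cons.IH)
  also have "\<dots> = pderivs (i # u # us @ vs) f x" by (rule pderivs_swap[OF f U Cons.prems])
  finally show ?case by simp
qed simp

lemma pderivs_mset_eq:
  assumes f: "smooth_on U f" and U: "open U"
  shows "mset is = mset js \<Longrightarrow> x \<in> U \<Longrightarrow> pderivs is f x = pderivs js f x"
proof (induction "is" arbitrary: js x)
  case Nil
  then show ?case by simp
next
  case (Cons i "is")
  then have "i \<in> set js" by (metis list.set_intros(1) set_mset_mset)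
  then obtain us vs where js: "js = us @ i # vs" by (meson split_list)
  then have "mset is = mset (us @ vs)" using Cons.prems(1) by simp
  then have "pderivs (i # is) f x = pderivs (i # us @ vs) f x"
    by (intro pderivs_Cons_cong[OF U Cons.prems(2) _ f] Cons.IH)
  also have "\<dots> = pderivs js f x"
    unfolding js by (rule pderivs_move[OF f U Cons.prems(2), symmetric])
  finally show ?case .
qed

section \<open>Exponents that separate monomials\<close>

lemma digits_unique:
  fixes f g :: "nat \<Rightarrow> nat"
  assumes "\<And>e. e < n \<Longrightarrow> f e < B" "\<And>e. e < n \<Longrightarrow> g e < B"
    and "(\<Sum>e<n. f e * B ^ e) = (\<Sum>e<n. g e * B ^ e)" "e < n"
  shows "f e = g e"
  using assms
proof (induction n arbitrary: f g e)
  case (Suc n)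
  have split: "(\<Sum>e<Suc n. h e * B ^ e) = h 0 + B * (\<Sum>e<n. h (Suc e) * B ^ e)" for h :: "nat \<Rightarrow> nat"
    by (simp add: sum.lessThan_Suc_shift sum_distrib_left mult_ac del: sum.lessThan_Suc)
  have eq: "f 0 + B * (\<Sum>e<n. f (Suc e) * B ^ e) = g 0 + B * (\<Sum>e<n. g (Suc e) * B ^ e)"
    using Suc.prems(3) by (simp only: split)
  have lt: "f 0 < B" "g 0 < B" using Suc.prems(1,2) by simp_all
  have "(f 0 + B * (\<Sum>e<n. f (Suc e) * B ^ e)) mod B = (g 0 + B * (\<Sum>e<n. g (Suc e) * B ^ e)) mod B"
    by (simp only: eq)
  then have 0: "f 0 = g 0" using lt by simp
  then have "(\<Sum>e<n. f (Suc e) * B ^ e) = (\<Sum>e<n. g (Suc e) * B ^ e)" using eq lt by simp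
  then have "f (Suc e) = g (Suc e)" if "e < n" for e
    using Suc.IH[of "\<lambda>e. f (Suc e)" "\<lambda>e. g (Suc e)" e] Suc.prems(1,2) that by simp
  then show ?case using 0 Suc.prems(4) by (cases e) auto
qed simp

text \<open>The leading term makes the lengths of index lists visible as the top digit in base \<open>k + 1\<close>;
  the lower digits are the multiplicities.\<close>

definition curve_exp :: "nat \<Rightarrow> 'd::finite \<Rightarrow> nat" where
  "curve_exp k i = (k + 1) ^ CARD('d) + (k + 1) ^ vidx i"

lemma curve_exp_sum:
  "sum_list (map (curve_exp k) is) =
    length is * (k + 1) ^ CARD('d) + (\<Sum>i\<in>UNIV. count (mset is) i * (k + 1) ^ vidx (i::'d::finite))"
proof (induction "is")
  case (Cons j "is")
  have "(\<Sum>i\<in>UNIV. count (mset (j # is)) i * (k + 1) ^ vidx i)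
      = (\<Sum>i\<in>UNIV. count (mset is) i * (k + 1) ^ vidx i + (if i = j then (k + 1) ^ vidx j else 0))"
    by (intro sum.cong) auto
  also have "\<dots> = (\<Sum>i\<in>UNIV. count (mset is) i * (k + 1) ^ vidx i) + (k + 1) ^ vidx j"
    by (simp add: sum.distrib)
  finally show ?case using Cons by (simp add: curve_exp_def)
qed simp

lemma curve_exp_inj:
  fixes "is" js :: "'d::finite list"
  assumes len: "length is \<le> k" "length js \<le> k"
    and eq: "sum_list (map (curve_exp k) is) = sum_list (map (curve_exp k) js)"
  shows "mset is = mset js"
proof (rule multiset_eqI)
  fix i :: 'd
  let ?d = "CARD('d)" and ?B = "k + 1"
  \<comment> \<open>The digit in position \<open>CARD('d)\<close> is the length, the lower ones are
    multiplicities; all are at most \<open>k\<close>, hence valid digits in base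
    \<open>k + 1\<close>.\<close>
  define dig where "dig ks e = (if e = ?d then length ks else count (mset ks) (inv vidx e))" for ks :: "'d list" and e
  have iv: "inv vidx (vidx i) = i" for i :: 'd by (simp add: inv_f_f inj_def)
  have "(\<Sum>e<Suc ?d. dig ks e * ?B ^ e) = sum_list (map (curve_exp k) ks)" for ks
  proof -
    have "(\<Sum>i\<in>UNIV. count (mset ks) (inv vidx (vidx i)) * ?B ^ vidx (i::'d)) = (\<Sum>e<?d. count (mset ks) (inv vidx e) * ?B ^ e)"
      by (rule sum.reindex_bij_betw[OF bij_vidx])
    moreover have "(\<Sum>e<?d. dig ks e * ?B ^ e) = (\<Sum>e<?d. count (mset ks) (inv vidx e) * ?B ^ e)"
      by (intro sum.cong) (auto simp: dig_def)
    ultimately show ?thesis by (simp add: curve_exp_sum iv dig_def)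
  qed
  then have "(\<Sum>e<Suc ?d. dig is e * ?B ^ e) = (\<Sum>e<Suc ?d. dig js e * ?B ^ e)" using eq by simp
  moreover have "dig ks e < ?B" if "length ks \<le> k" for ks e
    using that count_le_size[of "mset ks" "inv vidx e"] by (auto simp: dig_def)
  ultimately have "dig is (vidx i) = dig js (vidx i)"
    using len vidx_less[of i] by (intro digits_unique[of "Suc ?d" "dig is" ?B "dig js"]) auto
  then show "count (mset is) i = count (mset js) i" using vidx_less[of i] by (simp add: dig_def iv)
qed

text \<open>Lists of length \<open>k + 1\<close> reach this bound through their length digit alone,
  while those of length at most \<open>k\<close> stay strictly below it. The gap separates the
  Taylor polynomial of order \<open>k\<close> from its remainder along the curve.\<close>

lemma curve_exp_bound:
  fixes "is" :: "'d::finite list"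
  assumes "length is \<le> k"
  shows "sum_list (map (curve_exp k) is) < (k + 1) * (k + 1) ^ CARD('d)"
proof -
  let ?B = "k + 1" and ?d = "CARD('d)"
  have "curve_exp k i \<le> ?B ^ ?d + ?B ^ (?d - 1)" for i :: 'd
    using vidx_less[of i] unfolding curve_exp_def by (intro add_left_mono power_increasing) auto
  then have "sum_list (map (curve_exp k) is) \<le> length is * (?B ^ ?d + ?B ^ (?d - 1))"
    by (induction "is") (auto intro: add_mono)
  also have "\<dots> \<le> k * (?B ^ ?d + ?B ^ (?d - 1))" using assms by (rule mult_right_mono) simp
  also have "\<dots> < ?B * ?B ^ ?d"
  proof -
    have "?B ^ ?d = ?B * ?B ^ (?d - 1)" by (metis Suc_diff_1 power_Suc zero_less_card_finite)
    then have "k * ?B ^ (?d - 1) < ?B ^ ?d" by simp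
    then show ?thesis by (simp add: algebra_simps)
  qed
  finally show ?thesis .
qed

section \<open>Taylor expansion along the moment curve\<close>

definition mon :: "real^'d \<Rightarrow> 'd list \<Rightarrow> real" where
  "mon h is = prod_list (map (($) h) is)"

lemma mon_simps [simp]: "mon h [] = 1" "mon h (i # is) = h $ i * mon h is"
  by (simp_all add: mon_def)

lemma finite_lists_length: "finite {is :: 'd::finite list. length is = j}"
  using finite_lists_length_eq[of "UNIV :: 'd set" j] by simp

lemma sum_lists_Suc:
  fixes F :: "'d::finite list \<Rightarrow> 'a::comm_monoid_add"
  shows "(\<Sum>is\<in>{is. length is = Suc j}. F is) = (\<Sum>is\<in>{is. length is = j}. \<Sum>i\<in>UNIV. F (i # is))"
proof -
  have "(\<Sum>is\<in>{is. length is = Suc j}. F is) = (\<Sum>(is, i)\<in>{is. length is = j} \<times> UNIV. F (i # is))"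
    by (rule sum.reindex_bij_witness[of _ "\<lambda>(is, i). i # is" "\<lambda>is. (tl is, hd is)"])
      (auto simp: length_Suc_conv)
  also have "\<dots> = (\<Sum>is\<in>{is. length is = j}. \<Sum>i\<in>UNIV. F (i # is))"
    by (simp add: sum.cartesian_product)
  finally show ?thesis .
qed

text \<open>Summing over lists counts a mixed partial once for each ordering of its directions, so
  the multinomial factors are absorbed and only \<open>fact j\<close> remains.\<close>

lemma taylor_lists:
  fixes f :: "real^'d \<Rightarrow> real^'n"
  assumes f: "smooth_on U f" and seg: "\<And>s. 0 \<le> s \<Longrightarrow> s \<le> 1 \<Longrightarrow> x + s *\<^sub>R h \<in> U" and n: "0 < n"
  shows "\<exists>s. 0 \<le> s \<and> s \<le> 1 \<and> w \<bullet> f (x + h) =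
    (\<Sum>j<n. (\<Sum>is\<in>{is. length is = j}. mon h is * (w \<bullet> pderivs is f x)) / fact j) +
    (\<Sum>is\<in>{is. length is = n}. mon h is * (w \<bullet> pderivs is f (x + s *\<^sub>R h))) / fact n"
proof -
  define D where "D j s = (\<Sum>is\<in>{is. length is = j}. mon h is * (w \<bullet> pderivs is f (x + s *\<^sub>R h)))" for j and s :: real
  have "(D j has_real_derivative D (Suc j) s) (at s)" if "0 \<le> s" "s \<le> 1" for j s
  proof -
    have "((\<lambda>s. s *\<^sub>R h) has_vector_derivative h) (at s)" by (auto intro!: derivative_eq_intros)
    from pderivs_curve[OF f seg[OF that] this]
    have "((\<lambda>s. w \<bullet> pderivs is f (x + s *\<^sub>R h)) has_real_derivative
        w \<bullet> (\<Sum>i\<in>UNIV. h $ i *\<^sub>R pderivs (i # is) f (x + s *\<^sub>R h))) (at s)" for "is"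
      using bounded_linear.has_vector_derivative[OF bounded_linear_inner_right]
      unfolding has_real_derivative_iff_has_vector_derivative by blast
    then have "(D j has_real_derivative (\<Sum>is\<in>{is. length is = j}. mon h is *
        (w \<bullet> (\<Sum>i\<in>UNIV. h $ i *\<^sub>R pderivs (i # is) f (x + s *\<^sub>R h))))) (at s)"
      unfolding D_def by (intro DERIV_sum DERIV_cmult)
    also have "(\<Sum>is\<in>{is. length is = j}. mon h is *
        (w \<bullet> (\<Sum>i\<in>UNIV. h $ i *\<^sub>R pderivs (i # is) f (x + s *\<^sub>R h)))) = D (Suc j) s"
      unfolding D_def sum_lists_Suc by (simp add: inner_sum_right sum_distrib_left mult_ac)
    finally show ?thesis .
  qed
  note dD = this
  have "\<exists>s>0. s < 1 \<and> w \<bullet> f (x + 1 *\<^sub>R h) = (\<Sum>m<n. D m 0 / fact m * 1 ^ m) + D n s / fact n * 1 ^ n"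
  proof (rule Maclaurin[where f="\<lambda>s. w \<bullet> f (x + s *\<^sub>R h)" and h=1])
    show "D 0 = (\<lambda>s. w \<bullet> f (x + s *\<^sub>R h))" by (simp add: D_def fun_eq_iff)
    show "\<forall>m t. m < n \<and> 0 \<le> t \<and> t \<le> 1 \<longrightarrow> (D m has_real_derivative D (Suc m) t) (at t)"
      using dD by blast
  qed (use n in auto)
  then obtain s where "0 < s" "s < 1" "w \<bullet> f (x + h) = (\<Sum>m<n. D m 0 / fact m) + D n s / fact n" by auto
  then show ?thesis unfolding D_def by (intro exI[of _ s]) simp
qed

definition pcurve :: "('d::finite \<Rightarrow> real poly) \<Rightarrow> real \<Rightarrow> real^'d" where
  "pcurve g t = (\<chi> i. poly (g i) t)"

text \<open>The \<open>j\<close>-th derivative of \<open>poly P t *\<^sub>R pderivs is f (x + pcurve g t)\<close> with respect to \<open>t\<close>.\<close>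

primrec curve_deriv :: "(real^'d \<Rightarrow> real^'n) \<Rightarrow> ('d::finite \<Rightarrow> real poly) \<Rightarrow> nat \<Rightarrow> real poly \<Rightarrow> 'd list \<Rightarrow>
    real^'d \<Rightarrow> real \<Rightarrow> real^'n" where
  "curve_deriv f g 0 = (\<lambda>P is x t. poly P t *\<^sub>R pderivs is f (x + pcurve g t))"
| "curve_deriv f g (Suc j) = (\<lambda>P is x t. curve_deriv f g j (pderiv P) is x t +
     (\<Sum>i\<in>UNIV. curve_deriv f g j (P * pderiv (g i)) (i # is) x t))"

lemma pcurve_has_vector_derivative:
  "(pcurve g has_vector_derivative (\<chi> i. poly (pderiv (g i)) t)) (at t)"
proof -
  have "((\<lambda>t. \<Sum>i\<in>UNIV. poly (g i) t *\<^sub>R axis i (1::real)) has_vector_derivative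
      (\<Sum>i\<in>UNIV. poly (g i) t *\<^sub>R 0 + poly (pderiv (g i)) t *\<^sub>R axis i 1)) (at t)"
    by (intro has_vector_derivative_sum has_vector_derivative_scaleR poly_DERIV has_vector_derivative_const)
  moreover have "(\<Sum>i\<in>UNIV. c i *\<^sub>R axis i 1) = (\<chi> i. c i)" for c :: "'a \<Rightarrow> real"
    using basis_expansion[of "\<chi> i. c i"] by (simp add: scalar_mult_eq_scaleR)
  ultimately show ?thesis by (simp add: pcurve_def[abs_def])
qed

lemma curve_deriv_has_vector_derivative:
  assumes f: "smooth_on U f" and x: "x + pcurve g t \<in> U"
  shows "(curve_deriv f g j P is x has_vector_derivative curve_deriv f g (Suc j) P is x t) (at t)"
proof (induction j arbitrary: P "is")
  case 0
  let ?F = "\<lambda>is t. pderivs is f (x + pcurve g t)"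
  have "((\<lambda>t. poly P t *\<^sub>R ?F is t) has_vector_derivative
      poly P t *\<^sub>R (\<Sum>i\<in>UNIV. (\<chi> i. poly (pderiv (g i)) t) $ i *\<^sub>R ?F (i # is) t) + poly (pderiv P) t *\<^sub>R ?F is t) (at t)"
    by (rule has_vector_derivative_scaleR[OF poly_DERIV pderivs_curve[OF f x pcurve_has_vector_derivative]])
  then show ?case by (simp add: scaleR_sum_right add.commute)
next
  case (Suc j)
  have "((\<lambda>t. curve_deriv f g j (pderiv P) is x t + (\<Sum>i\<in>UNIV. curve_deriv f g j (P * pderiv (g i)) (i # is) x t))
      has_vector_derivative curve_deriv f g (Suc j) (pderiv P) is x t +
        (\<Sum>i\<in>UNIV. curve_deriv f g (Suc j) (P * pderiv (g i)) (i # is) x t)) (at t)"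
    by (intro has_vector_derivative_add has_vector_derivative_sum Suc.IH)
  then show ?case by simp
qed

lemma continuous_on_pcurve: "continuous_on A (\<lambda>z. pcurve g (snd z))"
  unfolding pcurve_def by (intro continuous_intros)

lemma curve_deriv_continuous_on:
  assumes f: "smooth_on U f"
  shows "continuous_on {z. fst z + pcurve g (snd z) \<in> U} (\<lambda>z. curve_deriv f g j P is (fst z) (snd z))"
proof (induction j arbitrary: P "is")
  case 0
  have "continuous_on {z. fst z + pcurve g (snd z) \<in> U} (\<lambda>z. pderivs is f (fst z + pcurve g (snd z)))"
    by (rule continuous_on_compose2[OF pderivs_continuous_on[OF f]])
      (auto intro!: continuous_intros continuous_on_pcurve)
  then show ?case by (auto intro!: continuous_intros)
next
  case (Suc j)
  then show ?case by (simp only: curve_deriv.simps) (intro continuous_on_add continuous_on_sum Suc.IH)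
qed

text \<open>The bound asks for vanishing at 0 to an order above the degree. Once the exact power of
  \<open>t\<close> is divided out, the quotient would be nonzero at 0 and yet tend to 0 from the
  right.\<close>

lemma poly_flat_zero:
  fixes p :: "real poly"
  assumes t0: "0 < t0" and flat: "\<And>t. 0 < t \<Longrightarrow> t < t0 \<Longrightarrow> \<bar>poly p t\<bar> \<le> C * t ^ L" and deg: "degree p < L"
  shows "p = 0"
proof (rule ccontr)
  assume p: "p \<noteq> 0"
  obtain q where q: "p = [:- 0, 1:] ^ order 0 p * q" "\<not> [:- 0, 1:] dvd q"
    using order_decomp[OF p, of 0] by blast
  let ?o = "order 0 p"
  have "?o \<le> degree p" using p by (rule order_degree)
  then have o: "?o < L" using deg by linarith
  have pq: "poly p t = t ^ ?o * poly q t" for t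
  proof -
    have "poly p t = poly ([:- 0, 1:] ^ ?o * q) t" using q(1) by (rule arg_cong)
    then show ?thesis by (simp add: poly_power)
  qed
  have q0: "poly q 0 \<noteq> 0" using q(2) by (simp add: poly_eq_0_iff_dvd)
  have bound: "\<bar>poly q t\<bar> \<le> C * t ^ (L - ?o)" if t: "0 < t" "t < t0" for t
  proof -
    have "t ^ ?o * \<bar>poly q t\<bar> \<le> C * t ^ L" using flat[OF t] t by (simp add: pq abs_mult)
    also have "\<dots> = t ^ ?o * (C * t ^ (L - ?o))" using o by (simp add: power_add[symmetric])
    finally show ?thesis using t by simp
  qed
  have "((\<lambda>t. \<bar>poly q t\<bar>) \<longlongrightarrow> \<bar>poly q 0\<bar>) (at_right 0)"
    by (intro tendsto_intros)
  moreover have "((\<lambda>t. C * t ^ (L - ?o)) \<longlongrightarrow> C * 0 ^ (L - ?o)) (at_right (0::real))"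
    by (intro tendsto_intros)
  moreover have "\<forall>\<^sub>F t in at_right 0. \<bar>poly q t\<bar> \<le> C * t ^ (L - ?o)"
    using bound t0 unfolding eventually_at_right_field by blast
  ultimately have "\<bar>poly q 0\<bar> \<le> C * 0 ^ (L - ?o)"
    by (intro tendsto_le[of "at_right (0::real)"]) auto
  then show False using q0 o by (simp add: power_0_left)
qed

definition moment_curve :: "nat \<Rightarrow> 'd::finite \<Rightarrow> real poly" where
  "moment_curve k i = monom 1 (curve_exp k i)"

lemma pcurve_moment: "pcurve (moment_curve k) t = (\<chi> i. t ^ curve_exp k i)"
  by (simp add: pcurve_def moment_curve_def poly_monom)

lemma mon_moment: "mon (pcurve (moment_curve k) t) is = t ^ sum_list (map (curve_exp k) is)"
  by (induction "is") (simp_all add: pcurve_moment power_add)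

lemma curve_exp_ge: "(k + 1) ^ CARD('d) \<le> curve_exp k (i :: 'd::finite)" "1 \<le> curve_exp k i"
proof -
  show "(k + 1) ^ CARD('d) \<le> curve_exp k i" by (simp add: curve_exp_def)
  have "1 \<le> (k + 1) ^ CARD('d)" by (rule one_le_power) simp
  then show "1 \<le> curve_exp k i" unfolding curve_exp_def by linarith
qed

lemma pcurve_moment_0: "pcurve (moment_curve k) 0 = 0"
proof -
  have "0 < curve_exp k i" for i :: 'a using curve_exp_ge(2)[of k i] by simp
  then show ?thesis by (simp add: pcurve_moment vec_eq_iff)
qed

lemma norm_moment_le:
  assumes "0 \<le> t" "t \<le> 1"
  shows "norm (pcurve (moment_curve k) t :: real^'d::finite) \<le> real CARD('d) * t"
proof -
  have "norm (pcurve (moment_curve k) t :: real^'d) \<le> (\<Sum>i\<in>UNIV. \<bar>(pcurve (moment_curve k) t :: real^'d) $ i\<bar>)"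
    by (rule norm_le_l1_cart)
  also have "\<dots> \<le> (\<Sum>i\<in>(UNIV::'d set). t)"
  proof (rule sum_mono)
    fix i :: 'd
    have "t ^ curve_exp k i \<le> t ^ 1" using assms curve_exp_ge(2) by (intro power_decreasing) auto
    then show "\<bar>(pcurve (moment_curve k) t :: real^'d) $ i\<bar> \<le> t" using assms by (simp add: pcurve_moment)
  qed
  finally show ?thesis by simp
qed

text \<open>If \<open>w\<close> annihilated all these derivatives, \<open>w \<bullet> f\<close>
  along the curve would be constant up to an error of order \<open>t ^ ?L\<close>. By Taylor it is a
  constant plus a polynomial \<open>p\<close> of degree below \<open>?L\<close>, up to such an
  error, so \<open>p\<close> vanishes. But essentially different monomials receive different powers
  of \<open>t\<close>, and the coefficient belonging to \<open>is0\<close> is a positive multiple of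
  \<open>w \<bullet> pderivs is0 f x0\<close>.\<close>

lemma curve_nondegenerate:
  fixes f :: "real^'d::finite \<Rightarrow> real^'n"
  assumes f: "smooth_on U f" and U: "open U" and x0: "x0 \<in> U"
    and is0: "1 \<le> length is0" "length is0 \<le> k" "w \<bullet> pderivs is0 f x0 \<noteq> 0"
  shows "\<exists>j\<in>{1..(k + 1) * (k + 1) ^ CARD('d)}. w \<bullet> curve_deriv f (moment_curve k) j 1 [] x0 0 \<noteq> 0"
proof (rule ccontr)
  let ?L = "(k + 1) * (k + 1) ^ CARD('d)" and ?g = "moment_curve k :: 'd \<Rightarrow> real poly"
  let ?N = "\<lambda>is :: 'd list. sum_list (map (curve_exp k) is)"
  define c where "c is = w \<bullet> pderivs is f x0" for "is"
  assume "\<not> ?thesis"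
  then have flat0: "w \<bullet> curve_deriv f ?g j 1 [] x0 0 = 0" if "1 \<le> j" "j \<le> ?L" for j using that by auto
  have Lpos: "0 < ?L" by simp
  obtain \<rho> where \<rho>: "0 < \<rho>" "cball x0 \<rho> \<subseteq> U" using U x0 by (meson open_contains_cball)
  define t0 where "t0 = min 1 (\<rho> / real CARD('d))"
  have t0: "0 < t0" "t0 \<le> 1" "real CARD('d) * t0 \<le> \<rho>" using \<rho> by (auto simp: t0_def min_def field_simps)
  have small: "norm (pcurve ?g t) \<le> \<rho>" if "0 \<le> t" "t \<le> t0" for t
  proof -
    have "norm (pcurve ?g t) \<le> real CARD('d) * t" using that t0 by (intro norm_moment_le) auto
    also have "\<dots> \<le> real CARD('d) * t0" using that by (intro mult_left_mono) auto
    finally show ?thesis using t0 by linarith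
  qed
  have seg: "x0 + s *\<^sub>R pcurve ?g t \<in> cball x0 \<rho>" if "0 \<le> t" "t \<le> t0" "0 \<le> s" "s \<le> 1" for s t
  proof -
    have "s * norm (pcurve ?g t) \<le> 1 * norm (pcurve ?g t)" using that by (intro mult_right_mono) auto
    then show ?thesis using small[OF that(1,2)] that by (simp add: dist_norm)
  qed
  have "\<exists>B. \<forall>y\<in>cball x0 \<rho>. \<bar>w \<bullet> pderivs is f y\<bar> \<le> B" for "is"
  proof -
    have "continuous_on (cball x0 \<rho>) (\<lambda>y. w \<bullet> pderivs is f y)"
      by (intro continuous_intros continuous_on_subset[OF pderivs_continuous_on[OF f] \<rho>(2)])
    then have "bounded ((\<lambda>y. w \<bullet> pderivs is f y) ` cball x0 \<rho>)"
      by (intro compact_imp_bounded compact_continuous_image) auto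
    then show ?thesis by (auto simp: bounded_iff)
  qed
  then obtain B where B: "\<And>is y. y \<in> cball x0 \<rho> \<Longrightarrow> \<bar>w \<bullet> pderivs is f y\<bar> \<le> B is" by metis
  define B1 where "B1 = (\<Sum>is\<in>{is. length is = k + 1}. B is)"
  define D where "D j t = w \<bullet> curve_deriv f ?g j 1 [] x0 t" for j t
  have dD: "(D j has_real_derivative D (Suc j) t) (at t)" if "0 \<le> t" "t \<le> t0" for j t
  proof -
    have "x0 + pcurve ?g t \<in> U" using seg[OF that, of 1] \<rho>(2) by auto
    from bounded_linear.has_vector_derivative[OF bounded_linear_inner_right curve_deriv_has_vector_derivative[OF f this]]
    show ?thesis unfolding D_def[abs_def] has_real_derivative_iff_has_vector_derivative .
  qed
  have D0: "D 0 t = w \<bullet> f (x0 + pcurve ?g t)" for t by (simp add: D_def)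
  have g0: "pcurve ?g 0 = 0" by (rule pcurve_moment_0)
  have "continuous_on {0..t0} (D ?L)"
    using dD by (intro continuous_at_imp_continuous_on ballI) (auto intro: DERIV_isCont)
  then have "bounded (D ?L ` {0..t0})" by (intro compact_imp_bounded compact_continuous_image) auto
  then obtain B2 where "\<forall>y\<in>D ?L ` {0..t0}. norm y \<le> B2" unfolding bounded_iff by blast
  then have B2: "\<bar>D ?L t\<bar> \<le> B2" if "0 \<le> t" "t \<le> t0" for t
    using that by (simp only: ball_simps real_norm_def atLeastAtMost_iff)
  define p where "p = (\<Sum>j\<in>{1..k}. \<Sum>is\<in>{is. length is = j}. monom (c is / fact j) (?N is))"
  have pt: "poly p t = (\<Sum>j\<in>{1..k}. \<Sum>is\<in>{is. length is = j}. c is / fact j * t ^ ?N is)" for t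
    by (simp add: p_def poly_sum poly_monom)
  have bound: "\<bar>poly p t\<bar> \<le> (B1 + B2) * t ^ ?L" if t: "0 < t" "t < t0" for t
  proof -
    have "\<exists>s. 0 \<le> s \<and> s \<le> 1 \<and> w \<bullet> f (x0 + pcurve ?g t) =
      (\<Sum>j<k + 1. (\<Sum>is\<in>{is. length is = j}. mon (pcurve ?g t) is * (w \<bullet> pderivs is f x0)) / fact j) +
      (\<Sum>is\<in>{is. length is = k + 1}. mon (pcurve ?g t) is * (w \<bullet> pderivs is f (x0 + s *\<^sub>R pcurve ?g t))) / fact (k + 1)"
      by (rule taylor_lists[OF f]) (use seg[of t] t \<rho>(2) in auto)
    then obtain s where s: "0 \<le> s" "s \<le> 1" and ty: "D 0 t =
      (\<Sum>j<k + 1. (\<Sum>is\<in>{is. length is = j}. t ^ ?N is * c is) / fact j) +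
      (\<Sum>is\<in>{is. length is = k + 1}. t ^ ?N is * (w \<bullet> pderivs is f (x0 + s *\<^sub>R pcurve ?g t))) / fact (k + 1)"
      unfolding mon_moment D0 c_def by blast
    define R where "R = (\<Sum>is\<in>{is. length is = k + 1}. t ^ ?N is * (w \<bullet> pderivs is f (x0 + s *\<^sub>R pcurve ?g t))) / fact (k + 1)"
    have "(\<Sum>j<k + 1. (\<Sum>is\<in>{is. length is = j}. t ^ ?N is * c is) / fact j) = D 0 0 + poly p t"
    proof -
      have "{..<k + 1} = insert 0 {1..k}" by auto
      then show ?thesis by (simp add: pt D0 g0 c_def sum_divide_distrib mult.commute)
    qed
    then have eq: "poly p t = D 0 t - D 0 0 - R" using ty by (simp add: R_def)
    have "\<bar>R\<bar> \<le> B1 * t ^ ?L"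
    proof -
      have "\<bar>R\<bar> \<le> \<bar>\<Sum>is\<in>{is. length is = k + 1}. t ^ ?N is * (w \<bullet> pderivs is f (x0 + s *\<^sub>R pcurve ?g t))\<bar> / 1"
        unfolding R_def abs_divide using fact_ge_1[of "k + 1", where ?'a=real] by (intro divide_left_mono) auto
      also have "\<dots> \<le> (\<Sum>is\<in>{is. length is = k + 1}. t ^ ?L * B is)"
        unfolding div_by_1
      proof (rule order_trans[OF sum_abs sum_mono])
        fix "is" :: "'d list" assume l: "is \<in> {is. length is = k + 1}"
        have "length is * (k + 1) ^ CARD('d) \<le> ?N is" by (simp add: curve_exp_sum)
        then have "?L \<le> ?N is" using l by simp
        then have "t ^ ?N is \<le> t ^ ?L" using t t0 by (intro power_decreasing) auto
        moreover have "\<bar>w \<bullet> pderivs is f (x0 + s *\<^sub>R pcurve ?g t)\<bar> \<le> B is"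
          using t s by (intro B seg) auto
        ultimately show "\<bar>t ^ ?N is * (w \<bullet> pderivs is f (x0 + s *\<^sub>R pcurve ?g t))\<bar> \<le> t ^ ?L * B is"
          using t unfolding abs_mult by (intro mult_mono) auto
      qed
      also have "\<dots> = B1 * t ^ ?L"
        by (simp only: B1_def sum_distrib_right mult.commute[of "t ^ ?L"])
      finally show ?thesis .
    qed
    moreover have "\<bar>D 0 t - D 0 0\<bar> \<le> B2 * t ^ ?L"
    proof -
      have "\<exists>s>0. s < t \<and> D 0 t = (\<Sum>m<?L. D m 0 / fact m * t ^ m) + D ?L s / fact ?L * t ^ ?L"
        by (rule Maclaurin) (use dD t Lpos in auto)
      then obtain s where s: "0 < s" "s < t" "D 0 t = (\<Sum>m<?L. D m 0 / fact m * t ^ m) + D ?L s / fact ?L * t ^ ?L"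
        by blast
      have "(\<Sum>m<?L. D m 0 / fact m * t ^ m) = (\<Sum>m<?L. if m = 0 then D 0 0 else 0)"
        using flat0 by (intro sum.cong) (auto simp: D_def)
      also have "\<dots> = D 0 0" using Lpos by simp
      finally have "\<bar>D 0 t - D 0 0\<bar> = \<bar>D ?L s\<bar> / fact ?L * t ^ ?L" using s(3) t by (simp add: abs_mult)
      also have "\<dots> \<le> \<bar>D ?L s\<bar> / 1 * t ^ ?L"
        using t fact_ge_1[of ?L, where ?'a=real] by (intro mult_right_mono divide_left_mono) auto
      also have "\<dots> \<le> B2 * t ^ ?L" using B2[of s] s t by (intro mult_right_mono) auto
      finally show ?thesis .
    qed
    ultimately show ?thesis unfolding eq by (simp add: distrib_right)
  qed
  have "degree p \<le> ?L - 1"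
    unfolding p_def
  proof (intro degree_sum_le finite_lists_length)
    fix j and "is" :: "'d list" assume "j \<in> {1..k}" "is \<in> {is. length is = j}"
    then have "?N is < ?L" by (intro curve_exp_bound) auto
    then show "degree (monom (c is / fact j) (?N is)) \<le> ?L - 1"
      using degree_monom_le[of "c is / fact j" "?N is"] by linarith
  qed auto
  then have "degree p < ?L" using Lpos by linarith
  then have p0: "p = 0" using bound t0(1) by (intro poly_flat_zero[of t0 p "B1 + B2" ?L])
  \<comment> \<open>Lists with the exponent of \<open>is0\<close> are its rearrangements; they have
    the same length and, by symmetry, the same derivative, so their contributions add up without
    cancellation.\<close>
  have cf: "(if ?N is = ?N is0 then c is / fact j else 0) = (c is0 / fact (length is0)) * (if ?N is = ?N is0 then 1 else 0)"
    if "j \<in> {1..k}" "is \<in> {is. length is = j}" for "is" j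
  proof (cases "?N is = ?N is0")
    case True
    then have m: "mset is = mset is0" using that is0 by (intro curve_exp_inj) auto
    then have "length is = length is0" by (metis size_mset)
    moreover have "c is = c is0" unfolding c_def using pderivs_mset_eq[OF f U m x0] by simp
    ultimately show ?thesis using that by simp
  qed simp
  have "coeff p (?N is0) = (\<Sum>j\<in>{1..k}. \<Sum>is\<in>{is. length is = j}. (if ?N is = ?N is0 then c is / fact j else 0))"
    by (simp add: p_def coeff_sum)
  also have "\<dots> = (\<Sum>j\<in>{1..k}. \<Sum>is\<in>{is. length is = j}. (c is0 / fact (length is0)) * (if ?N is = ?N is0 then 1 else 0))"
    by (intro sum.cong refl cf)
  also have "\<dots> = (c is0 / fact (length is0)) * (\<Sum>j\<in>{1..k}. \<Sum>is\<in>{is. length is = j}. (if ?N is = ?N is0 then 1 else 0))"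
    by (simp only: sum_distrib_left)
  finally have "(c is0 / fact (length is0)) * (\<Sum>j\<in>{1..k}. \<Sum>is\<in>{is. length is = j}. (if ?N is = ?N is0 then 1 else (0::real))) = 0"
    using p0 by simp
  then have "(\<Sum>j\<in>{1..k}. \<Sum>is\<in>{is. length is = j}. (if ?N is = ?N is0 then 1 else (0::real))) = 0"
    using is0(3) by (simp add: c_def)
  moreover have "1 \<le> (\<Sum>j\<in>{1..k}. \<Sum>is\<in>{is. length is = j}. (if ?N is = ?N is0 then 1 else (0::real)))"
  proof -
    define e where "e is = (if ?N is = ?N is0 then 1 else (0::real))" for "is"
    have e0: "0 \<le> e is" for "is" by (simp add: e_def)
    have "1 = e is0" by (simp add: e_def)
    also have "\<dots> \<le> (\<Sum>is\<in>{is. length is = length is0}. e is)"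
      by (rule member_le_sum) (use e0 finite_lists_length in auto)
    also have "\<dots> \<le> (\<Sum>j\<in>{1..k}. \<Sum>is\<in>{is. length is = j}. e is)"
      by (rule member_le_sum[of "length is0" "{1..k}" "\<lambda>j. \<Sum>is\<in>{is. length is = j}. e is"])
        (use e0 is0 in \<open>auto intro: sum_nonneg\<close>)
    finally show ?thesis by (simp only: e_def)
  qed
  ultimately show False by linarith
qed

section \<open>Fubini along curves and charts\<close>

text \<open>On the compact unit sphere of \<open>V\<close> the sum of the
  \<open>\<bar>u j \<bullet> w\<bar>\<close> has a positive lower bound, and some summand is at
  least the average.\<close>

lemma uniform_nondegeneracy:
  fixes u :: "nat \<Rightarrow> 'a::euclidean_space"
  assumes V: "subspace V" and J: "finite J" "J \<noteq> {}" and nz: "\<And>w. w \<in> V \<Longrightarrow> w \<noteq> 0 \<Longrightarrow> \<exists>j\<in>J. u j \<bullet> w \<noteq> 0"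
  shows "\<exists>\<kappa>>0. \<forall>w\<in>V. \<exists>j\<in>J. \<kappa> * norm w \<le> \<bar>u j \<bullet> w\<bar>"
proof -
  define S where "S = V \<inter> sphere 0 1"
  define F where "F w = (\<Sum>j\<in>J. \<bar>u j \<bullet> w\<bar>)" for w
  have "compact S" unfolding S_def using closed_subspace[OF V] by (intro closed_Int_compact) auto
  have Fpos: "0 < F w" if "w \<in> S" for w
  proof -
    have "w \<in> V" "w \<noteq> 0" using that by (auto simp: S_def)
    then obtain j where j: "j \<in> J" "u j \<bullet> w \<noteq> 0" using nz by blast
    then have "0 < \<bar>u j \<bullet> w\<bar>" by simp
    also have "\<dots> \<le> F w" unfolding F_def using J(1) j(1) by (intro member_le_sum) auto
    finally show ?thesis .
  qed
  have "\<exists>m>0. \<forall>w\<in>S. m \<le> F w"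
  proof (cases "S = {}")
    case True
    then show ?thesis by (intro exI[of _ 1]) auto
  next
    case False
    have "continuous_on S F" unfolding F_def by (intro continuous_intros)
    then obtain w0 where "w0 \<in> S" "\<forall>w\<in>S. F w0 \<le> F w"
      using continuous_attains_inf[OF \<open>compact S\<close> False] by blast
    then show ?thesis using Fpos by blast
  qed
  then obtain m where m: "0 < m" "\<And>w. w \<in> S \<Longrightarrow> m \<le> F w" by blast
  have cJ: "0 < real (card J)" using J by (simp add: card_gt_0_iff)
  define \<kappa> where "\<kappa> = m / real (card J)"
  have \<kappa>: "0 < \<kappa>" using m cJ by (simp add: \<kappa>_def)
  have "\<exists>j\<in>J. \<kappa> * norm w \<le> \<bar>u j \<bullet> w\<bar>" if w: "w \<in> V" for w
  proof (cases "w = 0")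
    case True
    then show ?thesis using J by auto
  next
    case False
    let ?w = "(1 / norm w) *\<^sub>R w"
    have "?w \<in> S" using w False subspace_scale[OF V] by (simp add: S_def)
    then have mF: "m \<le> F ?w" by (rule m(2))
    have "\<exists>j\<in>J. \<kappa> \<le> \<bar>u j \<bullet> ?w\<bar>"
    proof (rule ccontr)
      assume "\<not> ?thesis"
      then have "F ?w < (\<Sum>j\<in>J. \<kappa>)" unfolding F_def using J by (intro sum_strict_mono) auto
      also have "\<dots> = m" using cJ by (simp add: \<kappa>_def)
      finally show False using mF by simp
    qed
    then obtain j where j: "j \<in> J" "\<kappa> \<le> \<bar>u j \<bullet> ?w\<bar>" by blast
    have "\<bar>u j \<bullet> ?w\<bar> = \<bar>u j \<bullet> w\<bar> / norm w" by (simp add: abs_mult)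
    then have "\<kappa> * norm w \<le> \<bar>u j \<bullet> w\<bar>" using j(2) False by (simp add: pos_le_divide_eq)
    then show ?thesis using j(1) by blast
  qed
  then show ?thesis using \<kappa> by blast
qed

text \<open>Bounded sets of integer vectors are finite, so infinitely many solutions means solutions
  of arbitrarily large norm. This form shows a countable intersection of countable unions and so
  gives measurability.\<close>

lemma approximable_iff_unbounded:
  "approximable v y \<longleftrightarrow> (\<forall>N::nat. \<exists>q\<in>{q. int_vec q \<and> real N < norm q}. \<exists>p::int. \<bar>y \<bullet> q + of_int p\<bar> < norm q powr (- v))"
    (is "_ \<longleftrightarrow> ?R")
proof
  let ?S = "{q. int_vec q \<and> (\<exists>p::int. \<bar>y \<bullet> q + of_int p\<bar> < norm q powr (- v))}"
  show "?R" if "approximable v y"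
  proof (rule ccontr)
    assume "\<not> ?R"
    then obtain N :: nat where N: "\<not> (\<exists>q\<in>{q. int_vec q \<and> real N < norm q}. \<exists>p::int. \<bar>y \<bullet> q + of_int p\<bar> < norm q powr (- v))"
      by blast
    have "?S \<subseteq> {q. int_vec q \<and> norm q \<le> real N}"
    proof clarify
      fix q and p :: int assume "int_vec q" "\<bar>y \<bullet> q + of_int p\<bar> < norm q powr (- v)"
      then have "\<not> real N < norm q" using N by blast
      then show "norm q \<le> real N" by simp
    qed
    then have "finite ?S" using finite_int_vecs finite_subset by blast
    then show False using that by (simp add: approximable_def)
  qed
  show "approximable v y" if R: ?R
    unfolding approximable_def
  proof
    assume "finite ?S"
    then have "bounded ?S" by (rule finite_imp_bounded)
    then obtain B where B: "\<And>q. q \<in> ?S \<Longrightarrow> norm q \<le> B" by (auto simp: bounded_iff)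
    obtain N :: nat where "B < real N" using reals_Archimedean2 by blast
    moreover obtain q where "q \<in> ?S" "real N < norm q" using R[rule_format, of N] by auto
    ultimately show False using B[of q] by linarith
  qed
qed

lemma countable_int_vecs: "countable {q :: real^'n. int_vec q \<and> P q}"
proof (rule countable_subset)
  show "{q :: real^'n. int_vec q \<and> P q} \<subseteq> (\<Union>n::nat. {q. int_vec q \<and> norm q \<le> real n})"
    using real_arch_simple by auto
  show "countable (\<Union>n::nat. {q :: real^'n. int_vec q \<and> norm q \<le> real n})"
    by (rule countable_UN[OF countableI_type countable_finite[OF finite_int_vecs]])
qed

lemma approximable_borel:
  fixes f :: "'a::topological_space \<Rightarrow> real^'n"
  assumes "open U" "continuous_on U f"
  shows "{x \<in> U. approximable v (f x)} \<in> sets borel"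
proof -
  have "{x \<in> U. approximable v (f x)} = U \<inter> (\<Inter>N::nat. \<Union>q\<in>{q. int_vec q \<and> real N < norm q}. \<Union>p::int.
      {x \<in> U. \<bar>f x \<bullet> q + of_int p\<bar> < norm q powr (- v)})"
    unfolding approximable_iff_unbounded by blast
  moreover have B: "{x \<in> U. \<bar>f x \<bullet> q + of_int p\<bar> < norm q powr (- v)} \<in> sets borel" for q and p :: int
  proof -
    have "continuous_on U (\<lambda>x. \<bar>f x \<bullet> q + of_int p\<bar>)" by (intro continuous_intros assms(2))
    then have "open (U \<inter> (\<lambda>x. \<bar>f x \<bullet> q + of_int p\<bar>) -` {..<norm q powr (- v)})"
      using assms(1) by (intro continuous_open_preimage) auto
    moreover have "U \<inter> (\<lambda>x. \<bar>f x \<bullet> q + of_int p\<bar>) -` {..<norm q powr (- v)}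
        = {x \<in> U. \<bar>f x \<bullet> q + of_int p\<bar> < norm q powr (- v)}" by auto
    ultimately show ?thesis by (metis borel_open)
  qed
  then have "(\<Union>q\<in>{q. int_vec q \<and> real N < norm q}. \<Union>p::int.
      {x \<in> U. \<bar>f x \<bullet> q + of_int p\<bar> < norm q powr (- v)}) \<in> sets borel" for N :: nat
    by (intro sets.countable_UN'' countable_int_vecs countableI_type)
  then have "(\<Inter>N::nat. \<Union>q\<in>{q. int_vec q \<and> real N < norm q}. \<Union>p::int.
      {x \<in> U. \<bar>f x \<bullet> q + of_int p\<bar> < norm q powr (- v)}) \<in> sets borel"
    by (intro sets.countable_INT'') auto
  ultimately show ?thesis using sets.Int[OF borel_open[OF assms(1)]] by (simp only:)
qed

text \<open>Translating along the curve instead of straightening it avoids a change of variables in the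
  Fubini argument.\<close>

lemma negligible_along_curve:
  fixes A :: "(real^'d) set" and \<gamma> :: "real \<Rightarrow> real^'d"
  assumes A: "A \<in> sets borel" and \<gamma>: "continuous_on UNIV \<gamma>" "\<gamma> 0 = 0" and pos: "0 < e" "0 < r"
    and null: "\<And>x. x \<in> ball x0 e \<Longrightarrow> negligible {t \<in> cball 0 r. x + \<gamma> t \<in> A}"
  shows "negligible (A \<inter> ball x0 (e / 2))"
proof -
  define E where "E = (ball x0 e \<times> cball 0 r) \<inter> (\<lambda>z. fst z + \<gamma> (snd z)) -` A"
  have m: "(\<lambda>z. fst z + \<gamma> (snd z)) \<in> borel_measurable borel"
  proof (rule borel_measurable_continuous_onI)
    have "continuous_on UNIV (\<lambda>z :: (real^'d) \<times> real. \<gamma> (snd z))"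
      by (rule continuous_on_compose2[OF \<gamma>(1)]) (auto intro!: continuous_intros)
    then show "continuous_on UNIV (\<lambda>z :: (real^'d) \<times> real. fst z + \<gamma> (snd z))" by (intro continuous_intros)
  qed
  have "ball x0 e \<times> cball (0::real) r \<in> sets borel" by (intro borel_Times) auto
  moreover have "(\<lambda>z. fst z + \<gamma> (snd z)) -` A \<in> sets borel" using measurable_sets[OF m A] by simp
  ultimately have "E \<in> sets borel" unfolding E_def by (rule sets.Int)
  then have E: "E \<in> sets (lborel \<Otimes>\<^sub>M lborel)" unfolding lborel_prod sets_lborel .
  have "emeasure lborel (Pair x -` E) = 0" for x
  proof -
    have sec: "Pair x -` E \<in> sets lborel" using sets_Pair1[OF E] .
    have "negligible (Pair x -` E)"
    proof (cases "x \<in> ball x0 e")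
      case True
      have "Pair x -` E \<subseteq> {t \<in> cball 0 r. x + \<gamma> t \<in> A}" by (auto simp: E_def)
      then show ?thesis using null[OF True] negligible_subset by blast
    next
      case False
      then have "Pair x -` E = {}" by (auto simp: E_def)
      then show ?thesis by simp
    qed
    then show ?thesis using sec by (simp add: negligible_iff_emeasure0 emeasure_completion)
  qed
  then have "emeasure (lborel \<Otimes>\<^sub>M lborel) E = 0"
    using lborel.emeasure_pair_measure_alt[OF E] by simp
  then have "(\<integral>\<^sup>+ t. emeasure lborel ((\<lambda>x. (x, t)) -` E) \<partial>lborel) = 0"
    using lborel_pair.emeasure_pair_measure_alt2[OF E] by simp
  then have ae: "AE t in lborel. emeasure lborel ((\<lambda>x. (x, t)) -` E) = 0"
    using nn_integral_0_iff_AE lborel_pair.measurable_emeasure_Pair2[OF E] by blast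
  have "isCont \<gamma> 0" using \<gamma>(1) by (simp add: continuous_on_eq_continuous_at)
  then obtain d where d: "0 < d" "\<And>t. dist t 0 < d \<Longrightarrow> dist (\<gamma> t) (\<gamma> 0) < e / 2"
    using pos unfolding continuous_at_eps_delta by (metis half_gt_zero)
  define s where "s = min d r"
  have s: "0 < s" using d pos by (simp add: s_def)
  \<comment> \<open>Almost every \<open>t\<close> has a null slice, so one exists before the curve
    has moved by \<open>e / 2\<close>; that slice, translated by \<open>\<gamma> t\<close>, covers
    the part of \<open>A\<close> in the half ball.\<close>
  obtain t where t: "t \<in> {0<..<s}" "emeasure lborel ((\<lambda>x. (x, t)) -` E) = 0"
  proof (rule ccontr)
    assume "\<not> thesis"
    then have "\<And>t. t \<in> {0<..<s} \<Longrightarrow> emeasure lborel ((\<lambda>x. (x, t)) -` E) \<noteq> 0" using that by blast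
    then have "AE t in lborel. t \<notin> {0<..<s}" using ae by (auto elim: eventually_mono)
    then have "{0<..<s} \<in> null_sets lborel" by (subst AE_iff_null_sets) auto
    then show False using s by (auto simp: null_sets_def)
  qed
  have "negligible ((\<lambda>x. (x, t)) -` E)"
    using t(2) sets_Pair2[OF E, of t] by (simp add: negligible_iff_emeasure0 emeasure_completion)
  then have n: "negligible ((+) (\<gamma> t) ` ((\<lambda>x. (x, t)) -` E))" by (rule negligible_translation)
  have "A \<inter> ball x0 (e / 2) \<subseteq> (+) (\<gamma> t) ` ((\<lambda>x. (x, t)) -` E)"
  proof
    fix y assume y: "y \<in> A \<inter> ball x0 (e / 2)"
    have "norm (\<gamma> t) < e / 2" using d(2)[of t] t(1) \<gamma>(2) by (simp add: s_def)
    moreover have "dist x0 (y - \<gamma> t) \<le> dist x0 y + norm (\<gamma> t)"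
      using dist_triangle[of x0 "y - \<gamma> t" y] by (simp add: dist_norm)
    ultimately have "y - \<gamma> t \<in> ball x0 e" using y by simp
    then have "y - \<gamma> t \<in> (\<lambda>x. (x, t)) -` E" using y t(1) by (auto simp: E_def s_def)
    then show "y \<in> (+) (\<gamma> t) ` ((\<lambda>x. (x, t)) -` E)" by (intro image_eqI[of _ _ "y - \<gamma> t"]) auto
  qed
  then show ?thesis using n negligible_subset by blast
qed

lemma lin_part_eq:
  assumes "affine L" "a \<in> L"
  shows "lin_part L = (\<lambda>x. x - a) ` L" "subspace (lin_part L)"
proof -
  have sub: "subspace ((\<lambda>x. x - a) ` L)"
    using affine_diffs_subspace_subtract[OF assms] by simp
  show eq: "lin_part L = (\<lambda>x. x - a) ` L"
  proof
    show "(\<lambda>x. x - a) ` L \<subseteq> lin_part L" using assms(2) by (auto simp: lin_part_def)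
    show "lin_part L \<subseteq> (\<lambda>x. x - a) ` L"
    proof
      fix z assume "z \<in> lin_part L"
      then obtain x y where "x \<in> L" "y \<in> L" "z = x - y" by (auto simp: lin_part_def)
      then have "z = (x - a) - (y - a)" "x - a \<in> (\<lambda>x. x - a) ` L" "y - a \<in> (\<lambda>x. x - a) ` L" by auto
      then show "z \<in> (\<lambda>x. x - a) ` L" using subspace_diff[OF sub] by metis
    qed
  qed
  show "subspace (lin_part L)" using sub eq by simp
qed

text \<open>Nondegeneracy at \<open>x0\<close> gives a uniform lower bound for the derivatives of
  \<open>f\<close> along the moment curve through \<open>x0\<close>. Continuity keeps half of it for
  the translated curves through all \<open>x\<close> near \<open>x0\<close>. These share one
  interval of parameters and one set of constants, so each of them meets the approximable set in a
  null set of parameters, as Fubini requires.\<close>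

lemma approximable_locally_null:
  fixes f :: "real^'d::finite \<Rightarrow> real^'n::finite"
  assumes L: "affine L" and U: "open U" and f: "smooth_on U f" and x0: "x0 \<in> U" and nd: "nondeg_at L f U x0"
    and y0: "y0 \<in> L" and v: "0 < v" "v < v'" and d: "0 < d" "d \<le> 1"
    and dio: "\<And>q (p::int). int_vec q \<Longrightarrow> q \<noteq> 0 \<Longrightarrow> d * norm q powr (- v) \<le> \<bar>y0 \<bullet> q + of_int p\<bar>"
  shows "\<exists>r>0. ball x0 r \<subseteq> U \<and> negligible {x \<in> ball x0 r. approximable v' (f x)}"
proof -
  obtain k where fL: "f ` U \<subseteq> L" and sp: "span {pderivs is f x0 | is. 1 \<le> length is \<and> length is \<le> k} = lin_part L"
    using nd by (auto simp: nondeg_at_def)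
  define V where "V = lin_part L"
  have V: "subspace V" unfolding V_def using lin_part_eq[OF L y0] by simp
  let ?g = "moment_curve k :: 'd \<Rightarrow> real poly" and ?K = "(k + 1) * (k + 1) ^ CARD('d)"
  define F where "F j x t = curve_deriv f ?g j 1 [] x t" for j x t
  have "0 < ?K" by simp
  then have K1: "1 \<le> ?K" by linarith
  have nz: "\<exists>j\<in>{1..?K}. F j x0 0 \<bullet> w \<noteq> 0" if w: "w \<in> V" "w \<noteq> 0" for w
  proof -
    let ?D = "{pderivs is f x0 | is. 1 \<le> length is \<and> length is \<le> k}"
    have "\<exists>is. 1 \<le> length is \<and> length is \<le> k \<and> w \<bullet> pderivs is f x0 \<noteq> 0"
    proof (rule ccontr)
      assume "\<not> ?thesis"
      then have "?D \<subseteq> {y. w \<bullet> y = 0}" by auto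
      then have "span ?D \<subseteq> {y. w \<bullet> y = 0}" by (rule span_minimal[OF _ subspace_hyperplane])
      then have "w \<bullet> w = 0" using w(1) sp unfolding V_def by blast
      then show False using w(2) by simp
    qed
    then obtain "is" where "1 \<le> length is" "length is \<le> k" "w \<bullet> pderivs is f x0 \<noteq> 0" by blast
    from curve_nondegenerate[OF f U x0 this] show ?thesis by (simp add: F_def inner_commute)
  qed
  obtain \<kappa>0 where \<kappa>0: "0 < \<kappa>0" "\<And>w. w \<in> V \<Longrightarrow> \<exists>j\<in>{1..?K}. \<kappa>0 * norm w \<le> \<bar>F j x0 0 \<bullet> w\<bar>"
    using uniform_nondegeneracy[OF V _ _ nz] K1 by auto
  \<comment> \<open>Half of \<open>\<kappa>0\<close> is reserved for the change of the derivatives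
    between \<open>(x0, 0)\<close> and nearby \<open>(x, t)\<close>.\<close>
  define \<kappa> where "\<kappa> = \<kappa>0 / 2"
  have \<kappa>: "0 < \<kappa>" using \<kappa>0 by (simp add: \<kappa>_def)
  define S where "S = (\<Sum>j\<in>{1..?K}. norm (F j x0 0))"
  \<comment> \<open>Chosen so that \<open>\<Lambda> * \<kappa> = \<kappa> + S\<close>, which bounds
    the derivatives from above after this change.\<close>
  define \<Lambda> where "\<Lambda> = 1 + S / \<kappa>"
  have \<Lambda>: "1 \<le> \<Lambda>" using \<kappa> by (simp add: \<Lambda>_def S_def sum_nonneg)
  let ?O = "{z. fst z + pcurve ?g (snd z) \<in> U}"
  have "open ?O"
  proof -
    have "continuous_on UNIV (\<lambda>z. fst z + pcurve ?g (snd z))" by (intro continuous_intros continuous_on_pcurve)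
    then have "open ((\<lambda>z. fst z + pcurve ?g (snd z)) -` U)" using U by (rule open_vimage[rotated])
    then show ?thesis by (simp add: vimage_def)
  qed
  have z0: "(x0, 0) \<in> ?O" using x0 by (simp add: pcurve_moment_0)
  have "\<forall>\<^sub>F z in nhds (x0, 0). z \<in> ?O \<and> (\<forall>j\<in>{1..?K}. dist (F j (fst z) (snd z)) (F j x0 0) < \<kappa>)"
  proof (intro eventually_conj eventually_ball_finite ballI)
    show "\<forall>\<^sub>F z in nhds (x0, 0). z \<in> ?O" using \<open>open ?O\<close> z0 by (rule eventually_nhds_in_open)
    fix j
    have "isCont (\<lambda>z. F j (fst z) (snd z)) (x0, 0)"
      using curve_deriv_continuous_on[OF f, of ?g j 1 "[]"] \<open>open ?O\<close> z0
      unfolding F_def by (simp add: continuous_on_eq_continuous_at)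
    then show "\<forall>\<^sub>F z in nhds (x0, 0). dist (F j (fst z) (snd z)) (F j x0 0) < \<kappa>"
      using \<kappa> unfolding continuous_at_eps_delta eventually_nhds_metric by simp
  qed simp
  then obtain e0 where e0: "0 < e0" "\<And>z. dist z (x0, 0) < e0 \<Longrightarrow> z \<in> ?O \<and> (\<forall>j\<in>{1..?K}. dist (F j (fst z) (snd z)) (F j x0 0) < \<kappa>)"
    unfolding eventually_nhds_metric by blast
  define e where "e = e0 / 2"
  have e: "0 < e" using e0 by (simp add: e_def)
  have near: "x + pcurve ?g t \<in> U" "\<And>j. j \<in> {1..?K} \<Longrightarrow> norm (F j x t - F j x0 0) \<le> \<kappa>"
    if "x \<in> ball x0 e" "t \<in> cball 0 (e / 2)" for x t
  proof -
    have "dist (x, t) (x0, 0) \<le> dist x x0 + dist t 0"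
      by (metis dist_Pair_Pair real_sqrt_sum_squares_triangle_ineq add.right_neutral add.left_neutral sqrt_sum_squares_le_sum zero_le_dist)
    also have "\<dots> < e + e" using that e by (intro add_strict_mono) (auto simp: dist_commute)
    finally have "dist (x, t) (x0, 0) < e0" by (simp add: e_def)
    from e0(2)[OF this] show "x + pcurve ?g t \<in> U" "\<And>j. j \<in> {1..?K} \<Longrightarrow> norm (F j x t - F j x0 0) \<le> \<kappa>"
      by (auto simp: dist_norm less_imp_le)
  qed
  define r where "r = (e / 2) / 11 ^ Suc CARD('n coord)"
  have r: "0 < r" using e by (simp add: r_def)
  have rI: "cball (0::real) (11 ^ Suc CARD('n coord) * r) \<subseteq> cball 0 (e / 2)" by (simp add: r_def)
  define A where "A = {x \<in> U. approximable v' (f x)}"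
  have null: "negligible {t \<in> cball 0 r. x + pcurve ?g t \<in> A}" if x: "x \<in> ball x0 e" for x
  proof -
    have inL: "F 0 x t \<in> L" if "t \<in> cball 0 (e / 2)" for t
      using near(1)[OF x that] fL by (auto simp: F_def)
    interpret nondegenerate_curve "\<lambda>j. F j x" ?K "cball 0 (e / 2)" V \<kappa> \<Lambda>
    proof
      show "(F j x has_vector_derivative F (Suc j) x t) (at t)" if "t \<in> cball 0 (e / 2)" for j t
        unfolding F_def by (rule curve_deriv_has_vector_derivative[OF f near(1)[OF x that]])
      show "F 0 x t - F 0 x t' \<in> V" if "t \<in> cball 0 (e / 2)" "t' \<in> cball 0 (e / 2)" for t t'
        using inL[OF that(1)] inL[OF that(2)] by (auto simp: V_def lin_part_def)
      fix w assume w: "w \<in> V"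
      obtain j where j: "j \<in> {1..?K}" "\<kappa>0 * norm w \<le> \<bar>F j x0 0 \<bullet> w\<bar>" using \<kappa>0(2)[OF w] by blast
      have "\<kappa> * norm w \<le> \<bar>F j x t \<bullet> w\<bar> \<and> \<bar>F j x t \<bullet> w\<bar> \<le> \<Lambda> * (\<kappa> * norm w)" if t: "t \<in> cball 0 (e / 2)" for t
      proof -
        have "F j x t \<bullet> w = F j x0 0 \<bullet> w + (F j x t - F j x0 0) \<bullet> w" by (simp add: inner_diff_left)
        moreover have "\<bar>(F j x t - F j x0 0) \<bullet> w\<bar> \<le> \<kappa> * norm w"
          using Cauchy_Schwarz_ineq2[of "F j x t - F j x0 0" w] near(2)[OF x t j(1)]
          by (meson mult_right_mono norm_ge_zero order_trans)
        moreover have "\<bar>F j x0 0 \<bullet> w\<bar> \<le> S * norm w"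
        proof -
          have "norm (F j x0 0) \<le> S" unfolding S_def using j(1) by (intro member_le_sum) auto
          then show ?thesis using Cauchy_Schwarz_ineq2[of "F j x0 0" w]
            by (meson mult_right_mono norm_ge_zero order_trans)
        qed
        moreover have "\<Lambda> * (\<kappa> * norm w) = \<kappa> * norm w + S * norm w" using \<kappa> by (simp add: \<Lambda>_def distrib_right)
        moreover have "\<kappa>0 * norm w = \<kappa> * norm w + \<kappa> * norm w" by (simp add: \<kappa>_def)
        ultimately show ?thesis using j(2) by linarith
      qed
      then show "\<exists>j\<in>{1..?K}. \<forall>t\<in>cball 0 (e / 2). \<kappa> * norm w \<le> \<bar>F j x t \<bullet> w\<bar> \<and> \<bar>F j x t \<bullet> w\<bar> \<le> \<Lambda> * (\<kappa> * norm w)"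
        using j(1) by blast
    qed (use V \<kappa> \<Lambda> K1 in auto)
    have "(0::real) \<in> cball 0 (e / 2)" using e by simp
    from inL[OF this] have "y0 - F 0 x 0 \<in> V" using y0 unfolding V_def lin_part_def by blast
    from approximable_null[OF r rI this v d dio]
    have n: "negligible {t \<in> cball 0 r. approximable v' (F 0 x t)}" .
    have "{t \<in> cball 0 r. x + pcurve ?g t \<in> A} \<subseteq> {t \<in> cball 0 r. approximable v' (F 0 x t)}"
      by (auto simp: A_def F_def)
    then show ?thesis using n negligible_subset by blast
  qed
  have "A \<in> sets borel" unfolding A_def
    using pderivs_continuous_on[OF f, of "[]"] by (intro approximable_borel U) simp
  moreover have "continuous_on UNIV (pcurve ?g)" unfolding pcurve_def[abs_def] by (intro continuous_intros)
  ultimately have neg: "negligible (A \<inter> ball x0 (e / 2))"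
    using pcurve_moment_0 e r null by (rule negligible_along_curve)
  obtain r0 where r0: "0 < r0" "ball x0 r0 \<subseteq> U" using U x0 by (meson open_contains_ball)
  have "{x \<in> ball x0 (min r0 (e / 2)). approximable v' (f x)} \<subseteq> A \<inter> ball x0 (e / 2)"
    using r0(2) by (auto simp: A_def)
  then have "negligible {x \<in> ball x0 (min r0 (e / 2)). approximable v' (f x)}"
    using neg negligible_subset by blast
  moreover have "0 < min r0 (e / 2)" "ball x0 (min r0 (e / 2)) \<subseteq> U" using r0 e by auto
  ultimately show ?thesis by blast
qed

text \<open>The chart witnessing nondegeneracy at a point may differ from the one in which null sets
  are tested. The transition is locally Lipschitz: near a point an injective derivative bounds
  \<open>f\<close> from below, and differentiability bounds \<open>f'\<close> from above. Locally
  Lipschitz maps between spaces of equal dimension preserve negligibility.\<close>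

lemma chart_transition_negligible:
  fixes f f' :: "real^'d::finite \<Rightarrow> real^'n"
  assumes f: "is_chart U f M" and f': "is_chart U' f' M" and Z: "negligible Z" "Z \<subseteq> U'"
  shows "negligible {x \<in> U. f x \<in> f' ` Z}"
proof -
  have U: "open U" "smooth_on U f" and U': "open U'" "smooth_on U' f'" using f f' by (auto simp: is_chart_def)
  obtain g where g: "homeomorphism U (f ` U) f g" using f by (auto simp: is_chart_def)
  define Z' where "Z' = {z \<in> Z. f' z \<in> f ` U}"
  define \<tau> where "\<tau> z = g (f' z)" for z
  have \<tau>: "\<tau> z \<in> U" "f (\<tau> z) = f' z" if "z \<in> Z'" for z
    using that homeomorphism_apply1[OF g] homeomorphism_apply2[OF g] homeomorphism_image2[OF g]
    by (auto simp: Z'_def \<tau>_def)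
  have "negligible Z'" using Z(1) by (rule negligible_subset) (auto simp: Z'_def)
  then have "negligible (\<tau> ` Z')"
  proof (rule negligible_locally_Lipschitz_image[OF order_refl])
    fix z assume z: "z \<in> Z'"
    then have zU': "z \<in> U'" using Z(2) by (auto simp: Z'_def)
    let ?x = "\<tau> z"
    let ?D = "frechet_derivative f (at ?x)" and ?D' = "frechet_derivative f' (at z)"
    have D: "(f has_derivative ?D) (at ?x)"
      using smooth_onD[OF U(2) \<tau>(1)[OF z], of "[]"] by (simp add: frechet_derivative_works)
    have D': "(f' has_derivative ?D') (at z)"
      using smooth_onD[OF U'(2) zU', of "[]"] by (simp add: frechet_derivative_works)
    have "inj ?D" using f \<tau>(1)[OF z] by (auto simp: is_chart_def)
    then obtain c where c: "0 < c" "\<And>h. c * norm h \<le> norm (?D h)"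
      using linear_inj_bounded_below_pos[OF has_derivative_linear[OF D]] by (metis mult.commute)
    obtain \<delta> where \<delta>: "0 < \<delta>" "\<And>y. norm (y - ?x) < \<delta> \<Longrightarrow> norm (f y - f ?x - ?D (y - ?x)) \<le> c / 2 * norm (y - ?x)"
      using D c(1) unfolding has_derivative_at_alt by (metis half_gt_zero)
    have below: "c / 2 * norm (y - ?x) \<le> norm (f y - f ?x)" if "norm (y - ?x) < \<delta>" for y
    proof -
      have "norm (?D (y - ?x)) \<le> norm (f y - f ?x) + norm (f y - f ?x - ?D (y - ?x))"
        by (metis norm_minus_commute norm_triangle_sub)
      then show ?thesis using \<delta>(2)[OF that] c(2)[of "y - ?x"] by linarith
    qed
    obtain B0 where B0: "\<And>h. norm (?D' h) \<le> B0 * norm h"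
      using bounded_linear.bounded[OF has_derivative_bounded_linear[OF D']] by (metis mult.commute)
    obtain \<delta>' where \<delta>': "0 < \<delta>'" "\<And>y. norm (y - z) < \<delta>' \<Longrightarrow> norm (f' y - f' z - ?D' (y - z)) \<le> 1 * norm (y - z)"
      using D' unfolding has_derivative_at_alt by (metis zero_less_one)
    have above: "norm (f' y - f' z) \<le> (B0 + 1) * norm (y - z)" if "norm (y - z) < \<delta>'" for y
    proof -
      have "norm (f' y - f' z) \<le> norm (?D' (y - z)) + norm (f' y - f' z - ?D' (y - z))"
        by (metis norm_triangle_sub)
      then show ?thesis using \<delta>'(2)[OF that] B0[of "y - z"] by (simp add: distrib_right)
    qed
    \<comment> \<open>The lower bound for \<open>f\<close> holds only near \<open>?x\<close>;
      continuity of the inverse chart keeps \<open>\<tau> y\<close> there.\<close>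
    have "continuous_on Z' \<tau>"
      unfolding \<tau>_def
    proof (rule continuous_on_compose2[OF homeomorphism_cont2[OF g]])
      show "continuous_on Z' f'"
        using pderivs_continuous_on[OF U'(2), of "[]"] Z(2)
        by (auto intro: continuous_on_subset simp: Z'_def)
    qed (auto simp: Z'_def)
    then obtain d where d: "0 < d" "\<And>y. y \<in> Z' \<Longrightarrow> dist y z < d \<Longrightarrow> dist (\<tau> y) ?x < \<delta>"
      using z \<delta>(1) unfolding continuous_on_iff by metis
    show "\<exists>T B. open T \<and> z \<in> T \<and> (\<forall>y\<in>Z' \<inter> T. norm (\<tau> y - \<tau> z) \<le> B * norm (y - z))"
    proof (intro exI[of _ "ball z (min d \<delta>')"] exI[of _ "2 / c * (B0 + 1)"] conjI ballI)
      fix y assume y: "y \<in> Z' \<inter> ball z (min d \<delta>')"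
      then have "norm (\<tau> y - ?x) < \<delta>" using d(2)[of y] by (simp add: dist_commute dist_norm)
      then have "c / 2 * norm (\<tau> y - ?x) \<le> norm (f (\<tau> y) - f ?x)" by (rule below)
      also have "\<dots> = norm (f' y - f' z)" using \<tau>(2) y z by simp
      also have "\<dots> \<le> (B0 + 1) * norm (y - z)" using y by (intro above) (simp add: dist_norm norm_minus_commute)
      finally show "norm (\<tau> y - \<tau> z) \<le> 2 / c * (B0 + 1) * norm (y - z)"
        using c(1) by (simp add: field_simps)
    qed (use d \<delta>' in auto)
  qed
  moreover have "{x \<in> U. f x \<in> f' ` Z} \<subseteq> \<tau> ` Z'"
  proof
    fix x assume "x \<in> {x \<in> U. f x \<in> f' ` Z}"
    then obtain z where z: "x \<in> U" "z \<in> Z" "f x = f' z" by auto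
    then have "\<tau> z = x" using homeomorphism_apply1[OF g] by (metis \<tau>_def)
    moreover have "z \<in> Z'" using z by (auto simp: Z'_def intro: image_eqI[of _ f x])
    ultimately show "x \<in> \<tau> ` Z'" by blast
  qed
  ultimately show ?thesis by (rule negligible_subset)
qed

text \<open>The degenerate points are null by assumption. Near each other approximable point, the
  local result in its own chart is carried over to the given chart, and negligibility is a local
  property.\<close>

lemma null_in_approximable:
  fixes L M :: "(real^'n::finite) set"
  assumes L: "affine L" and nd: "mfd_nondeg TYPE('d::finite) L M"
    and y0: "y0 \<in> L" and v: "0 < v" "v < v'" and d: "0 < d" "d \<le> 1"
    and dio: "\<And>q (p::int). int_vec q \<Longrightarrow> q \<noteq> 0 \<Longrightarrow> d * norm q powr (- v) \<le> \<bar>y0 \<bullet> q + of_int p\<bar>"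
  shows "null_in TYPE('d) M {y \<in> M. approximable v' y}"
  unfolding null_in_def
proof (intro allI impI)
  fix U :: "(real^'d) set" and f
  assume f: "is_chart U f M"
  let ?N = "{y \<in> M. \<not> mfd_nondeg_at TYPE('d) L M y}"
  have U: "open U" "f ` U \<subseteq> M" "continuous_on U f"
    using f pderivs_continuous_on[of U f "[]"] by (auto simp: is_chart_def)
  have N: "negligible (f -` ?N \<inter> U)"
    using nd f by (auto simp: mfd_nondeg_def null_in_def negligible_iff_null_sets)
  define S where "S = {x \<in> U. approximable v' (f x) \<and> mfd_nondeg_at TYPE('d) L M (f x)}"
  have "negligible S"
    unfolding locally_negligible_alt[of S]
  proof
    fix x assume x: "x \<in> S"
    then obtain U' :: "(real^'d) set" and f' x' where f': "is_chart U' f' M" "x' \<in> U'" "f' x' = f x" "nondeg_at L f' U' x'"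
      by (auto simp: S_def mfd_nondeg_at_def)
    have U': "open U'" "smooth_on U' f'" "openin (top_of_set M) (f' ` U')" using f'(1) by (auto simp: is_chart_def)
    obtain r where r: "0 < r" "ball x' r \<subseteq> U'" "negligible {z \<in> ball x' r. approximable v' (f' z)}"
      using approximable_locally_null[OF L U'(1,2) f'(2,4) y0 v d dio] by blast
    obtain g' where g': "homeomorphism U' (f' ` U') f' g'" using f'(1) by (auto simp: is_chart_def)
    have "openin (top_of_set U') (ball x' r)" using r(2) by (simp add: openin_open_eq[OF U'(1)])
    then have "openin (top_of_set (f' ` U')) (f' ` ball x' r)" by (rule homeomorphism_imp_open_map[OF g'])
    then have "openin (top_of_set M) (f' ` ball x' r)" using U'(3) by (rule openin_trans)
    then have "openin (top_of_set U) (U \<inter> f -` (f' ` ball x' r))"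
      by (rule continuous_openin_preimage[OF U(3), rotated]) (use U(2) in blast)
    then have O: "open (U \<inter> f -` (f' ` ball x' r))" using U(1) openin_open_eq by blast
    define Q where "Q = S \<inter> (U \<inter> f -` (f' ` ball x' r))"
    have "openin (top_of_set S) Q" unfolding Q_def using O by (rule openin_open_Int)
    moreover have "x \<in> Q" using x f'(3) r(1) by (auto simp: Q_def S_def intro!: image_eqI[of _ f' x'])
    moreover have "negligible Q"
    proof (rule negligible_subset[OF chart_transition_negligible[OF f f'(1) r(3)]])
      show "Q \<subseteq> {x \<in> U. f x \<in> f' ` {z \<in> ball x' r. approximable v' (f' z)}}"
      proof
        fix y assume y: "y \<in> Q"
        then obtain z where "z \<in> ball x' r" "f y = f' z" by (auto simp: Q_def)
        then show "y \<in> {x \<in> U. f x \<in> f' ` {z \<in> ball x' r. approximable v' (f' z)}}"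
          using y by (auto simp: Q_def S_def)
      qed
    qed (use r(2) in auto)
    ultimately show "\<exists>Q. openin (top_of_set S) Q \<and> x \<in> Q \<and> negligible Q" by blast
  qed
  then have "negligible (S \<union> (f -` ?N \<inter> U))" using N by (rule negligible_Un)
  moreover have "f -` {y \<in> M. approximable v' y} \<inter> U \<subseteq> S \<union> (f -` ?N \<inter> U)" by (auto simp: S_def)
  ultimately have "negligible (f -` {y \<in> M. approximable v' y} \<inter> U)" by (rule negligible_subset)
  then show "f -` {y \<in> M. approximable v' y} \<inter> U \<in> null_sets lebesgue" by (simp add: negligible_iff_null_sets)
qed

section \<open>Elementary facts about the exponent of a point\<close>

lemma int_vec_norm_ge_1:
  assumes "int_vec q" "q \<noteq> 0"
  shows "1 \<le> norm q"
proof -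
  obtain i where i: "q $ i \<noteq> 0" using assms(2) by (auto simp: vec_eq_iff)
  have "1 \<le> \<bar>q $ i\<bar>" using assms(1) i by (simp add: int_vec_def Ints_nonzero_abs_ge1)
  then show ?thesis using component_le_norm_cart[of q i] by linarith
qed

lemma approximable_mono:
  assumes "approximable v y" "v' \<le> v"
  shows "approximable v' y"
  unfolding approximable_def
proof
  assume "finite {q. int_vec q \<and> (\<exists>p::int. \<bar>y \<bullet> q + of_int p\<bar> < norm q powr (- v'))}"
  moreover have "{q. int_vec q \<and> (\<exists>p::int. \<bar>y \<bullet> q + of_int p\<bar> < norm q powr (- v))}
      \<subseteq> {q. int_vec q \<and> (\<exists>p::int. \<bar>y \<bullet> q + of_int p\<bar> < norm q powr (- v'))}"
  proof
    fix q assume "q \<in> {q. int_vec q \<and> (\<exists>p::int. \<bar>y \<bullet> q + of_int p\<bar> < norm q powr (- v))}"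
    then obtain p :: int where q: "int_vec q" "\<bar>y \<bullet> q + of_int p\<bar> < norm q powr (- v)" by blast
    \<comment> \<open>\<open>0 powr (- v)\<close> is 0, so the strict inequality excludes
      \<open>q = 0\<close>.\<close>
    then have "q \<noteq> 0" by auto
    then have "norm q powr (- v) \<le> norm q powr (- v')"
      using int_vec_norm_ge_1[OF q(1)] assms(2) by (intro powr_mono) auto
    then have "\<bar>y \<bullet> q + of_int p\<bar> < norm q powr (- v')" using q(2) by linarith
    then show "q \<in> {q. int_vec q \<and> (\<exists>p::int. \<bar>y \<bullet> q + of_int p\<bar> < norm q powr (- v'))}" using q(1) by blast
  qed
  ultimately have "finite {q. int_vec q \<and> (\<exists>p::int. \<bar>y \<bullet> q + of_int p\<bar> < norm q powr (- v))}"
    by (rule finite_subset[rotated])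
  then show False using assms(1) by (simp add: approximable_def)
qed

lemma dio_exp_eq: "dio_exp y = Sup {ereal v | v. v > 0 \<and> approximable v y}"
  unfolding dio_exp_def approximable_def ..

lemma distance_to_integers:
  fixes b :: real
  assumes "\<And>p::int. b + of_int p \<noteq> 0"
  shows "\<exists>e>0. \<forall>p::int. e \<le> \<bar>b + of_int p\<bar>"
proof -
  have "b \<notin> \<int>" using assms by (metis Ints_cases add.left_inverse add.commute of_int_minus)
  then have f: "0 < frac b" "frac b < 1" by (simp_all add: frac_gt_0_iff frac_lt_1)
  define e where "e = min (frac b) (1 - frac b)"
  have "e \<le> \<bar>b + of_int p\<bar>" for p :: int
  proof -
    have eq: "b + of_int p = frac b + of_int (\<lfloor>b\<rfloor> + p)" by (simp add: frac_def)
    show ?thesis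
    proof (cases "0 \<le> \<lfloor>b\<rfloor> + p")
      case True
      then have "(0::real) \<le> of_int (\<lfloor>b\<rfloor> + p)" by (simp only: of_int_0_le_iff)
      then show ?thesis unfolding eq e_def using f by linarith
    next
      case False
      then have "\<lfloor>b\<rfloor> + p \<le> - 1" by linarith
      then have "of_int (\<lfloor>b\<rfloor> + p) \<le> (of_int (- 1) :: real)" by (simp only: of_int_le_iff)
      then show ?thesis unfolding eq e_def using f by simp
    qed
  qed
  moreover have "0 < e" using f by (simp add: e_def)
  ultimately show ?thesis by blast
qed

text \<open>Finitely many \<open>q\<close> violate the bound with constant 1, and each keeps a
  positive distance from the integers, since an exact zero would recur at all positive multiples of
  \<open>q\<close>. The least of these distances, cut off at 1, is the constant.\<close>

lemma not_approximable_bound: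
  fixes y :: "real^'n"
  assumes v: "0 < v" and na: "\<not> approximable v y"
  shows "\<exists>d>0. d \<le> 1 \<and> (\<forall>q (p::int). int_vec q \<longrightarrow> q \<noteq> 0 \<longrightarrow> d * norm q powr (- v) \<le> \<bar>y \<bullet> q + of_int p\<bar>)"
proof -
  define S where "S = {q. int_vec q \<and> (\<exists>p::int. \<bar>y \<bullet> q + of_int p\<bar> < norm q powr (- v))}"
  have fin: "finite S" using na by (simp add: approximable_def S_def)
  have "y \<bullet> q + of_int p \<noteq> 0" if q: "int_vec q" "q \<noteq> 0" for q and p :: int
  proof
    assume z: "y \<bullet> q + of_int p = 0"
    have "of_nat (Suc n) *\<^sub>R q \<in> S" for n
    proof -
      have "y \<bullet> (of_nat (Suc n) *\<^sub>R q) + of_int (int (Suc n) * p) = real (Suc n) * (y \<bullet> q + of_int p)"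
        by (simp add: algebra_simps)
      then have "y \<bullet> (of_nat (Suc n) *\<^sub>R q) + of_int (int (Suc n) * p) = 0" using z by simp
      moreover have "0 < norm (of_nat (Suc n) *\<^sub>R q) powr (- v)" using q(2) by simp
      ultimately have "\<exists>p::int. \<bar>y \<bullet> (of_nat (Suc n) *\<^sub>R q) + of_int p\<bar> < norm (of_nat (Suc n) *\<^sub>R q) powr (- v)"
        by (metis abs_zero)
      moreover have "int_vec (of_nat (Suc n) *\<^sub>R q)" using q(1) by (auto simp: int_vec_def intro!: Ints_mult Ints_add)
      ultimately show ?thesis unfolding S_def by blast
    qed
    then have "range (\<lambda>n. of_nat (Suc n) *\<^sub>R q) \<subseteq> S" by blast
    moreover have "inj (\<lambda>n. of_nat (Suc n) *\<^sub>R q)" using q(2) by (auto simp: inj_def)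
    ultimately show False using fin range_inj_infinite finite_subset by blast
  qed
  then have "\<exists>e>0. \<forall>p::int. e \<le> \<bar>y \<bullet> q + of_int p\<bar>" if "int_vec q" "q \<noteq> 0" for q
    using distance_to_integers that by blast
  then obtain e where e: "\<And>q. int_vec q \<Longrightarrow> q \<noteq> 0 \<Longrightarrow> 0 < e q"
    "\<And>q p. int_vec q \<Longrightarrow> q \<noteq> 0 \<Longrightarrow> e q \<le> \<bar>y \<bullet> q + of_int (p::int)\<bar>" by metis
  have S: "int_vec q" "q \<noteq> 0" if "q \<in> S" for q using that by (auto simp: S_def)
  define d where "d = Min (insert 1 (e ` S))"
  have d: "0 < d" "d \<le> 1" "\<And>q. q \<in> S \<Longrightarrow> d \<le> e q"
    using fin e(1) S by (auto simp: d_def)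
  have "d * norm q powr (- v) \<le> \<bar>y \<bullet> q + of_int p\<bar>" if q: "int_vec q" "q \<noteq> 0" for q and p :: int
  proof (cases "q \<in> S")
    case True
    have "norm q powr (- v) \<le> norm q powr 0" using int_vec_norm_ge_1[OF q] v by (intro powr_mono) auto
    then have "norm q powr (- v) \<le> 1" using q(2) by simp
    then have "d * norm q powr (- v) \<le> d * 1" using d(1) by (intro mult_left_mono) auto
    also have "\<dots> \<le> \<bar>y \<bullet> q + of_int p\<bar>" using d(3)[OF True] e(2)[OF q, of p] by linarith
    finally show ?thesis .
  next
    case False
    then have "norm q powr (- v) \<le> \<bar>y \<bullet> q + of_int p\<bar>" using q(1) by (auto simp: S_def not_less)
    moreover have "d * norm q powr (- v) \<le> 1 * norm q powr (- v)" using d(2) by (intro mult_right_mono) auto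
    ultimately show ?thesis by linarith
  qed
  then show ?thesis using d(1,2) by blast
qed

text \<open>Dirichlet's theorem in one coordinate, with 1/2 leaving room to beat the constant
  \<open>d\<close>. It makes exponents of points positive, so that the main argument may assume
  \<open>0 < v\<close>.\<close>

lemma approximable_half: "approximable (1 / 2) (y :: real^'n)"
proof (rule ccontr)
  assume "\<not> ?thesis"
  then obtain d where d: "0 < d" "\<And>q (p::int). int_vec q \<Longrightarrow> q \<noteq> 0 \<Longrightarrow> d * norm q powr (- (1 / 2)) \<le> \<bar>y \<bullet> q + of_int p\<bar>"
    using not_approximable_bound[of "1 / 2" y] by auto
  obtain N :: nat where N: "1 / d ^ 2 < real N" using reals_Archimedean2 by blast
  have "0 < real N" using N d(1) by (smt (verit) divide_pos_pos zero_less_power)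
  then have N0: "0 < N" by simp
  define i :: 'n where "i = undefined"
  obtain h k where hk: "0 < k" "k \<le> int N" "\<bar>of_int k * (y $ i) - of_int h\<bar> < 1 / real N"
    using Dirichlet_approx[OF N0, of "y $ i"] by blast
  define q where "q = (of_int k :: real) *\<^sub>R axis i (1::real)"
  have q: "int_vec q" "q \<noteq> 0" "norm q = of_int k" "y \<bullet> q = of_int k * (y $ i)"
  proof -
    show "int_vec q" by (simp add: q_def int_vec_def axis_def)
    show "q \<noteq> 0" "norm q = of_int k" "y \<bullet> q = of_int k * (y $ i)"
      using hk(1) by (simp_all add: q_def inner_axis axis_eq_0_iff)
  qed
  have "d * real N powr (- (1 / 2)) \<le> d * norm q powr (- (1 / 2))"
    using d(1) hk(1,2) q(3) \<open>0 < real N\<close> by (intro mult_left_mono powr_mono2') auto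
  also have "\<dots> \<le> \<bar>y \<bullet> q + of_int (- h)\<bar>" by (rule d(2)[OF q(1,2)])
  also have "\<dots> < 1 / real N" using hk(3) q(4) by simp
  finally have "d * real N powr (- (1 / 2)) < 1 / real N" .
  then have "d * (real N powr (- (1 / 2)) * real N) < 1" using \<open>0 < real N\<close> by (simp add: field_simps)
  also have "real N powr (- (1 / 2)) * real N = real N powr (1 / 2)"
  proof -
    have "real N powr (- (1 / 2)) * real N powr 1 = real N powr (1 / 2)" unfolding powr_add[symmetric] by simp
    then show ?thesis using \<open>0 < real N\<close> by simp
  qed
  finally have "d * sqrt (real N) < 1" by (simp add: powr_half_sqrt)
  then have "(d * sqrt (real N)) ^ 2 < 1 ^ 2" using d(1) by (intro power_strict_mono) auto
  then have "d ^ 2 * real N < 1" by (simp add: power_mult_distrib)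
  then show False using N d(1) by (simp add: field_simps)
qed

lemma dio_exp_pos: "0 < dio_exp (y :: real^'n)"
proof -
  have "ereal (1 / 2) \<le> dio_exp y"
    unfolding dio_exp_eq using approximable_half[of y] by (intro Sup_upper) (auto intro!: exI[of _ "1 / 2"])
  then show ?thesis by (rule less_le_trans[rotated]) simp
qed

lemma dio_exp_gt_imp_approximable:
  assumes "ereal v < dio_exp y"
  shows "approximable v y"
proof -
  obtain s where "s \<in> {ereal v | v. v > 0 \<and> approximable v y}" "ereal v < s"
    using assms unfolding dio_exp_eq less_Sup_iff by (elim bexE)
  then obtain v1 where "approximable v1 y" "v < v1" by auto
  then show ?thesis by (rule approximable_mono[OF _ less_imp_le])
qed

lemma null_in_subset: "null_in TYPE('d::finite) M B \<Longrightarrow> A \<subseteq> B \<Longrightarrow> null_in TYPE('d) M A"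
  unfolding null_in_def negligible_iff_null_sets[symmetric]
proof (intro allI impI)
  fix U :: "(real^'d) set" and f
  assume "\<forall>(U :: (real^'d) set) f. is_chart U f M \<longrightarrow> negligible (f -` B \<inter> U)" "A \<subseteq> B" "is_chart U f M"
  then have "negligible (f -` B \<inter> U)" "f -` A \<inter> U \<subseteq> f -` B \<inter> U" by auto
  then show "negligible (f -` A \<inter> U)" by (rule negligible_subset)
qed

text \<open>Two exponents are inserted between the values to be compared: the lower one supplies the
  Diophantine bound at \<open>y0\<close>, the upper one the null set, and the nondivergence argument
  consumes their gap.\<close>

lemma dio_exp_mfd_le:
  fixes L M :: "(real^'n::finite) set"
  assumes L: "affine L" and nd: "mfd_nondeg TYPE('d::finite) L M" and y0: "y0 \<in> L"
  shows "dio_exp_mfd TYPE('d) M \<le> dio_exp y0"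
proof (rule ccontr)
  assume "\<not> ?thesis"
  then obtain s where "s \<in> {ereal v | v. \<not> null_in TYPE('d) M {y \<in> M. dio_exp y > ereal v}}" "dio_exp y0 < s"
    unfolding dio_exp_mfd_def not_le less_Sup_iff by (elim bexE)
  then obtain v' where v': "\<not> null_in TYPE('d) M {y \<in> M. dio_exp y > ereal v'}" "dio_exp y0 < ereal v'" by blast
  obtain v where v: "dio_exp y0 < ereal v" "ereal v < ereal v'" using ereal_dense2[OF v'(2)] by blast
  have "0 < ereal v" using dio_exp_pos v(1) by (rule less_trans)
  then have v0: "0 < v" "v < v'" using v(2) by auto
  have "\<not> approximable v y0"
  proof
    assume "approximable v y0"
    then have "ereal v \<le> dio_exp y0" unfolding dio_exp_eq using v0(1) by (intro Sup_upper) auto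
    then show False using v(1) by simp
  qed
  then obtain d where d: "0 < d" "d \<le> 1"
    "\<And>q (p::int). int_vec q \<Longrightarrow> q \<noteq> 0 \<Longrightarrow> d * norm q powr (- v) \<le> \<bar>y0 \<bullet> q + of_int p\<bar>"
    using not_approximable_bound[OF v0(1)] by blast
  have "null_in TYPE('d) M {y \<in> M. approximable v' y}"
    by (rule null_in_approximable[OF L nd y0 v0 d])
  then have "null_in TYPE('d) M {y \<in> M. dio_exp y > ereal v'}"
    by (rule null_in_subset) (auto intro: dio_exp_gt_imp_approximable)
  then show False using v'(1) by contradiction
qed

text \<open>A level below the infimum is exceeded on all of \<open>M\<close>, and a chart domain,
  being open and nonempty, is not null.\<close>

lemma dio_exp_mfd_ge:
  fixes M :: "(real^'n::finite) set"
  assumes M: "submanifold TYPE('d::finite) M" "M \<noteq> {}"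
  shows "(INF y\<in>M. dio_exp y) \<le> dio_exp_mfd TYPE('d) M"
proof (rule ccontr)
  assume "\<not> ?thesis"
  then obtain b where b: "dio_exp_mfd TYPE('d) M < ereal b" "ereal b < (INF y\<in>M. dio_exp y)"
    using ereal_dense2 unfolding not_le by blast
  have "ereal b < dio_exp y" if "y \<in> M" for y
    using b(2) INF_lower[OF that, of dio_exp] by (rule less_le_trans)
  then have all: "{y \<in> M. dio_exp y > ereal b} = M" by auto
  obtain y where "y \<in> M" using M(2) by blast
  then obtain U :: "(real^'d) set" and f where f: "is_chart U f M" "y \<in> f ` U"
    using M(1) unfolding submanifold_def by blast
  have "\<not> null_in TYPE('d) M {y \<in> M. dio_exp y > ereal b}"
  proof
    assume "null_in TYPE('d) M {y \<in> M. dio_exp y > ereal b}"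
    then have "negligible (f -` M \<inter> U)"
      unfolding all null_in_def negligible_iff_null_sets using f(1) by blast
    moreover have "f -` M \<inter> U = U" using f(1) by (auto simp: is_chart_def)
    ultimately have "negligible U" by simp
    then show False using f open_not_negligible by (auto simp: is_chart_def)
  qed
  then have "ereal b \<le> dio_exp_mfd TYPE('d) M" unfolding dio_exp_mfd_def by (intro Sup_upper) blast
  then show False using b(1) by simp
qed

section \<open>Affine subspaces as nondegenerate submanifolds\<close>

lemma pderivs_affine:
  fixes h :: "real^'d::finite \<Rightarrow> real^'n"
  assumes h: "linear h"
  shows "pderivs [i] (\<lambda>x. a + h x) = (\<lambda>_. h (axis i 1))"
    and "is \<noteq> [] \<Longrightarrow> \<exists>c. pderivs is (\<lambda>x. a + h x) = (\<lambda>_. c)"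
proof -
  have "((\<lambda>x. a + h x) has_derivative h) (at x)" for x
    using linear_imp_has_derivative[OF h] by (auto intro!: derivative_eq_intros)
  then have D: "frechet_derivative (\<lambda>x. a + h x) (at x) = h" for x
    using frechet_derivative_at by metis
  then show 1: "pderivs [i] (\<lambda>x. a + h x) = (\<lambda>_. h (axis i 1))" for i by (simp add: pderiv1_def fun_eq_iff)
  show "is \<noteq> [] \<Longrightarrow> \<exists>c. pderivs is (\<lambda>x. a + h x) = (\<lambda>_. c)"
  proof (induction "is")
    case (Cons i "is")
    show ?case
    proof (cases "is = []")
      case True
      then show ?thesis using 1 by blast
    next
      case False
      then obtain c where c: "pderivs is (\<lambda>x. a + h x) = (\<lambda>_. c)" using Cons.IH by blast
      have "pderivs (i # is) (\<lambda>x. a + h x) = (\<lambda>_. 0)"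
        unfolding pderivs.simps c by (simp add: pderiv1_def fun_eq_iff)
      then show ?thesis by blast
    qed
  qed simp
qed

text \<open>A linear isometry onto the direction of \<open>L\<close>, shifted by a point of
  \<open>L\<close>, is a global chart whose first partial derivatives already span that direction.
  So the results for \<open>M\<close> apply to \<open>L\<close> itself.\<close>

lemma affine_chart:
  fixes L :: "(real^'n::finite) set"
  assumes L: "affine L" "aff_dim L = int CARD('k::finite)"
  shows "\<exists>f :: real^'k \<Rightarrow> real^'n. is_chart UNIV f L \<and> range f = L \<and> (\<forall>x. nondeg_at L f UNIV x)"
proof -
  have "L \<noteq> {}" using L(2) by auto
  then obtain a where a: "a \<in> L" by blast
  have V: "lin_part L = (\<lambda>x. x - a) ` L" "subspace (lin_part L)" using lin_part_eq[OF L(1) a] .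
  have La: "L = (+) a ` lin_part L" by (auto simp: V(1) image_image)
  have "dim (lin_part L) = CARD('k)"
  proof -
    have "aff_dim L = aff_dim (lin_part L)" by (subst La) (rule aff_dim_translation_eq)
    also have "\<dots> = int (dim (lin_part L))" using V(2) by (rule aff_dim_subspace)
    finally show ?thesis using L(2) by simp
  qed
  then obtain h :: "real^'k \<Rightarrow> real^'n" where h: "linear h" "range h = lin_part L" "\<And>x. norm (h x) = norm x"
    using isometry_subspaces[of "UNIV :: (real^'k) set" "lin_part L"] V(2) by (auto simp: dim_UNIV)
  have injh: "inj h" using linear_injective_0[OF h(1)] h(3) by (metis norm_eq_zero)
  define f where "f x = a + h x" for x
  have D: "(f has_derivative h) (at x)" for x
    unfolding f_def using linear_imp_has_derivative[OF h(1)] by (auto intro!: derivative_eq_intros)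
  then have Df: "frechet_derivative f (at x) = h" for x using frechet_derivative_at by metis
  have rf: "range f = L" by (subst La) (auto simp: f_def h(2)[symmetric])
  have smooth: "smooth_on UNIV f"
    unfolding smooth_on_def
  proof (intro allI ballI)
    fix "is" x
    show "pderivs is f differentiable (at x)"
    proof (cases "is = []")
      case True
      then show ?thesis using D differentiableI by auto
    next
      case False
      then obtain c where "pderivs is f = (\<lambda>_. c)" using pderivs_affine(2)[OF h(1)] unfolding f_def[abs_def] by blast
      then show ?thesis by simp
    qed
  qed
  obtain g' where g': "linear g'" "g' \<circ> h = id" using linear_injective_left_inverse[OF h(1) injh] by blast
  have "homeomorphism UNIV (range f) f (\<lambda>y. g' (y - a))"
  proof (rule homeomorphismI)
    show "continuous_on UNIV f" using D by (meson continuous_at_imp_continuous_on has_derivative_continuous)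
    show "continuous_on (range f) (\<lambda>y. g' (y - a))"
      by (intro linear_continuous_on_compose[OF _ g'(1)] continuous_intros)
    show "g' (f x - a) = x" for x using g'(2) by (simp add: f_def o_def fun_eq_iff id_def)
    then show "f (g' (y - a)) = y" if "y \<in> range f" for y using that by auto
  qed auto
  then have chart: "is_chart UNIV f L"
    unfolding is_chart_def Df using smooth rf injh by auto
  have "nondeg_at L f UNIV x" for x
    unfolding nondeg_at_def
  proof (intro conjI exI[of _ 1])
    show "range f \<subseteq> L" using rf by simp
    have "{pderivs is f x | is. 1 \<le> length is \<and> length is \<le> 1} = h ` range (\<lambda>i. axis i 1)"
    proof -
      have one: "pderivs [i] f x = h (axis i 1)" for i using pderivs_affine(1)[OF h(1), of i a] unfolding f_def[abs_def] by metis
      have "{is. 1 \<le> length is \<and> length is \<le> 1} = range (\<lambda>i :: 'k. [i])"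
      proof (intro set_eqI iffI)
        fix "is" :: "'k list" assume "is \<in> {is. 1 \<le> length is \<and> length is \<le> 1}"
        then show "is \<in> range (\<lambda>i. [i])" by (cases "is") auto
      qed auto
      then show ?thesis unfolding setcompr_eq_image by (simp only: image_image one)
    qed
    then have "span {pderivs is f x | is. 1 \<le> length is \<and> length is \<le> 1} = h ` span (range (\<lambda>i. axis i 1))"
      by (simp only: linear_span_image[OF h(1)])
    also have "span (range (\<lambda>i. axis i (1::real))) = (UNIV :: (real^'k) set)"
    proof -
      have "(x :: real^'k) \<in> span (range (\<lambda>i. axis i 1))" for x
      proof -
        have "(\<Sum>i\<in>UNIV. x $ i *\<^sub>R axis i 1) \<in> span (range (\<lambda>i. axis i (1::real)))"
          by (intro span_sum span_scale span_base) auto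
        then show ?thesis using basis_expansion[of x] by (simp add: scalar_mult_eq_scaleR)
      qed
      then show ?thesis by blast
    qed
    finally show "span {pderivs is f x | is. 1 \<le> length is \<and> length is \<le> 1} = lin_part L" using h(2) by simp
  qed
  then show ?thesis using chart rf by blast
qed

theorem theorem0p3:
  fixes L M :: "(real^'n) set"
  assumes "affine L" and "aff_dim L = int CARD('k::finite)"
    and "submanifold TYPE('d::finite) M" and "M \<noteq> {}" and "M \<subseteq> L"
    and "mfd_nondeg TYPE('d) L M"
  shows "dio_exp_mfd TYPE('d) M = dio_exp_mfd TYPE('k) L
       \<and> dio_exp_mfd TYPE('k) L = (INF y\<in>L. dio_exp y)
       \<and> (INF y\<in>L. dio_exp y) = (INF y\<in>M. dio_exp y)"
proof -
  obtain f :: "real^'k \<Rightarrow> real^'n" where f: "is_chart UNIV f L" "range f = L" "\<And>x. nondeg_at L f UNIV x"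
    using affine_chart[OF assms(1,2)] by blast
  have "submanifold TYPE('k) L" unfolding submanifold_def using f(1,2) by blast
  moreover have "mfd_nondeg_at TYPE('k) L L y" if "y \<in> L" for y
    unfolding mfd_nondeg_at_def using f that by blast
  then have e: "{y \<in> L. \<not> mfd_nondeg_at TYPE('k) L L y} = {}" by blast
  have "mfd_nondeg TYPE('k) L L" unfolding mfd_nondeg_def null_in_def e by simp
  ultimately have L: "dio_exp_mfd TYPE('k) L \<le> (INF y\<in>L. dio_exp y)" "(INF y\<in>L. dio_exp y) \<le> dio_exp_mfd TYPE('k) L"
    using dio_exp_mfd_le[OF assms(1)] dio_exp_mfd_ge assms(4,5) by (auto intro!: INF_greatest)
  have M: "dio_exp_mfd TYPE('d) M \<le> (INF y\<in>L. dio_exp y)" "(INF y\<in>M. dio_exp y) \<le> dio_exp_mfd TYPE('d) M"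
    using dio_exp_mfd_le[OF assms(1,6)] dio_exp_mfd_ge[OF assms(3,4)] by (auto intro!: INF_greatest)
  \<comment> \<open>With the two inequalities for \<open>M\<close> this closes the circle of
    inequalities.\<close>
  have "(INF y\<in>L. dio_exp y) \<le> (INF y\<in>M. dio_exp y)"
    by (rule INF_superset_mono[OF assms(5)]) simp
  then show ?thesis using L M by (metis antisym order_trans)
qed

end
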